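(* Suppose $n$ is an even integer with $t_1\leq n<\min\{t_2,t_3\}$, and put $K=k_1+k_2+k_3$. Then: (i) the $\mathfrak{BI}$-module $\mathscr M_n(x_1)$ is isomorphic to $W_1\oplus W_1$, where $W_1=E_{n-t_1}\big(k_2+\tfrac{n+1}{2},\,-K-\tfrac{n+1}{2},\,-k_3-\tfrac{n+1}{2}\big)^{((-1,1),(1\,2\,3))}$; (ii) the $\mathfrak{BI}$-module $\mathscr M_n/\mathscr M_n(x_1)$ is isomorphic to $W_2\oplus W_2$, where $W_2=O_{t_1-1}(k_2,\,-K-n-1,\,-k_3)^{((1,-1),(1\,2\,3))}$. Moreover, if $k_2,k_3\geq0$, then $W_1,W_2$ are irreducible and isomorphic to $E_{n-t_1}\big(K+\tfrac{n+1}{2},\,k_3+\tfrac{n+1}{2},\,k_2+\tfrac{n+1}{2}\big)^{(1,-1)}$ and $O_{t_1-1}(K+n+1,\,k_3,\,k_2)$, respectively.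
   Context: Fix real numbers $k_1,k_2,k_3$. For $i=1,2,3$ let $R_i$ be the operator on functions on $\mathbb R^3$ replacing $x_i$ by $-x_i$, and $T_if=\frac{\partial f}{\partial x_i}+k_i\frac{f-R_if}{x_i}$ (Dunkl operators). Let $\sigma_1=\begin{pmatrix}0&1\\1&0\end{pmatrix}$, $\sigma_2=\begin{pmatrix}0&-\sqrt{-1}\\ \sqrt{-1}&0\end{pmatrix}$, $\sigma_3=\begin{pmatrix}1&0\\0&-1\end{pmatrix}$, and let $e_i$ act on $\mathbb C^2$ by $\sigma_i$. Tensor products are over $\mathbb R$; $\mathbb R[\cdots]_m$ denotes homogeneous polynomials of degree $m$. Let $\mathbf D=e_1\otimes T_1+e_2\otimes T_2+e_3\otimes T_3$ and $\mathscr M_n=\ker(\mathbf D|_{\mathbb C^2\otimes\mathbb R[x_1,x_2,x_3]_n})$. For $i=1,2,3$ set $t_i=-2k_i$ if $2k_i$ is an odd negative integer, and $t_i=\infty$ otherwise. For $i=1,2,3$, $\mathscr M_n(x_i)=\mathscr M_n\cap\bigoplus_{j=t_i}^n\mathbb C^2\otimes(x_i^j\cdot\mathbb R[x_p,x_q]_{n-j})$ where $\{p,q\}=\{1,2,3\}\setminus\{i\}$ (it is $\{0\}$ if $n<t_i$); it is a $\mathfrak{BI}$-submodule of $\mathscr M_n$. $\mathfrak{BI}$ is the unital associative $\mathbb C$-algebra generated by $X,Y,Z$ with relations saying that $\{X,Y\}-Z$, $\{Y,Z\}-X$, $\{Z,X\}-Y$ commute with $X,Y,Z$ ($\{A,B\}=AB+BA$).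 $\mathscr M_n$ is a $\mathfrak{BI}$-module via $X=(\sqrt{-1}\,e_1\otimes(x_3T_2-x_2T_3)+\tfrac12)R_2R_3+k_2R_3+k_3R_2$, $Y=(\sqrt{-1}\,e_2\otimes(x_1T_3-x_3T_1)+\tfrac12)R_1R_3+k_3R_1+k_1R_3$, $Z=(\sqrt{-1}\,e_3\otimes(x_2T_1-x_1T_2)+\tfrac12)R_1R_2+k_1R_2+k_2R_1$, operators composed right to left, $R_i$ acting on the polynomial factor. Twisting: for a $\mathfrak{BI}$-module $V$ and algebra automorphism $\varepsilon$, $V^\varepsilon$ is $V$ with action $x\cdot v=\varepsilon(x)v$. Write $(W_1,W_2,W_3)=(X,Y,Z)$. A permutation $\sigma\in\mathfrak S_3$ denotes the automorphism $W_i\mapsto W_{\sigma(i)}$; the sign automorphisms are $(1,-1)\colon X\mapsto X,Y\mapsto -Y,Z\mapsto -Z$; $(-1,1)\colon X\mapsto -X,Y\mapsto Y,Z\mapsto -Z$; $(-1,-1)\colon X\mapsto -X,Y\mapsto -Y,Z\mapsto Z$; a pair $(\epsilon,\sigma)$ denotes the composite $\epsilon\circ\sigma$. For $a,b,c\in\mathbb C$ and an integer $d\geq0$, let $\theta_i=\frac{(-1)^i(2a-d+2i)}{2}$, $\theta^*_i=\frac{(-1)^i(2b-d+2i)}{2}$ ($0\le i\le d$). For odd $d$, $E_d(a,b,c)$ is the $\mathfrak{BI}$-module $\mathbb C^{d+1}$ in which, w.r.t. a basis $v_0,\dots,v_d$, $X$ acts by the lower bidiagonal matrix with diagonal $(\theta_i)$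 and subdiagonal entries $1$, $Y$ by the upper bidiagonal matrix with diagonal $(\theta^*_i)$ and superdiagonal $(\varphi_1,\dots,\varphi_d)$ with $\varphi_i=i(d-i+1)$ ($i$ even), $\varphi_i=c^2-\frac{(2a+2b-d+2i-1)^2}{4}$ ($i$ odd), and $Z=\{X,Y\}-\big(c^2-a^2-b^2+\frac{(d+1)^2}{4}\big)$. For even $d$, $O_d(a,b,c)$ is defined in the same way but with $\varphi_i=\frac{i(d+1-2i-2a-2b-2c)}{2}$ ($i$ even), $\varphi_i=\frac{(i-d-1)(d+1-2i-2a-2b+2c)}{2}$ ($i$ odd), and $Z=\{X,Y\}-(2ab-c(d+1))$. *)

theory Defs
  imports Complex_Main "HOL-Library.Function_Algebras" "HOL-Library.Extended_Nat"
begin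

text \<open>All vector spaces are spaces of complex-valued functions on an index type,
  with pointwise addition and the scalar multiplication below.\<close>

definition vsc :: "complex \<Rightarrow> ('i \<Rightarrow> complex) \<Rightarrow> ('i \<Rightarrow> complex)" where
  "vsc c v = (\<lambda>i. c * v i)"

type_synonym 'i vop = "('i \<Rightarrow> complex) \<Rightarrow> ('i \<Rightarrow> complex)"

type_synonym 'i bimod = "('i \<Rightarrow> complex) set \<times> 'i vop \<times> 'i vop \<times> 'i vop"

definition car :: "'i bimod \<Rightarrow> ('i \<Rightarrow> complex) set" where "car M = fst M"
definition actX :: "'i bimod \<Rightarrow> 'i vop" where "actX M = fst (snd M)"
definition actY :: "'i bimod \<Rightarrow> 'i vop" where "actY M = fst (snd (snd M))"
definition actZ :: "'i bimod \<Rightarrow> 'i vop" where "actZ M = snd (snd (snd M))"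

definition lin_on :: "('i \<Rightarrow> complex) set \<Rightarrow> (('i \<Rightarrow> complex) \<Rightarrow> ('j \<Rightarrow> complex)) \<Rightarrow> bool" where
  "lin_on V f \<longleftrightarrow> (\<forall>u\<in>V. \<forall>w\<in>V. f (u + w) = f u + f w) \<and> (\<forall>c. \<forall>u\<in>V. f (vsc c u) = vsc c (f u))"

definition intertwines :: "'i bimod \<Rightarrow> 'j bimod \<Rightarrow> (('i \<Rightarrow> complex) \<Rightarrow> ('j \<Rightarrow> complex)) \<Rightarrow> bool" where
  "intertwines M N f \<longleftrightarrow> (\<forall>v\<in>car M. f (actX M v) = actX N (f v) \<and> f (actY M v) = actY N (f v)
                                      \<and> f (actZ M v) = actZ N (f v))"

definition bimod_iso :: "'i bimod \<Rightarrow> 'j bimod \<Rightarrow> bool" where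
  "bimod_iso M N \<longleftrightarrow> (\<exists>f. lin_on (car M) f \<and> bij_betw f (car M) (car N) \<and> intertwines M N f)"

text \<open>The quotient module M/N is isomorphic to W (N a submodule of M): expressed through
  the first isomorphism theorem, i.e. there is a surjective module homomorphism M \<rightarrow> W
  with kernel exactly N.\<close>
definition quot_iso :: "'i bimod \<Rightarrow> 'i bimod \<Rightarrow> 'j bimod \<Rightarrow> bool" where
  "quot_iso M N W \<longleftrightarrow> (\<exists>f. lin_on (car M) f \<and> f ` car M = car W \<and>
       {v \<in> car M. f v = 0} = car N \<and> intertwines M W f)"

definition subspace_of :: "('i \<Rightarrow> complex) set \<Rightarrow> ('i \<Rightarrow> complex) set \<Rightarrow> bool" where
  "subspace_of U V \<longleftrightarrow> U \<subseteq> V \<and> 0 \<in> U \<and> (\<forall>u\<in>U. \<forall>w\<in>U. u + w \<in> U) \<and> (\<forall>c. \<forall>u\<in>U. vsc c u \<in> U)"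

definition irreducible_mod :: "'i bimod \<Rightarrow> bool" where
  "irreducible_mod M \<longleftrightarrow> car M \<noteq> {0} \<and>
     (\<forall>U. subspace_of U (car M) \<and> actX M ` U \<subseteq> U \<and> actY M ` U \<subseteq> U \<and> actZ M ` U \<subseteq> U
          \<longrightarrow> U = {0} \<or> U = car M)"

definition dsum2 :: "'i bimod \<Rightarrow> (bool \<times> 'i) bimod" where
  "dsum2 M = ({w. (\<lambda>j. w (False, j)) \<in> car M \<and> (\<lambda>j. w (True, j)) \<in> car M},
     (\<lambda>w (s, i). actX M (\<lambda>j. w (s, j)) i),
     (\<lambda>w (s, i). actY M (\<lambda>j. w (s, j)) i),
     (\<lambda>w (s, i). actZ M (\<lambda>j. w (s, j)) i))"

text \<open>Twisting. Sign automorphism (e1,e2,e3): X \<mapsto> e1 X, Y \<mapsto> e2 Y, Z \<mapsto> e3 Z;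
  the cycle (1 2 3): X \<mapsto> Y, Y \<mapsto> Z, Z \<mapsto> X.  In V^\<epsilon> the generator x acts by \<epsilon>(x).\<close>
definition twist_sgn :: "complex \<Rightarrow> complex \<Rightarrow> complex \<Rightarrow> 'i bimod \<Rightarrow> 'i bimod" where
  "twist_sgn e1 e2 e3 M = (car M, \<lambda>v. vsc e1 (actX M v), \<lambda>v. vsc e2 (actY M v), \<lambda>v. vsc e3 (actZ M v))"

definition twist_123 :: "'i bimod \<Rightarrow> 'i bimod" where
  "twist_123 M = (car M, actY M, actZ M, actX M)"

text \<open>Twist by the composite automorphism (\<epsilon>, (1 2 3)) = \<epsilon> \<circ> (1 2 3):
  x acts by \<epsilon>((1 2 3)(x)), i.e. V^{\<epsilon>\<circ>\<sigma>} = (V^\<epsilon>)^\<sigma>.\<close>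
definition twist_sgn_123 :: "complex \<Rightarrow> complex \<Rightarrow> complex \<Rightarrow> 'i bimod \<Rightarrow> 'i bimod" where
  "twist_sgn_123 e1 e2 e3 M = twist_123 (twist_sgn e1 e2 e3 M)"

text \<open>Coordinates w.r.t. the basis v_0..v_d: vectors nat \<Rightarrow> complex supported in {0..d}.\<close>
definition bidiagX :: "nat \<Rightarrow> (nat \<Rightarrow> complex) \<Rightarrow> nat vop" where
  "bidiagX d th w = (\<lambda>i. if i \<le> d then th i * w i + (if i = 0 then 0 else w (i - 1)) else 0)"

definition bidiagY :: "nat \<Rightarrow> (nat \<Rightarrow> complex) \<Rightarrow> (nat \<Rightarrow> complex) \<Rightarrow> nat vop" where
  "bidiagY d ths ph w = (\<lambda>i. if i \<le> d then ths i * w i + (if i < d then ph (i + 1) * w (i + 1) else 0) else 0)"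

definition bidiag_mod :: "nat \<Rightarrow> (nat \<Rightarrow> complex) \<Rightarrow> (nat \<Rightarrow> complex) \<Rightarrow> (nat \<Rightarrow> complex) \<Rightarrow> complex \<Rightarrow> nat bimod" where
  "bidiag_mod d th ths ph kap =
     ({w. \<forall>i>d. w i = 0}, bidiagX d th, bidiagY d ths ph,
      \<lambda>w. bidiagX d th (bidiagY d ths ph w) + bidiagY d ths ph (bidiagX d th w) - vsc kap w)"

definition theta :: "nat \<Rightarrow> complex \<Rightarrow> nat \<Rightarrow> complex" where
  "theta d a i = (-1) ^ i * (2 * a - of_nat d + 2 * of_nat i) / 2"

definition Emod :: "nat \<Rightarrow> complex \<Rightarrow> complex \<Rightarrow> complex \<Rightarrow> nat bimod" where
  "Emod d a b c = bidiag_mod d (theta d a) (theta d b)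
     (\<lambda>i. if even i then of_nat i * (of_nat d - of_nat i + 1)
          else c ^ 2 - (2 * a + 2 * b - of_nat d + 2 * of_nat i - 1) ^ 2 / 4)
     (c ^ 2 - a ^ 2 - b ^ 2 + (of_nat d + 1) ^ 2 / 4)"

definition Omod :: "nat \<Rightarrow> complex \<Rightarrow> complex \<Rightarrow> complex \<Rightarrow> nat bimod" where
  "Omod d a b c = bidiag_mod d (theta d a) (theta d b)
     (\<lambda>i. if even i then of_nat i * (of_nat d + 1 - 2 * of_nat i - 2 * a - 2 * b - 2 * c) / 2
          else (of_nat i - of_nat d - 1) * (of_nat d + 1 - 2 * of_nat i - 2 * a - 2 * b + 2 * c) / 2)
     (2 * a * b - c * (of_nat d + 1))"

text \<open>An element of C^2 \<otimes>_R R[x1,x2,x3] is given by its coefficients: p (s,(a,b,c)) is the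
  coefficient of x1^a x2^b x3^c in component s of C^2 (False = first, True = second).\<close>
type_synonym mono = "nat \<times> nat \<times> nat"
type_synonym cpol = "bool \<times> mono \<Rightarrow> complex"

definition expo :: "nat \<Rightarrow> mono \<Rightarrow> nat" where
  "expo i m = (case m of (a, b, c) \<Rightarrow> if i = 1 then a else if i = 2 then b else c)"

definition incr :: "nat \<Rightarrow> mono \<Rightarrow> mono" where
  "incr i m = (case m of (a, b, c) \<Rightarrow>
     if i = 1 then (a + 1, b, c) else if i = 2 then (a, b + 1, c) else (a, b, c + 1))"

definition decr :: "nat \<Rightarrow> mono \<Rightarrow> mono" where
  "decr i m = (case m of (a, b, c) \<Rightarrow>
     if i = 1 then (a - 1, b, c) else if i = 2 then (a, b - 1, c) else (a, b, c - 1))"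

definition pdx :: "nat \<Rightarrow> cpol \<Rightarrow> cpol" where
  "pdx i p = (\<lambda>(s, m). of_nat (expo i m + 1) * p (s, incr i m))"

definition refl :: "nat \<Rightarrow> cpol \<Rightarrow> cpol" where
  "refl i p = (\<lambda>(s, m). (-1) ^ expo i m * p (s, m))"

text \<open>division by x_i (exact for polynomials divisible by x_i)\<close>
definition divx :: "nat \<Rightarrow> cpol \<Rightarrow> cpol" where
  "divx i p = (\<lambda>(s, m). p (s, incr i m))"

definition mulx :: "nat \<Rightarrow> cpol \<Rightarrow> cpol" where
  "mulx i p = (\<lambda>(s, m). if expo i m = 0 then 0 else p (s, decr i m))"

definition dunkl :: "(nat \<Rightarrow> real) \<Rightarrow> nat \<Rightarrow> cpol \<Rightarrow> cpol" where
  "dunkl k i p = pdx i p + vsc (complex_of_real (k i)) (divx i (p - refl i p))"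

definition pauli :: "nat \<Rightarrow> cpol \<Rightarrow> cpol" where
  "pauli i p = (\<lambda>(s, m).
     if i = 1 then p (\<not> s, m)
     else if i = 2 then (if s then \<i> * p (False, m) else - \<i> * p (True, m))
     else (if s then - p (True, m) else p (False, m)))"

definition dirac :: "(nat \<Rightarrow> real) \<Rightarrow> cpol \<Rightarrow> cpol" where
  "dirac k p = pauli 1 (dunkl k 1 p) + pauli 2 (dunkl k 2 p) + pauli 3 (dunkl k 3 p)"

definition homog :: "nat \<Rightarrow> cpol set" where
  "homog n = {p. \<forall>s a b c. p (s, (a, b, c)) \<noteq> 0 \<longrightarrow> a + b + c = n}"

definition Mn :: "(nat \<Rightarrow> real) \<Rightarrow> nat \<Rightarrow> cpol set" where
  "Mn k n = {p \<in> homog n. dirac k p = 0}"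

definition tpar :: "real \<Rightarrow> enat" where
  "tpar kk = (if \<exists>m::nat. odd m \<and> 2 * kk = - real m then enat (nat \<lfloor>- 2 * kk\<rfloor>) else \<infinity>)"

definition Mnx :: "(nat \<Rightarrow> real) \<Rightarrow> nat \<Rightarrow> nat \<Rightarrow> cpol set" where
  "Mnx k n i = {p \<in> Mn k n. \<forall>s m. enat (expo i m) < tpar (k i) \<longrightarrow> p (s, m) = 0}"

definition bi_op :: "(nat \<Rightarrow> real) \<Rightarrow> nat \<Rightarrow> nat \<Rightarrow> nat \<Rightarrow> nat \<Rightarrow> nat \<Rightarrow> cpol \<Rightarrow> cpol" where
  "bi_op k i q r a b p =
     (let p' = refl a (refl b p) in
        vsc \<i> (pauli i (mulx q (dunkl k r p') - mulx r (dunkl k q p'))) + vsc (1/2) p'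
        + vsc (complex_of_real (k a)) (refl b p) + vsc (complex_of_real (k b)) (refl a p))"

definition opX :: "(nat \<Rightarrow> real) \<Rightarrow> cpol \<Rightarrow> cpol" where "opX k = bi_op k 1 3 2 2 3"
definition opY :: "(nat \<Rightarrow> real) \<Rightarrow> cpol \<Rightarrow> cpol" where "opY k = bi_op k 2 1 3 1 3"
definition opZ :: "(nat \<Rightarrow> real) \<Rightarrow> cpol \<Rightarrow> cpol" where "opZ k = bi_op k 3 2 1 1 2"

definition Mmod :: "(nat \<Rightarrow> real) \<Rightarrow> nat \<Rightarrow> (bool \<times> mono) bimod" where
  "Mmod k n = (Mn k n, opX k, opY k, opZ k)"

definition Mxmod :: "(nat \<Rightarrow> real) \<Rightarrow> nat \<Rightarrow> nat \<Rightarrow> (bool \<times> mono) bimod" where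
  "Mxmod k n i = (Mnx k n i, opX k, opY k, opZ k)"

end

theory Submission
  imports Defs
begin

text \<open>
  Since \<open>n < t\<^sub>2\<close>, an element of the kernel \<open>M\<^sub>n\<close> is determined by its restriction to \<open>x\<^sub>2 = 0\<close>, which is arbitrary
  (Cauchy-Kovalevskaya extension). On the monomials \<open>x\<^sub>1\<^sup>a x\<^sub>3\<^bsup>n-a\<^esup>\<close> the operators \<open>Z\<close> and \<open>X\<close> are bidiagonal,
  and \<open>Z\<close> raises, \<open>X\<close> lowers the exponent \<open>a\<close>; the factor of \<open>X\<close> from \<open>a = t\<^sub>1\<close> to \<open>a = t\<^sub>1 - 1\<close> vanishes. The
  monomials with \<open>a \<ge> t\<^sub>1\<close> span the submodule, the others the quotient, and rescaling them
  gives the bases of \<open>W\<^sub>1\<close> and \<open>W\<^sub>2\<close>. The two eigenlines of \<open>e\<^sub>2\<close> yield the two summands.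

  The remaining isomorphisms hold between bidiagonal modules: in such a module the eigenvector
  \<open>v\<close> of \<open>Y\<close> spans, under the products of the factors \<open>Z - \<theta>\<^sub>j\<close>, another bidiagonal form in which \<open>Z\<close> takes
  the role of \<open>X\<close>. Irreducibility follows by comparing two forms in which the eigenvalues of \<open>X\<close>
  occur in opposite orders.
\<close>

subsection \<open>Split parameters\<close>

text \<open>A change of split form must end after exactly \<open>d + 1\<close> vectors, and this is
  the obstacle. The eigenvalue argument needs the continued value \<open>theta d b (Suc d)\<close>
  to differ from all eigenvalues of \<open>Y\<close>, which can fail for real \<open>b\<close> but
  never for non-real \<open>b\<close>. When \<open>X\<close> and \<open>Z\<close> are exchanged, the
  entries of the chain are continuous in \<open>b\<close>, so its end carries over to every
  \<open>b\<close>; when \<open>a\<close> becomes \<open>- a\<close>, the chain does not contain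
  \<open>b\<close> at all. That \<open>Y\<close> acts bidiagonally on a chain has to be checked on
  its first two vectors only. Eliminating the third generator leaves a cubic relation, which acts as
  a recursion along the chain and has the same shape for the pairs \<open>(X, Y)\<close> and
  \<open>(Z, Y)\<close>. The three-cycle in the twists is a product of two transpositions: the
  exchange of \<open>X\<close> and \<open>Z\<close>, and the reversal of the basis, which exchanges
  \<open>X\<close> and \<open>Y\<close>. The reversal divides by the entries of
  \<open>\<phi>\<close>; their being non-zero, there and for irreducibility, is what
  \<open>k 2 \<ge> 0\<close> and \<open>k 3 \<ge> 0\<close> guarantee.\<close>

lemma vsc_apply [simp]: "vsc c v i = c * v i" by (simp add: vsc_def)

definition phiE :: "nat \<Rightarrow> complex \<Rightarrow> complex \<Rightarrow> complex \<Rightarrow> nat \<Rightarrow> complex" where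
  "phiE d a b c i = (if even i then of_nat i * (of_nat d - of_nat i + 1)
          else c ^ 2 - (2 * a + 2 * b - of_nat d + 2 * of_nat i - 1) ^ 2 / 4)"

definition phiO :: "nat \<Rightarrow> complex \<Rightarrow> complex \<Rightarrow> complex \<Rightarrow> nat \<Rightarrow> complex" where
  "phiO d a b c i = (if even i then of_nat i * (of_nat d + 1 - 2 * of_nat i - 2 * a - 2 * b - 2 * c) / 2
          else (of_nat i - of_nat d - 1) * (of_nat d + 1 - 2 * of_nat i - 2 * a - 2 * b + 2 * c) / 2)"

definition kapE :: "nat \<Rightarrow> complex \<Rightarrow> complex \<Rightarrow> complex \<Rightarrow> complex" where
  "kapE d a b c = c ^ 2 - a ^ 2 - b ^ 2 + (of_nat d + 1) ^ 2 / 4"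

definition kapO :: "nat \<Rightarrow> complex \<Rightarrow> complex \<Rightarrow> complex \<Rightarrow> complex" where
  "kapO d a b c = 2 * a * b - c * (of_nat d + 1)"

lemma Emod_eq: "Emod d a b c = bidiag_mod d (theta d a) (theta d b) (phiE d a b c) (kapE d a b c)"
  unfolding Emod_def phiE_def[abs_def] kapE_def ..

lemma Omod_eq: "Omod d a b c = bidiag_mod d (theta d a) (theta d b) (phiO d a b c) (kapO d a b c)"
  unfolding Omod_def phiO_def[abs_def] kapO_def ..

text \<open>The coefficient identities expressing \<open>{X,Y} = Z + \<kappa>\<close>, \<open>{Y,Z} = X + \<nu>\<close>, \<open>{Z,X} = Y + \<mu>\<close> for a lower
  bidiagonal \<open>X\<close> with diagonal \<open>\<alpha>\<close> and an upper bidiagonal \<open>Y\<close> with diagonal \<open>\<beta>\<close> and superdiagonal \<open>\<phi>\<close>.\<close>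
definition BI_params ::
  "(nat \<Rightarrow> complex) \<Rightarrow> (nat \<Rightarrow> complex) \<Rightarrow> (nat \<Rightarrow> complex) \<Rightarrow> complex \<Rightarrow> complex \<Rightarrow> complex \<Rightarrow> bool" where
  "BI_params \<alpha> \<beta> \<phi> \<kappa> \<nu> \<mu> \<longleftrightarrow> \<phi> 0 = 0 \<and>
    (\<forall>i. (\<alpha> i + \<alpha> (Suc i))\<^sup>2 = 1 \<and> (\<beta> i + \<beta> (Suc i))\<^sup>2 = 1 \<and>
      \<alpha> (Suc (Suc i)) = - \<alpha> i - 2 * \<alpha> (Suc i) \<and> \<beta> (Suc (Suc i)) = - \<beta> i - 2 * \<beta> (Suc i) \<and>
      \<phi> (Suc (Suc i)) = 2 * \<kappa> - \<phi> i - 2 * \<phi> (Suc i) - (\<beta> i + \<beta> (Suc i)) * (\<alpha> i + \<alpha> (Suc i))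
         - 2 * (\<alpha> i * \<beta> i + \<alpha> (Suc i) * \<beta> (Suc i)) \<and>
      4 * (\<alpha> i)\<^sup>2 * \<beta> i + \<phi> (Suc i) * (3 * \<alpha> i + \<alpha> (Suc i)) + \<phi> i * (3 * \<alpha> i + \<alpha> (i - 1))
         = \<beta> i + 2 * \<kappa> * \<alpha> i + \<mu> \<and>
      4 * \<alpha> i * (\<beta> i)\<^sup>2 + \<phi> (Suc i) * (3 * \<beta> i + \<beta> (Suc i)) + \<phi> i * (3 * \<beta> i + \<beta> (i - 1))
         = \<alpha> i + 2 * \<kappa> * \<beta> i + \<nu>)"

lemma theta_even: "even i \<Longrightarrow> theta d a i = (2 * a - of_nat d + 2 * of_nat i) / 2"
  and theta_odd: "odd i \<Longrightarrow> theta d a i = - (2 * a - of_nat d + 2 * of_nat i) / 2"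
  by (simp_all add: theta_def)

lemma theta_add_Suc: "theta d a i + theta d a (Suc i) = - ((-1) ^ i)"
  by (cases "even i") (simp_all add: theta_even theta_odd field_simps)

lemma minus_one_power_sq [simp]: "((-1) ^ i)\<^sup>2 = (1 :: 'a :: comm_ring_1)"
  by (cases "even i") simp_all

lemma theta_Suc_Suc: "theta d a (Suc (Suc i)) = - theta d a i - 2 * theta d a (Suc i)"
  by (cases "even i") (simp_all add: theta_even theta_odd field_simps)

text \<open>Substituting \<open>d = 2e - 1\<close> and \<open>i = m + e - 1\<close> clears the denominators of \<open>\<theta>\<close> and \<open>\<phi>\<close>, which keeps the identities below tractable.\<close>
lemma shifted_theta_phi:
  assumes D: "complex_of_nat d = 2 * e - 1" and i: "complex_of_nat i = m + e - 1"
  shows "theta d (p + 1 / 2) i = (if even i then p + m else - (p + m))"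
    and "phiE d (p + 1 / 2) (q + 1 / 2) c i = (if even i then e\<^sup>2 - (m - 1)\<^sup>2 else c\<^sup>2 - (p + q + m)\<^sup>2)"
    and "phiO d (p + 1 / 2) (q + 1 / 2) c i
      = (if even i then - ((m + e - 1) * (p + q + m + c)) else (m - e - 1) * (c - (p + q + m)))"
proof -
  show "theta d (p + 1 / 2) i = (if even i then p + m else - (p + m))"
    unfolding theta_def D i by (simp add: field_simps)
  have 1: "2 * (p + 1 / 2) + 2 * (q + 1 / 2) - of_nat d + 2 * of_nat i - 1 = 2 * (p + q + m)"
    "(m + e - 1) * (of_nat d - (m + e - 1) + 1) = e\<^sup>2 - (m - 1)\<^sup>2"
    unfolding D i by (simp_all add: algebra_simps power2_eq_square)
  show "phiE d (p + 1 / 2) (q + 1 / 2) c i = (if even i then e\<^sup>2 - (m - 1)\<^sup>2 else c\<^sup>2 - (p + q + m)\<^sup>2)"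
    unfolding phiE_def 1 unfolding i 1 by (simp only: power_mult_distrib) simp
  show "phiO d (p + 1 / 2) (q + 1 / 2) c i
      = (if even i then - ((m + e - 1) * (p + q + m + c)) else (m - e - 1) * (c - (p + q + m)))"
    unfolding phiO_def D i by (simp add: field_simps)
qed

lemma shifted_kap:
  assumes "complex_of_nat d = 2 * e - 1"
  shows "2 * kapE d (p + 1 / 2) (q + 1 / 2) c = 2 * (c\<^sup>2 - p\<^sup>2 - p - q\<^sup>2 - q + e\<^sup>2) - 1"
    and "kapE d (p + 1 / 2) c (q + 1 / 2) = q\<^sup>2 + q - p\<^sup>2 - p - c\<^sup>2 + e\<^sup>2"
    and "2 * kapO d (p + 1 / 2) (q + 1 / 2) c = 4 * p * q + 2 * p + 2 * q + 1 - 4 * c * e"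
    and "kapO d (p + 1 / 2) c (q + 1 / 2) = 2 * p * c + c - 2 * q * e - e"
  unfolding kapE_def kapO_def assms by (simp_all add: field_simps power2_eq_square)

lemma phi_identity_aux:
  fixes a b :: complex
  obtains e p q m where "complex_of_nat d = 2 * e - 1" "a = p + 1 / 2" "b = q + 1 / 2" "complex_of_nat i = m + e - 1"
proof
  show "complex_of_nat d = 2 * ((of_nat d + 1) / 2) - 1" "a = (a - 1 / 2) + 1 / 2" "b = (b - 1 / 2) + 1 / 2"
    "complex_of_nat i = (of_nat i + 1 - (of_nat d + 1) / 2) + (of_nat d + 1) / 2 - 1"
    by (simp_all add: field_simps)
qed

text \<open>This is the diagonal entry of the relation
  \<open>X X Y + 2 X Y X + Y X X = Y + 2 \<kappa> X + \<mu>\<close> with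
  \<open>\<mu> = K d a c b\<close>. For each parity of \<open>i\<close> it is a polynomial identity
  in the shifted variables.\<close>

lemma phi_identity:
  assumes "F = phiE \<and> K = kapE \<or> F = phiO \<and> K = kapO"
  shows "4 * (theta d a i)\<^sup>2 * theta d b i + F d a b c (Suc i) * (3 * theta d a i + theta d a (Suc i))
      + F d a b c i * (3 * theta d a i + theta d a (i - 1))
      = theta d b i + 2 * K d a b c * theta d a i + K d a c b"
proof -
  obtain e p q m where D: "complex_of_nat d = 2 * e - 1" and a: "a = p + 1 / 2" and b: "b = q + 1 / 2"
    and i: "complex_of_nat i = m + e - 1"
    by (rule phi_identity_aux)
  have s: "complex_of_nat (Suc i) = (m + 1) + e - 1" using i by simp
  note at_i = shifted_theta_phi[OF D i] and at_Suc = shifted_theta_phi[OF D s]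
  \<comment> \<open>Removes the index \<open>i - 1\<close>: for \<open>i = 0\<close> both sides
    vanish because \<open>F d a b c 0 = 0\<close>; otherwise two consecutive values of
    \<open>theta\<close> add up to a sign.\<close>
  have pr: "F d a b c i * (3 * theta d a i + theta d a (i - 1)) = F d a b c i * (2 * theta d a i - (if even i then - 1 else 1))"
  proof (cases i)
    case 0
    then show ?thesis using assms by (auto simp: phiE_def phiO_def)
  next
    case (Suc j)
    have "theta d a j = (if even i then 1 else - 1) - theta d a (Suc j)"
      using theta_add_Suc[of d a j] by (cases "even j") (simp_all add: Suc eq_diff_eq)
    then show ?thesis by (simp add: Suc)
  qed
  have E: ?thesis if "F = phiE" "K = kapE"
    unfolding pr unfolding that a b at_i at_Suc shifted_kap[OF D]
    by (cases "even i") (simp_all add: algebra_simps power2_eq_square)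
  have O: ?thesis if "F = phiO" "K = kapO"
    unfolding pr unfolding that a b at_i at_Suc shifted_kap[OF D]
    by (cases "even i") (simp_all add: algebra_simps power2_eq_square)
  show ?thesis using assms E O by blast
qed

text \<open>The three constants are one expression in which the distinguished parameter is
  \<open>c\<close>, \<open>a\<close>, \<open>b\<close> in turn. The clause with the square of
  \<open>theta d b i\<close> comes from the one for \<open>a\<close> by exchanging \<open>a\<close>
  and \<open>b\<close>, which leaves \<open>phiE\<close> and \<open>kapE d a b c\<close>
  unchanged.\<close>

lemma BI_params_E:
  "BI_params (theta d a) (theta d b) (phiE d a b c) (kapE d a b c) (kapE d c b a) (kapE d a c b)"
proof -
  have h1: "phiE d a b c (Suc (Suc i)) = 2 * kapE d a b c - phiE d a b c i - 2 * phiE d a b c (Suc i)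
      - 1 - 2 * (theta d a i * theta d b i + theta d a (Suc i) * theta d b (Suc i))" for i
    by (cases "even i") (simp_all add: theta_even theta_odd phiE_def kapE_def field_simps power2_eq_square)
  note h0 = phi_identity[OF disjI1, OF conjI, OF refl refl]
  have sym: "phiE d b a c = phiE d a b c" "kapE d b a c = kapE d a b c" "kapE d b c a = kapE d c b a"
    by (auto simp: phiE_def fun_eq_iff kapE_def add_ac)
  have h0': "4 * theta d a i * (theta d b i)\<^sup>2 + phiE d a b c (Suc i) * (3 * theta d b i + theta d b (Suc i))
      + phiE d a b c i * (3 * theta d b i + theta d b (i - 1))
      = theta d a i + 2 * kapE d a b c * theta d b i + kapE d c b a" for i
    using h0[of d b i a c] by (simp add: sym algebra_simps)
  show ?thesis
    unfolding BI_params_def theta_add_Suc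
    using h1 h0 h0' by (simp add: theta_Suc_Suc phiE_def[of d a b c 0] flip: power2_eq_square)
qed

lemma BI_params_O:
  "BI_params (theta d a) (theta d b) (phiO d a b c) (kapO d a b c) (kapO d c b a) (kapO d a c b)"
proof -
  have h1: "phiO d a b c (Suc (Suc i)) = 2 * kapO d a b c - phiO d a b c i - 2 * phiO d a b c (Suc i)
      - 1 - 2 * (theta d a i * theta d b i + theta d a (Suc i) * theta d b (Suc i))" for i
    by (cases "even i") (simp_all add: theta_even theta_odd phiO_def kapO_def field_simps power2_eq_square)
  note h0 = phi_identity[OF disjI2, OF conjI, OF refl refl]
  have sym: "phiO d b a c = phiO d a b c" "kapO d b a c = kapO d a b c" "kapO d b c a = kapO d c b a"
    by (auto simp: phiO_def fun_eq_iff kapO_def algebra_simps)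
  have h0': "4 * theta d a i * (theta d b i)\<^sup>2 + phiO d a b c (Suc i) * (3 * theta d b i + theta d b (Suc i))
      + phiO d a b c i * (3 * theta d b i + theta d b (i - 1))
      = theta d a i + 2 * kapO d a b c * theta d b i + kapO d c b a" for i
    using h0[of d b i a c] by (simp add: sym algebra_simps)
  show ?thesis
    unfolding BI_params_def theta_add_Suc
    using h1 h0 h0' by (simp add: theta_Suc_Suc phiO_def[of d a b c 0] flip: power2_eq_square)
qed


section \<open>Cubic relations of the untruncated bidiagonal operators\<close>

text \<open>The infinite bidiagonal operators; truncation is a homomorphism to the finite module because
  \<open>\<phi> (Suc d) = 0\<close>.\<close>
definition verma_X :: "(nat \<Rightarrow> complex) \<Rightarrow> (nat \<Rightarrow> complex) \<Rightarrow> nat \<Rightarrow> complex" where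
  "verma_X \<alpha> w i = \<alpha> i * w i + (if i = 0 then 0 else w (i - 1))"

definition verma_Y :: "(nat \<Rightarrow> complex) \<Rightarrow> (nat \<Rightarrow> complex) \<Rightarrow> (nat \<Rightarrow> complex) \<Rightarrow> nat \<Rightarrow> complex" where
  "verma_Y \<beta> \<phi> w i = \<beta> i * w i + \<phi> (Suc i) * w (Suc i)"

definition trunc :: "nat \<Rightarrow> (nat \<Rightarrow> complex) \<Rightarrow> nat \<Rightarrow> complex" where
  "trunc d w i = (if i \<le> d then w i else 0)"

lemma trunc_trunc [simp]: "trunc d (trunc d w) = trunc d w"
  by (auto simp: trunc_def fun_eq_iff)

lemma trunc_add: "trunc d (v + w) = trunc d v + trunc d w"
  and trunc_vsc: "trunc d (vsc c w) = vsc c (trunc d w)"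
  by (auto simp: trunc_def fun_eq_iff)

lemma bidiagX_eq_trunc: "bidiagX d \<alpha> w = trunc d (verma_X \<alpha> w)"
  by (auto simp: bidiagX_def verma_X_def trunc_def fun_eq_iff)

lemma bidiagY_eq_trunc: "\<phi> (Suc d) = 0 \<Longrightarrow> bidiagY d \<beta> \<phi> w = trunc d (verma_Y \<beta> \<phi> w)"
  by (auto simp: bidiagY_def verma_Y_def trunc_def fun_eq_iff not_less le_antisym)

lemma trunc_verma_X_trunc [simp]: "trunc d (verma_X \<alpha> (trunc d w)) = trunc d (verma_X \<alpha> w)"
  by (auto simp: verma_X_def trunc_def fun_eq_iff)

lemma trunc_verma_Y_trunc: "\<phi> (Suc d) = 0 \<Longrightarrow> trunc d (verma_Y \<beta> \<phi> (trunc d w)) = trunc d (verma_Y \<beta> \<phi> w)"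
  by (auto simp: verma_Y_def trunc_def fun_eq_iff not_less_eq_eq le_antisym)

text \<open>The relation results from \<open>{X,Y} = Z + \<kappa>\<close> and
  \<open>{Z,X} = Y + \<mu>\<close> by eliminating \<open>Z\<close>. At position \<open>i\<close> it
  compares the coefficients of the entries \<open>i + 1\<close>, \<open>i\<close>,
  \<open>i - 1\<close>, \<open>i - 2\<close> of \<open>w\<close>, and each comparison is one clause
  of \<open>BI_params\<close>.\<close>

lemma verma_XXY:
  assumes "BI_params \<alpha> \<beta> \<phi> \<kappa> \<nu> \<mu>"
  shows "verma_X \<alpha> (verma_X \<alpha> (verma_Y \<beta> \<phi> w)) + vsc 2 (verma_X \<alpha> (verma_Y \<beta> \<phi> (verma_X \<alpha> w))) + verma_Y \<beta> \<phi> (verma_X \<alpha> (verma_X \<alpha> w))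
    = verma_Y \<beta> \<phi> w + vsc (2 * \<kappa>) (verma_X \<alpha> w) + vsc \<mu> w"
proof
  fix i
  have z: "\<phi> 0 = 0" using assms by (simp add: BI_params_def)
  have sq: "(\<alpha> i + \<alpha> (Suc i))\<^sup>2 = 1" for i using assms by (simp add: BI_params_def)
  have b: "\<beta> (Suc (Suc i)) = - \<beta> i - 2 * \<beta> (Suc i)" for i using assms by (simp add: BI_params_def)
  have h1: "\<phi> (Suc (Suc i)) = 2 * \<kappa> - \<phi> i - 2 * \<phi> (Suc i) - (\<beta> i + \<beta> (Suc i)) * (\<alpha> i + \<alpha> (Suc i))
         - 2 * (\<alpha> i * \<beta> i + \<alpha> (Suc i) * \<beta> (Suc i))" for i using assms by (simp add: BI_params_def)
  have h0: "4 * (\<alpha> i)\<^sup>2 * \<beta> i + \<phi> (Suc i) * (3 * \<alpha> i + \<alpha> (Suc i)) + \<phi> i * (3 * \<alpha> i + \<alpha> (i - 1))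
         = \<beta> i + 2 * \<kappa> * \<alpha> i + \<mu>" for i using assms by (simp add: BI_params_def)
  show "(verma_X \<alpha> (verma_X \<alpha> (verma_Y \<beta> \<phi> w)) + vsc 2 (verma_X \<alpha> (verma_Y \<beta> \<phi> (verma_X \<alpha> w))) + verma_Y \<beta> \<phi> (verma_X \<alpha> (verma_X \<alpha> w))) i
    = (verma_Y \<beta> \<phi> w + vsc (2 * \<kappa>) (verma_X \<alpha> w) + vsc \<mu> w) i"
  proof (cases i)
    case 0
    have "(verma_X \<alpha> (verma_X \<alpha> (verma_Y \<beta> \<phi> w)) + vsc 2 (verma_X \<alpha> (verma_Y \<beta> \<phi> (verma_X \<alpha> w))) + verma_Y \<beta> \<phi> (verma_X \<alpha> (verma_X \<alpha> w))) i
       = (4 * (\<alpha> 0)\<^sup>2 * \<beta> 0 + \<phi> 1 * (3 * \<alpha> 0 + \<alpha> 1)) * w 0 + \<phi> 1 * (\<alpha> 0 + \<alpha> 1)\<^sup>2 * w 1"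
      by (simp add: 0 verma_X_def verma_Y_def algebra_simps power2_eq_square)
    moreover have "4 * (\<alpha> 0)\<^sup>2 * \<beta> 0 + \<phi> 1 * (3 * \<alpha> 0 + \<alpha> 1) = \<beta> 0 + 2 * \<kappa> * \<alpha> 0 + \<mu>"
      using h0[of 0] z by simp
    moreover have "(\<alpha> 0 + \<alpha> 1)\<^sup>2 = 1" using sq[of 0] by simp
    moreover have "(verma_Y \<beta> \<phi> w + vsc (2 * \<kappa>) (verma_X \<alpha> w) + vsc \<mu> w) i
        = (\<beta> 0 + 2 * \<kappa> * \<alpha> 0 + \<mu>) * w 0 + \<phi> 1 * 1 * w 1"
      by (simp add: 0 verma_X_def verma_Y_def algebra_simps)
    ultimately show ?thesis by (simp only:)
  next
    case (Suc j)
    define v where "v = (if j = 0 then 0 else w (j - 1))"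
    have "(verma_X \<alpha> (verma_X \<alpha> (verma_Y \<beta> \<phi> w)) + vsc 2 (verma_X \<alpha> (verma_Y \<beta> \<phi> (verma_X \<alpha> w))) + verma_Y \<beta> \<phi> (verma_X \<alpha> (verma_X \<alpha> w))) i
       = (4 * (\<alpha> i)\<^sup>2 * \<beta> i + \<phi> (Suc i) * (3 * \<alpha> i + \<alpha> (Suc i)) + \<phi> i * (3 * \<alpha> i + \<alpha> j)) * w i
         + \<phi> (Suc i) * (\<alpha> i + \<alpha> (Suc i))\<^sup>2 * w (Suc i)
         + (\<phi> j + 2 * \<phi> i + \<phi> (Suc i) + (\<beta> j + \<beta> i) * (\<alpha> j + \<alpha> i) + 2 * (\<alpha> j * \<beta> j + \<alpha> i * \<beta> i)) * w j
         + (\<beta> (j - 1) + 2 * \<beta> j + \<beta> i) * v"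
      using z by (cases j) (simp_all add: Suc v_def verma_X_def verma_Y_def algebra_simps power2_eq_square)
    moreover have "4 * (\<alpha> i)\<^sup>2 * \<beta> i + \<phi> (Suc i) * (3 * \<alpha> i + \<alpha> (Suc i)) + \<phi> i * (3 * \<alpha> i + \<alpha> j)
       = \<beta> i + 2 * \<kappa> * \<alpha> i + \<mu>"
      using h0[of i] by (simp add: Suc)
    moreover have "(\<beta> (j - 1) + 2 * \<beta> j + \<beta> i) * v = 0"
      by (cases j) (auto simp: v_def Suc b)
    moreover have "\<phi> j + 2 * \<phi> i + \<phi> (Suc i) + (\<beta> j + \<beta> i) * (\<alpha> j + \<alpha> i) + 2 * (\<alpha> j * \<beta> j + \<alpha> i * \<beta> i) = 2 * \<kappa>"
      using h1[of j] by (simp add: Suc algebra_simps)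
    moreover have "(\<alpha> i + \<alpha> (Suc i))\<^sup>2 = 1" by (rule sq)
    moreover have "(verma_Y \<beta> \<phi> w + vsc (2 * \<kappa>) (verma_X \<alpha> w) + vsc \<mu> w) i
        = (\<beta> i + 2 * \<kappa> * \<alpha> i + \<mu>) * w i + \<phi> (Suc i) * 1 * w (Suc i) + 2 * \<kappa> * w j + 0"
      by (simp add: Suc verma_X_def verma_Y_def algebra_simps)
    ultimately show ?thesis by (simp only:)
  qed
qed

lemma verma_YYX:
  assumes "BI_params \<alpha> \<beta> \<phi> \<kappa> \<nu> \<mu>"
  shows "verma_Y \<beta> \<phi> (verma_Y \<beta> \<phi> (verma_X \<alpha> w)) + vsc 2 (verma_Y \<beta> \<phi> (verma_X \<alpha> (verma_Y \<beta> \<phi> w))) + verma_X \<alpha> (verma_Y \<beta> \<phi> (verma_Y \<beta> \<phi> w))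
    = verma_X \<alpha> w + vsc (2 * \<kappa>) (verma_Y \<beta> \<phi> w) + vsc \<nu> w"
proof
  fix i
  have z: "\<phi> 0 = 0" using assms by (simp add: BI_params_def)
  have sq: "(\<beta> i + \<beta> (Suc i))\<^sup>2 = 1" for i using assms by (simp add: BI_params_def)
  have b: "\<alpha> (Suc (Suc i)) = - \<alpha> i - 2 * \<alpha> (Suc i)" for i using assms by (simp add: BI_params_def)
  have h1: "\<phi> (Suc (Suc i)) = 2 * \<kappa> - \<phi> i - 2 * \<phi> (Suc i) - (\<beta> i + \<beta> (Suc i)) * (\<alpha> i + \<alpha> (Suc i))
         - 2 * (\<alpha> i * \<beta> i + \<alpha> (Suc i) * \<beta> (Suc i))" for i using assms by (simp add: BI_params_def)
  have h0: "4 * \<alpha> i * (\<beta> i)\<^sup>2 + \<phi> (Suc i) * (3 * \<beta> i + \<beta> (Suc i)) + \<phi> i * (3 * \<beta> i + \<beta> (i - 1))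
         = \<alpha> i + 2 * \<kappa> * \<beta> i + \<nu>" for i using assms by (simp add: BI_params_def)
  have e2: "\<phi> (Suc i) * \<phi> (Suc (Suc i)) * (\<alpha> i + 2 * \<alpha> (Suc i) + \<alpha> (Suc (Suc i))) = 0"
    by (simp add: b)
  have e1: "\<phi> (Suc i) * (\<phi> i + 2 * \<phi> (Suc i) + \<phi> (Suc (Suc i)) + (\<beta> i + \<beta> (Suc i)) * (\<alpha> i + \<alpha> (Suc i))
      + 2 * (\<alpha> i * \<beta> i + \<alpha> (Suc i) * \<beta> (Suc i))) = \<phi> (Suc i) * (2 * \<kappa>)"
    by (simp add: h1)
  show "(verma_Y \<beta> \<phi> (verma_Y \<beta> \<phi> (verma_X \<alpha> w)) + vsc 2 (verma_Y \<beta> \<phi> (verma_X \<alpha> (verma_Y \<beta> \<phi> w))) + verma_X \<alpha> (verma_Y \<beta> \<phi> (verma_Y \<beta> \<phi> w))) i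
    = (verma_X \<alpha> w + vsc (2 * \<kappa>) (verma_Y \<beta> \<phi> w) + vsc \<nu> w) i"
  proof -
    define v where "v = (if i = 0 then 0 else w (i - 1))"
    have "(verma_Y \<beta> \<phi> (verma_Y \<beta> \<phi> (verma_X \<alpha> w)) + vsc 2 (verma_Y \<beta> \<phi> (verma_X \<alpha> (verma_Y \<beta> \<phi> w))) + verma_X \<alpha> (verma_Y \<beta> \<phi> (verma_Y \<beta> \<phi> w))) i
       = (4 * \<alpha> i * (\<beta> i)\<^sup>2 + \<phi> (Suc i) * (3 * \<beta> i + \<beta> (Suc i)) + \<phi> i * (3 * \<beta> i + \<beta> (i - 1))) * w i
       + (\<phi> (Suc i) * (\<phi> i + 2 * \<phi> (Suc i) + \<phi> (Suc (Suc i)) + (\<beta> i + \<beta> (Suc i)) * (\<alpha> i + \<alpha> (Suc i))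
            + 2 * (\<alpha> i * \<beta> i + \<alpha> (Suc i) * \<beta> (Suc i)))) * w (Suc i)
       + (\<phi> (Suc i) * \<phi> (Suc (Suc i)) * (\<alpha> i + 2 * \<alpha> (Suc i) + \<alpha> (Suc (Suc i)))) * w (Suc (Suc i))
       + (\<beta> i + \<beta> (i - 1))\<^sup>2 * v"
      using z by (cases i) (simp_all add: v_def verma_X_def verma_Y_def algebra_simps power2_eq_square)
    moreover have "(\<beta> i + \<beta> (i - 1))\<^sup>2 * v = v"
      using sq[of "i - 1"] by (cases i) (auto simp: v_def add_ac)
    ultimately show ?thesis unfolding h0 e1 e2
      by (cases i) (simp_all add: v_def verma_X_def verma_Y_def algebra_simps)
  qed
qed

subsection \<open>Chains of vectors\<close>

definition supp_le :: "nat \<Rightarrow> (nat \<Rightarrow> complex) set" where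
  "supp_le d = {w. \<forall>i>d. w i = 0}"

lemma vsc_0 [simp]: "vsc 0 v = 0"
  and vsc_zero [simp]: "vsc c 0 = 0"
  and vsc_1 [simp]: "vsc 1 v = v"
  and vsc_vsc [simp]: "vsc c (vsc c' v) = vsc (c * c') v"
  by (simp_all add: fun_eq_iff)

lemma lin_on_UNIV:
  assumes "lin_on UNIV A"
  shows "A (u + w) = A u + A w" "A (vsc c u) = vsc c (A u)" "A (u - w) = A u - A w" "A 0 = 0"
proof -
  show add: "A (u + w) = A u + A w" for u w using assms by (simp add: lin_on_def)
  show scl: "A (vsc c u) = vsc c (A u)" for c u using assms by (simp add: lin_on_def)
  have "A (u - w) + A w = A u" by (simp flip: add)
  then show "A (u - w) = A u - A w" by (simp add: eq_diff_eq)
  show "A 0 = 0" using scl[of 0 0] by simp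
qed

text \<open>Evaluated at \<open>u i\<close>, the cubic relation expresses
  \<open>B (u (i + 2))\<close> through \<open>B (u i)\<close> and \<open>B (u (i + 1))\<close>. So
  the bidiagonal shape of \<open>B\<close> on \<open>u 0\<close> and \<open>u 1\<close> spreads to
  the whole chain, and \<open>BI_params\<close> says that \<open>\<beta>\<close> and
  \<open>\<phi>\<close> continue with the right values.\<close>

lemma split_chain:
  assumes linA: "lin_on UNIV A" and linB: "lin_on UNIV B"
    and rel: "\<And>w. w \<in> V \<Longrightarrow> A (A (B w)) + vsc 2 (A (B (A w))) + B (A (A w)) = B w + vsc (2 * \<kappa>) (A w) + vsc \<mu> w"
    and uV: "\<And>i. u i \<in> V"
    and P: "BI_params \<alpha> \<beta> \<phi> \<kappa> \<nu> \<mu>"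
    and u: "\<And>i. u (Suc i) = A (u i) - vsc (\<alpha> i) (u i)"
    and B0: "B (u 0) = vsc (\<beta> 0) (u 0)"
    and B1: "B (u 1) = vsc (\<beta> 1) (u 1) + vsc (\<phi> 1) (u 0)"
  shows "B (u i) = vsc (\<beta> i) (u i) + vsc (\<phi> i) (u (i - 1))"
proof -
  have z: "\<phi> 0 = 0" using P by (simp add: BI_params_def)
  have sq: "(\<alpha> i + \<alpha> (Suc i))\<^sup>2 = 1" for i using P by (simp add: BI_params_def)
  have b: "\<beta> (Suc (Suc i)) = - \<beta> i - 2 * \<beta> (Suc i)" for i using P by (simp add: BI_params_def)
  have h1: "\<phi> (Suc (Suc i)) = 2 * \<kappa> - \<phi> i - 2 * \<phi> (Suc i) - (\<beta> i + \<beta> (Suc i)) * (\<alpha> i + \<alpha> (Suc i))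
         - 2 * (\<alpha> i * \<beta> i + \<alpha> (Suc i) * \<beta> (Suc i))" for i using P by (simp add: BI_params_def)
  have h0: "4 * (\<alpha> i)\<^sup>2 * \<beta> i + \<phi> (Suc i) * (3 * \<alpha> i + \<alpha> (Suc i)) + \<phi> i * (3 * \<alpha> i + \<alpha> (i - 1))
         = \<beta> i + 2 * \<kappa> * \<alpha> i + \<mu>" for i using P by (simp add: BI_params_def)
  note A = lin_on_UNIV[OF linA] and Bl = lin_on_UNIV[OF linB]
  have Au: "A (u i) = u (Suc i) + vsc (\<alpha> i) (u i)" for i by (simp add: u)
  \<comment> \<open>The recursion has order two, so two consecutive indices are carried
    along.\<close>
  have "B (u i) = vsc (\<beta> i) (u i) + vsc (\<phi> i) (u (i - 1)) \<and>
        B (u (Suc i)) = vsc (\<beta> (Suc i)) (u (Suc i)) + vsc (\<phi> (Suc i)) (u i)" for i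
  proof (induction i)
    case 0
    show ?case using B0 B1 by (simp add: z fun_eq_iff)
  next
    case (Suc i)
    define p where "p = u (i - 1)"
    have IH0: "B (u i) = vsc (\<beta> i) (u i) + vsc (\<phi> i) p"
      and IH1: "B (u (Suc i)) = vsc (\<beta> (Suc i)) (u (Suc i)) + vsc (\<phi> (Suc i)) (u i)"
      using Suc by (auto simp: p_def)
    \<comment> \<open>The factor \<open>\<phi> i\<close> is kept because for \<open>i = 0\<close>
      the vector \<open>p\<close> is \<open>u 0\<close> and the bare equation would be wrong; there
      \<open>\<phi> 0 = 0\<close>.\<close>
    have Ap: "vsc (\<phi> i) (A p) = vsc (\<phi> i) (u i + vsc (\<alpha> (i - 1)) p)"
      using Au[of "i - 1"] by (cases i) (auto simp: z p_def fun_eq_iff)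
    have AAp: "vsc (\<phi> i) (A (A p)) = vsc (\<phi> i) (A (u i) + vsc (\<alpha> (i - 1)) (A p))"
      using arg_cong[OF Ap, of A] by (simp add: A)
    have t1: "A (A (B (u i))) = vsc (\<beta> i) (A (A (u i))) + vsc (\<phi> i) (A (A p))"
      by (simp add: IH0 A)
    have t2: "B (A (u i)) = vsc (\<beta> (Suc i)) (u (Suc i)) + vsc (\<phi> (Suc i)) (u i)
        + vsc (\<alpha> i) (vsc (\<beta> i) (u i) + vsc (\<phi> i) p)"
      by (simp add: Au Bl IH0 IH1)
    have t3: "A (B (A (u i))) = vsc (\<beta> (Suc i)) (A (u (Suc i))) + vsc (\<phi> (Suc i)) (A (u i))
        + vsc (\<alpha> i) (vsc (\<beta> i) (A (u i)) + vsc (\<phi> i) (A p))"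
      unfolding t2 by (simp add: A)
    have t4: "B (A (A (u i))) = B (u (Suc (Suc i))) + vsc (\<alpha> (Suc i)) (B (u (Suc i))) + vsc (\<alpha> i) (B (A (u i)))"
      by (simp add: Au[of i] A Au[of "Suc i"] Bl)
    have AA: "A (A (u i)) = u (Suc (Suc i)) + vsc (\<alpha> (Suc i)) (u (Suc i)) + vsc (\<alpha> i) (u (Suc i) + vsc (\<alpha> i) (u i))"
      by (simp add: Au A)
    have "B (u (Suc (Suc i))) x = \<beta> (Suc (Suc i)) * u (Suc (Suc i)) x + \<phi> (Suc (Suc i)) * u (Suc i) x" for x
    proof -
      have Apx: "\<phi> i * A p x = \<phi> i * (u i x + \<alpha> (i - 1) * p x)"
        using fun_cong[OF Ap, of x] by simp
      have AApx: "\<phi> i * A (A p) x = \<phi> i * (u (Suc i) x + \<alpha> i * u i x) + \<alpha> (i - 1) * (\<phi> i * A p x)"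
        using fun_cong[OF AAp, of x] by (simp add: Au algebra_simps)
      have t3x: "A (B (A (u i))) x = \<beta> (Suc i) * (u (Suc (Suc i)) x + \<alpha> (Suc i) * u (Suc i) x)
        + \<phi> (Suc i) * (u (Suc i) x + \<alpha> i * u i x)
        + \<alpha> i * (\<beta> i * (u (Suc i) x + \<alpha> i * u i x) + \<phi> i * A p x)"
        unfolding t3 by (simp add: Au)
      have t1x: "A (A (B (u i))) x = \<beta> i * (u (Suc (Suc i)) x + \<alpha> (Suc i) * u (Suc i) x + \<alpha> i * (u (Suc i) x + \<alpha> i * u i x))
         + \<phi> i * A (A p) x"
        unfolding t1 AA by simp
      have t4x: "B (A (A (u i))) x = B (u (Suc (Suc i))) x
         + \<alpha> (Suc i) * (\<beta> (Suc i) * u (Suc i) x + \<phi> (Suc i) * u i x)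
         + \<alpha> i * (\<beta> (Suc i) * u (Suc i) x + \<phi> (Suc i) * u i x + \<alpha> i * (\<beta> i * u i x + \<phi> i * p x))"
        unfolding t4 t2 IH1 by simp
      have "A (A (B (u i))) x + 2 * A (B (A (u i))) x + B (A (A (u i))) x
          = \<beta> i * u i x + \<phi> i * p x + 2 * \<kappa> * (u (Suc i) x + \<alpha> i * u i x) + \<mu> * u i x"
        using fun_cong[OF rel[OF uV[of i]], of x] by (simp add: IH0 Au)
      \<comment> \<open>The deviation from the claim, sorted by the chain vectors
        \<open>u (i + 2)\<close>, \<open>u (i + 1)\<close>, \<open>u i\<close> and \<open>p\<close>;
        every coefficient vanishes by a clause of \<open>BI_params\<close>, the last one with the
        help of \<open>\<phi> 0 = 0\<close>.\<close>
      then have "B (u (Suc (Suc i))) x - (\<beta> (Suc (Suc i)) * u (Suc (Suc i)) x + \<phi> (Suc (Suc i)) * u (Suc i) x)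
        = (- \<beta> i - 2 * \<beta> (Suc i) - \<beta> (Suc (Suc i))) * u (Suc (Suc i)) x
        + (2 * \<kappa> - \<phi> i - 2 * \<phi> (Suc i) - (\<beta> i + \<beta> (Suc i)) * (\<alpha> i + \<alpha> (Suc i))
         - 2 * (\<alpha> i * \<beta> i + \<alpha> (Suc i) * \<beta> (Suc i)) - \<phi> (Suc (Suc i))) * u (Suc i) x
        + ((\<beta> i + 2 * \<kappa> * \<alpha> i + \<mu>) - (4 * (\<alpha> i)\<^sup>2 * \<beta> i + \<phi> (Suc i) * (3 * \<alpha> i + \<alpha> (Suc i))
           + \<phi> i * (3 * \<alpha> i + \<alpha> (i - 1)))) * u i x
        + \<phi> i * (1 - (\<alpha> i + \<alpha> (i - 1))\<^sup>2) * p x"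
        unfolding t1x t3x t4x AApx Apx by (simp add: algebra_simps power2_eq_square)
      also have "\<dots> = \<phi> i * (1 - (\<alpha> i + \<alpha> (i - 1))\<^sup>2) * p x"
        unfolding h0 by (simp add: b h1)
      also have "\<dots> = 0"
        using sq[of "i - 1"] by (cases i) (auto simp: z add_ac)
      finally show ?thesis by simp
    qed
    then show ?case using IH1 by (simp add: fun_eq_iff)
  qed
  then show ?thesis by blast
qed


lemma supp_le_closed:
  "0 \<in> supp_le d" "u \<in> supp_le d \<Longrightarrow> w \<in> supp_le d \<Longrightarrow> u + w \<in> supp_le d"
  "u \<in> supp_le d \<Longrightarrow> w \<in> supp_le d \<Longrightarrow> u - w \<in> supp_le d"
  "u \<in> supp_le d \<Longrightarrow> vsc c u \<in> supp_le d"
  by (auto simp: supp_le_def)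

lemma bidiag_supp_le: "bidiagX d \<alpha> w \<in> supp_le d" "bidiagY d \<beta> \<phi> w \<in> supp_le d"
  by (auto simp: supp_le_def bidiagX_def bidiagY_def)

lemma trunc_supp_le: "w \<in> supp_le d \<Longrightarrow> trunc d w = w"
  by (auto simp: trunc_def supp_le_def fun_eq_iff)

lemma lin_on_bidiag: "lin_on UNIV (bidiagX d \<alpha>)" "lin_on UNIV (bidiagY d \<beta> \<phi>)"
  by (auto simp: lin_on_def bidiagX_def bidiagY_def fun_eq_iff algebra_simps)

text \<open>The operator is upper triangular, so the last non-zero entry of an eigenvector would
  make \<open>c\<close> a diagonal entry. The entries are shown to vanish from index
  \<open>d\<close> downwards.\<close>

lemma bidiagY_eigenvector_zero:
  assumes w: "w \<in> supp_le d" and eig: "bidiagY d \<beta> \<phi> w = vsc c w" and ne: "\<And>j. j \<le> d \<Longrightarrow> \<beta> j \<noteq> c"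
  shows "w = 0"
proof -
  have "\<forall>i\<ge>0. w i = 0"
  proof (rule inc_induct[of 0 "Suc d" "\<lambda>m. \<forall>i\<ge>m. w i = 0"])
    show "\<forall>i\<ge>Suc d. w i = 0" using w by (auto simp: supp_le_def)
    fix m assume m: "m < Suc d" and IH: "\<forall>i\<ge>Suc m. w i = 0"
    have "bidiagY d \<beta> \<phi> w m = \<beta> m * w m"
      using m IH by (simp add: bidiagY_def)
    then have "(\<beta> m - c) * w m = 0" using fun_cong[OF eig, of m] by (simp only: left_diff_distrib vsc_apply) simp
    then have "w m = 0" using ne[of m] m by simp
    then show "\<forall>i\<ge>m. w i = 0" using IH by (metis Suc_leI le_eq_less_or_eq)
  qed simp
  then show ?thesis by (simp add: fun_eq_iff)
qed

section \<open>Linear combinations along a chain and their triangularity\<close>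

definition comb :: "nat \<Rightarrow> (nat \<Rightarrow> 'i \<Rightarrow> complex) \<Rightarrow> (nat \<Rightarrow> complex) \<Rightarrow> 'i \<Rightarrow> complex" where
  "comb d u w = (\<Sum>i\<le>d. vsc (w i) (u i))"

lemma sum_fun_apply: "(\<Sum>i\<in>I. f i) x = (\<Sum>i\<in>I. f i x :: 'b :: comm_monoid_add)"
  by (induction I rule: infinite_finite_induct) auto

lemma comb_apply: "comb d u w x = (\<Sum>i\<le>d. w i * u i x)"
  by (simp add: comb_def sum_fun_apply)

lemma lin_on_comb: "lin_on V (comb d u)"
  by (auto simp: lin_on_def fun_eq_iff comb_apply algebra_simps sum.distrib sum_distrib_left)

lemma lin_on_UNIV_comb:
  assumes "lin_on UNIV A" shows "A (comb d u w) = comb d (\<lambda>i. A (u i)) w"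
proof -
  have "A (\<Sum>i\<in>I. vsc (w i) (u i)) = (\<Sum>i\<in>I. vsc (w i) (A (u i)))" for I
    by (induction I rule: infinite_finite_induct)
      (simp_all only: sum.infinite sum.empty sum.insert lin_on_UNIV[OF assms] not_False_eq_True)
  then show ?thesis by (simp add: comb_def)
qed

lemma comb_bidiagX:
  assumes A: "lin_on UNIV A" and u: "\<And>i. A (u i) = u (Suc i) + vsc (\<alpha> i) (u i)" and 0: "u (Suc d) = 0"
  shows "comb d u (bidiagX d \<alpha> w) = A (comb d u w)"
proof
  fix x
  have *: "(\<Sum>i\<le>d. (if i = 0 then 0 else w (i - 1)) * u i x) + w d * u (Suc d) x = (\<Sum>i\<le>d. w i * u (Suc i) x)" for d
    by (induction d) auto
  have "comb d u (bidiagX d \<alpha> w) x = (\<Sum>i\<le>d. \<alpha> i * w i * u i x + (if i = 0 then 0 else w (i - 1)) * u i x)"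
    unfolding comb_apply by (rule sum.cong) (auto simp: bidiagX_def algebra_simps)
  also have "\<dots> = (\<Sum>i\<le>d. \<alpha> i * w i * u i x) + (\<Sum>i\<le>d. w i * u (Suc i) x)"
    using *[of d] 0 by (simp add: sum.distrib)
  also have "\<dots> = A (comb d u w) x"
    unfolding lin_on_UNIV_comb[OF A] comb_apply u by (simp add: sum.distrib algebra_simps)
  finally show "comb d u (bidiagX d \<alpha> w) x = A (comb d u w) x" .
qed

lemma comb_bidiagY:
  assumes B: "lin_on UNIV B" and u: "\<And>i. B (u i) = vsc (\<beta> i) (u i) + vsc (\<phi> i) (u (i - 1))"
    and 0: "\<phi> 0 = 0" "\<phi> (Suc d) = 0"
  shows "comb d u (bidiagY d \<beta> \<phi> w) = B (comb d u w)"
proof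
  fix x
  have *: "(\<Sum>i\<le>d. \<phi> (Suc i) * w (Suc i) * u i x) = (\<Sum>i\<le>Suc d. \<phi> i * w i * u (i - 1) x)" for d
    using 0(1) by (induction d) auto
  have "comb d u (bidiagY d \<beta> \<phi> w) x = (\<Sum>i\<le>d. \<beta> i * w i * u i x + \<phi> (Suc i) * w (Suc i) * u i x)"
    unfolding comb_apply by (rule sum.cong) (auto simp: bidiagY_def algebra_simps 0 not_less le_antisym)
  also have "\<dots> = (\<Sum>i\<le>d. \<beta> i * w i * u i x) + (\<Sum>i\<le>d. \<phi> i * w i * u (i - 1) x)"
    using *[of d] 0 by (simp add: sum.distrib)
  also have "\<dots> = B (comb d u w) x"
    unfolding lin_on_UNIV_comb[OF B] comb_apply u by (simp add: sum.distrib algebra_simps)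
  finally show "comb d u (bidiagY d \<beta> \<phi> w) x = B (comb d u w) x" .
qed

lemma comb_triangular:
  fixes u :: "nat \<Rightarrow> nat \<Rightarrow> complex"
  assumes "m \<le> d" "\<And>i. i \<le> d \<Longrightarrow> u i \<in> supp_le i" "\<forall>i>m. w i = 0"
  shows "comb d u w m = w m * u m m"
proof -
  have "comb d u w m = (\<Sum>i\<in>{m}. w i * u i m)"
    unfolding comb_apply
  proof (rule sum.mono_neutral_right)
    show "\<forall>i\<in>{..d} - {m}. w i * u i m = 0"
    proof
      fix i assume "i \<in> {..d} - {m}"
      then show "w i * u i m = 0"
        using assms(2)[of i] assms(3) by (cases "i < m") (auto simp: supp_le_def)
    qed
  qed (use assms in auto)
  then show ?thesis by simp
qed

lemma bij_betw_comb:
  fixes u :: "nat \<Rightarrow> nat \<Rightarrow> complex"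
  assumes tri: "\<And>i. i \<le> d \<Longrightarrow> u i \<in> supp_le i" and nz: "\<And>i. i \<le> d \<Longrightarrow> u i i \<noteq> 0"
  shows "bij_betw (comb d u) (supp_le d) (supp_le d)"
proof (rule bij_betw_imageI)
  have ker: "w = 0" if w: "w \<in> supp_le d" and 0: "comb d u w = 0" for w
  proof -
    have "\<forall>i\<ge>0. w i = 0"
    proof (rule inc_induct[of 0 "Suc d" "\<lambda>m. \<forall>i\<ge>m. w i = 0"])
      show "\<forall>i\<ge>Suc d. w i = 0" using w by (auto simp: supp_le_def)
      fix m assume m: "m < Suc d" and IH: "\<forall>i\<ge>Suc m. w i = 0"
      have "w m * u m m = 0"
        using comb_triangular[of m d u w] m tri IH 0 by auto
      then have "w m = 0" using nz[of m] m by simp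
      then show "\<forall>i\<ge>m. w i = 0" using IH by (metis Suc_leI le_eq_less_or_eq)
    qed simp
    then show ?thesis by (simp add: fun_eq_iff)
  qed
  show "inj_on (comb d u) (supp_le d)"
  proof (rule inj_onI)
    fix v w assume "v \<in> supp_le d" "w \<in> supp_le d" "comb d u v = comb d u w"
    then show "v = w" using ker[of "v - w"] lin_on_UNIV(3)[OF lin_on_comb, of d u v w]
      by (simp add: supp_le_closed)
  qed
  \<comment> \<open>Back substitution: subtracting a multiple of \<open>u m\<close> removes the top
    entry \<open>y m\<close>.\<close>
  have ex: "m \<le> Suc d \<Longrightarrow> \<forall>i\<ge>m. y i = 0 \<Longrightarrow> \<exists>w. (\<forall>i\<ge>m. w i = 0) \<and> comb d u w = y" for m y
  proof (induction m arbitrary: y)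
    case 0
    then have "comb d u (\<lambda>_. 0) x = y x" for x by (simp only: comb_apply) simp
    then show ?case by (intro exI[of _ "\<lambda>_. 0"]) auto
  next
    case (Suc m)
    define c where "c = y m / u m m"
    have m: "m \<le> d" using Suc.prems by simp
    have "\<forall>i\<ge>m. (y - vsc c (u m)) i = 0"
    proof (intro allI impI)
      fix i assume "m \<le> i"
      then consider "i = m" | "Suc m \<le> i" by linarith
      then show "(y - vsc c (u m)) i = 0"
        using Suc.prems tri[OF m] nz[OF m] by cases (auto simp: c_def supp_le_def)
    qed
    then obtain w where w: "\<forall>i\<ge>m. w i = 0" "comb d u w = y - vsc c (u m)"
      using Suc by (metis Suc_leD)
    have "comb d u (w(m := c)) x = y x" for x
    proof -
      have "comb d u (w(m := c)) x = (\<Sum>i\<le>d. w i * u i x + (if i = m then c * u m x else 0))"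
        unfolding comb_apply by (rule sum.cong) (use w(1) in auto)
      also have "\<dots> = comb d u w x + c * u m x"
        using m by (simp add: sum.distrib comb_apply)
      finally show ?thesis by (simp add: w(2))
    qed
    moreover have "\<forall>i\<ge>Suc m. (w(m := c)) i = 0" using w(1) by auto
    ultimately show ?case by (metis ext)
  qed
  have "comb d u w \<in> supp_le d" for w
    using tri by (auto simp: supp_le_def comb_apply intro!: sum.neutral)
  moreover have "y \<in> comb d u ` supp_le d" if "y \<in> supp_le d" for y
    using ex[of "Suc d" y] that by (auto simp: supp_le_def image_iff Suc_le_eq)
  ultimately show "comb d u ` supp_le d = supp_le d" by blast
qed

text \<open>The vectors \<open>(A - \<alpha> (i - 1)) ... (A - \<alpha> 0) v\<close>.\<close>

primrec chain :: "nat vop \<Rightarrow> (nat \<Rightarrow> complex) \<Rightarrow> (nat \<Rightarrow> complex) \<Rightarrow> nat \<Rightarrow> nat \<Rightarrow> complex" where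
  "chain A \<alpha> v 0 = v"
| "chain A \<alpha> v (Suc i) = A (chain A \<alpha> v i) - vsc (\<alpha> i) (chain A \<alpha> v i)"

lemma car_bidiag_mod: "car (bidiag_mod d \<alpha> \<beta> \<phi> \<kappa>) = supp_le d"
  and actX_bidiag_mod: "actX (bidiag_mod d \<alpha> \<beta> \<phi> \<kappa>) = bidiagX d \<alpha>"
  and actY_bidiag_mod: "actY (bidiag_mod d \<alpha> \<beta> \<phi> \<kappa>) = bidiagY d \<beta> \<phi>"
  and actZ_bidiag_mod: "actZ (bidiag_mod d \<alpha> \<beta> \<phi> \<kappa>) w
    = bidiagX d \<alpha> (bidiagY d \<beta> \<phi> w) + bidiagY d \<beta> \<phi> (bidiagX d \<alpha> w) - vsc \<kappa> w"
  by (auto simp: bidiag_mod_def car_def actX_def actY_def actZ_def supp_le_def)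

lemmas bidiag_mod_simps = car_bidiag_mod actX_bidiag_mod actY_bidiag_mod actZ_bidiag_mod

text \<open>The isomorphism sends the \<open>i\<close>-th unit vector to the \<open>i\<close>-th
  chain vector. By \<open>lead\<close>, each application of \<open>A\<close> extends the support by
  exactly one index, so the chain is a triangular basis; \<open>split_chain\<close> gives the action
  of \<open>B\<close>, and \<open>nil\<close> and \<open>top\<close> close the chain at its two
  ends.\<close>

lemma bimod_iso_chain:
  assumes P: "BI_params \<alpha> \<beta> \<phi> \<kappa> \<nu> \<mu>" and top: "\<phi> (Suc d) = 0"
    and linA: "lin_on UNIV A" and linB: "lin_on UNIV B"
    and A: "\<And>w. w \<in> supp_le d \<Longrightarrow> A w \<in> supp_le d"
    and lead: "\<And>i w. i < d \<Longrightarrow> w \<in> supp_le i \<Longrightarrow> A w \<in> supp_le (Suc i) \<and> (w i \<noteq> 0 \<longrightarrow> A w (Suc i) \<noteq> 0)"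
    and v: "v \<in> supp_le 0" "v 0 \<noteq> 0"
    and rel: "\<And>w. w \<in> supp_le d \<Longrightarrow>
        A (A (B w)) + vsc 2 (A (B (A w))) + B (A (A w)) = B w + vsc (2 * \<kappa>) (A w) + vsc \<mu> w"
    and B0: "B v = vsc (\<beta> 0) v"
    and B1: "B (chain A \<alpha> v 1) = vsc (\<beta> 1) (chain A \<alpha> v 1) + vsc (\<phi> 1) v"
    and nil: "chain A \<alpha> v (Suc d) = 0"
    and N: "car N = supp_le d" "\<And>w. w \<in> supp_le d \<Longrightarrow> actX N w = A w" "\<And>w. w \<in> supp_le d \<Longrightarrow> actY N w = B w"
      "\<And>w. w \<in> supp_le d \<Longrightarrow> actZ N w = A (B w) + B (A w) - vsc \<kappa> w"
  shows "bimod_iso (bidiag_mod d \<alpha> \<beta> \<phi> \<kappa>) N"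
proof -
  define u where "u = chain A \<alpha> v"
  have v': "v \<in> supp_le d" using v by (auto simp: supp_le_def)
  have uV: "u i \<in> supp_le d" for i
    unfolding u_def by (induction i) (simp_all only: v' chain.simps supp_le_closed A)
  have u0: "B (u 0) = vsc (\<beta> 0) (u 0)"
    unfolding u_def chain.simps(1) by (rule B0)
  have u1: "B (u 1) = vsc (\<beta> 1) (u 1) + vsc (\<phi> 1) (u 0)"
    unfolding u_def chain.simps(1) by (rule B1)
  have uS: "u (Suc i) = A (u i) - vsc (\<alpha> i) (u i)" for i
    unfolding u_def by (rule chain.simps(2))
  have uB: "B (u i) = vsc (\<beta> i) (u i) + vsc (\<phi> i) (u (i - 1))" for i
    by (rule split_chain[OF linA linB rel uV P uS u0 u1])
  have uA: "A (u i) = u (Suc i) + vsc (\<alpha> i) (u i)" for i by (simp add: u_def)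
  have tri: "u i \<in> supp_le i \<and> u i i \<noteq> 0" if "i \<le> d" for i
    using that
  proof (induction i)
    case (Suc i)
    then have IH: "u i \<in> supp_le i" "u i i \<noteq> 0" by auto
    have "u (Suc i) \<in> supp_le (Suc i)" "u (Suc i) (Suc i) = A (u i) (Suc i)"
      using lead[of i "u i"] IH Suc.prems by (auto simp: u_def supp_le_def)
    then show ?case using lead[of i "u i"] IH Suc.prems by auto
  qed (use v in \<open>simp add: u_def\<close>)
  have \<phi>0: "\<phi> 0 = 0" using P by (simp add: BI_params_def)
  have X: "comb d u (bidiagX d \<alpha> w) = A (comb d u w)" for w
    by (rule comb_bidiagX[where u = u, OF linA uA]) (unfold u_def, rule nil)
  have Y: "comb d u (bidiagY d \<beta> \<phi> w) = B (comb d u w)" for w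
    by (rule comb_bidiagY[where u = u, OF linB uB \<phi>0 top])
  have bij: "bij_betw (comb d u) (supp_le d) (supp_le d)"
    by (rule bij_betw_comb) (use tri in auto)
  have img: "comb d u w \<in> supp_le d" if "w \<in> supp_le d" for w
    using bij that by (auto simp: bij_betw_def)
  note lin = lin_on_UNIV[OF lin_on_comb[of UNIV d u]]
  have "intertwines (bidiag_mod d \<alpha> \<beta> \<phi> \<kappa>) N (comb d u)"
    unfolding intertwines_def by (auto simp: bidiag_mod_simps N img lin X Y)
  then show ?thesis
    unfolding bimod_iso_def using bij
    by (intro exI[of _ "comb d u"]) (auto simp: bidiag_mod_simps N lin_on_comb)
qed

subsection \<open>Exchanging X and Z\<close>

lemma BI_params_sum_neq_0:
  assumes "BI_params \<alpha> \<beta> \<phi> \<kappa> \<nu> \<mu>" shows "\<beta> i + \<beta> (Suc i) \<noteq> 0"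
proof -
  have "(\<beta> i + \<beta> (Suc i))\<^sup>2 = 1" using assms by (auto simp: BI_params_def)
  then show ?thesis by auto
qed

lemma bidiag_XXY:
  assumes P: "BI_params \<alpha> \<beta> \<phi> \<kappa> \<nu> \<mu>" and top: "\<phi> (Suc d) = 0" and w: "w \<in> supp_le d"
  defines "X \<equiv> bidiagX d \<alpha>" and "Y \<equiv> bidiagY d \<beta> \<phi>"
  shows "X (X (Y w)) + vsc 2 (X (Y (X w))) + Y (X (X w)) = Y w + vsc (2 * \<kappa>) (X w) + vsc \<mu> w"
    and "Y (Y (X w)) + vsc 2 (Y (X (Y w))) + X (Y (Y w)) = X w + vsc (2 * \<kappa>) (Y w) + vsc \<nu> w"
proof -
  have X: "X v = trunc d (verma_X \<alpha> v)" for v by (simp add: X_def bidiagX_eq_trunc)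
  have Y: "Y v = trunc d (verma_Y \<beta> \<phi> v)" for v by (simp add: Y_def bidiagY_eq_trunc top)
  have cY: "trunc d (verma_Y \<beta> \<phi> (trunc d w)) = trunc d (verma_Y \<beta> \<phi> w)" for w by (rule trunc_verma_Y_trunc[where \<phi> = \<phi>, OF top])
  show "X (X (Y w)) + vsc 2 (X (Y (X w))) + Y (X (X w)) = Y w + vsc (2 * \<kappa>) (X w) + vsc \<mu> w"
    using arg_cong[OF verma_XXY[OF P, of w], of "trunc d"]
    by (simp only: trunc_add trunc_vsc X Y cY trunc_verma_X_trunc trunc_supp_le[OF w])
  show "Y (Y (X w)) + vsc 2 (Y (X (Y w))) + X (Y (Y w)) = X w + vsc (2 * \<kappa>) (Y w) + vsc \<nu> w"
    using arg_cong[OF verma_YYX[OF P, of w], of "trunc d"]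
    by (simp only: trunc_add trunc_vsc X Y cY trunc_verma_X_trunc trunc_supp_le[OF w])
qed

definition bidiagZ where
  "bidiagZ d \<alpha> \<beta> \<phi> \<kappa> w = bidiagX d \<alpha> (bidiagY d \<beta> \<phi> w) + bidiagY d \<beta> \<phi> (bidiagX d \<alpha> w) - vsc \<kappa> w"

lemma actZ_bidiagZ: "actZ (bidiag_mod d \<alpha> \<beta> \<phi> \<kappa>) = bidiagZ d \<alpha> \<beta> \<phi> \<kappa>"
  by (simp add: fun_eq_iff actZ_bidiag_mod bidiagZ_def)

lemma lin_on_bidiagZ: "lin_on UNIV (bidiagZ d \<alpha> \<beta> \<phi> \<kappa>)"
  unfolding lin_on_def bidiagZ_def
  by (auto simp: lin_on_UNIV[OF lin_on_bidiag(1)] lin_on_UNIV[OF lin_on_bidiag(2)] fun_eq_iff algebra_simps)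

lemma bidiagZ_supp_le: "w \<in> supp_le d \<Longrightarrow> bidiagZ d \<alpha> \<beta> \<phi> \<kappa> w \<in> supp_le d"
  unfolding bidiagZ_def by (intro supp_le_closed bidiag_supp_le)

lemma bidiag_ZX_YZ:
  assumes P: "BI_params \<alpha> \<beta> \<phi> \<kappa> \<nu> \<mu>" and top: "\<phi> (Suc d) = 0" and w: "w \<in> supp_le d"
  defines "X \<equiv> bidiagX d \<alpha>" and "Y \<equiv> bidiagY d \<beta> \<phi>" and "Z \<equiv> bidiagZ d \<alpha> \<beta> \<phi> \<kappa>"
  shows "Z (X w) + X (Z w) = Y w + vsc \<mu> w" and "Y (Z w) + Z (Y w) = X w + vsc \<nu> w"
proof -
  note lX = lin_on_UNIV[OF lin_on_bidiag(1)[of d \<alpha>], folded X_def]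
    and lY = lin_on_UNIV[OF lin_on_bidiag(2)[of d \<beta> \<phi>], folded Y_def]
  have Z: "Z v = X (Y v) + Y (X v) - vsc \<kappa> v" for v by (simp add: Z_def bidiagZ_def X_def Y_def)
  note r = bidiag_XXY[OF P top w, folded X_def Y_def]
  show "Z (X w) + X (Z w) = Y w + vsc \<mu> w"
    using r(1) unfolding Z lX by (simp add: fun_eq_iff algebra_simps)
  show "Y (Z w) + Z (Y w) = X w + vsc \<nu> w"
    using r(2) unfolding Z lY by (simp add: fun_eq_iff algebra_simps)
qed

text \<open>Eliminating \<open>X\<close> from \<open>{Y,Z} = X + \<nu>\<close> and
  \<open>{Z,X} = Y + \<mu>\<close> gives for \<open>Z\<close> and \<open>Y\<close> the cubic
  relation of \<open>X\<close> and \<open>Y\<close>, with \<open>\<nu>\<close> in place of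
  \<open>\<kappa>\<close>. Hence \<open>split_chain\<close> applies with \<open>Z\<close> as raising
  operator.\<close>

lemma bidiag_ZZY:
  assumes P: "BI_params \<alpha> \<beta> \<phi> \<kappa> \<nu> \<mu>" and top: "\<phi> (Suc d) = 0" and w: "w \<in> supp_le d"
  defines "Y \<equiv> bidiagY d \<beta> \<phi>" and "Z \<equiv> bidiagZ d \<alpha> \<beta> \<phi> \<kappa>"
  shows "Z (Z (Y w)) + vsc 2 (Z (Y (Z w))) + Y (Z (Z w)) = Y w + vsc (2 * \<nu>) (Z w) + vsc \<mu> w"
proof -
  define X where "X = bidiagX d \<alpha>"
  note lZ = lin_on_UNIV[OF lin_on_bidiagZ[of d \<alpha> \<beta> \<phi> \<kappa>], folded Z_def]
  have Zw: "Z w \<in> supp_le d" unfolding Z_def by (rule bidiagZ_supp_le[OF w])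
  note r = bidiag_ZX_YZ[OF P top, folded X_def Y_def Z_def]
  have "Z (Z (Y w)) + vsc 2 (Z (Y (Z w))) + Y (Z (Z w))
      = (Z (Y (Z w)) + Z (Z (Y w))) + (Y (Z (Z w)) + Z (Y (Z w)))"
    by (simp add: fun_eq_iff)
  also have "Z (Y (Z w)) + Z (Z (Y w)) = Z (X w) + vsc \<nu> (Z w)"
    using arg_cong[OF r(2)[OF w], of Z] unfolding lZ .
  also have "Y (Z (Z w)) + Z (Y (Z w)) = X (Z w) + vsc \<nu> (Z w)" by (rule r(2)[OF Zw])
  also have "(Z (X w) + vsc \<nu> (Z w)) + (X (Z w) + vsc \<nu> (Z w)) = (Z (X w) + X (Z w)) + vsc (2 * \<nu>) (Z w)"
    by (simp add: fun_eq_iff algebra_simps)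
  finally show ?thesis unfolding r(1)[OF w] by (simp add: fun_eq_iff algebra_simps)
qed

definition e0 :: "nat \<Rightarrow> complex" where "e0 i = (if i = 0 then 1 else 0)"

lemma bidiagY_e0: "bidiagY d \<beta> \<phi> e0 = vsc (\<beta> 0) e0"
  by (auto simp: fun_eq_iff bidiagY_def e0_def)

text \<open>The first chain vector is \<open>c\<close> times the unit vector 0 minus the unit vector
  1, as \<open>\<beta> 0 + \<beta> 1 = - 1\<close>. Applying the upper bidiagonal operator to it
  produces exactly the value required of \<open>\<phi>' 1\<close>. For \<open>d = 0\<close> the unit
  vector 1 is absent, and \<open>top\<close> makes both \<open>\<phi> 1\<close> and
  \<open>\<phi>' 1\<close> zero.\<close>

lemma bidiagZ_base:
  assumes top: "\<phi> (Suc d) = 0" "\<phi>' (Suc d) = 0" and s: "\<beta> 0 + \<beta> 1 = - 1"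
    and base: "\<phi>' 1 = (2 * \<alpha> 0 * \<beta> 0 + \<phi> 1 - \<kappa> - \<alpha>' 0) * (\<beta> 0 - \<beta> 1) - \<phi> 1"
  shows "bidiagY d \<beta> \<phi> (chain (bidiagZ d \<alpha> \<beta> \<phi> \<kappa>) \<alpha>' e0 1)
    = vsc (\<beta> 1) (chain (bidiagZ d \<alpha> \<beta> \<phi> \<kappa>) \<alpha>' e0 1) + vsc (\<phi>' 1) e0"
proof -
  define c where "c = 2 * \<alpha> 0 * \<beta> 0 + \<phi> 1 - \<kappa> - \<alpha>' 0"
  have 1: "chain (bidiagZ d \<alpha> \<beta> \<phi> \<kappa>) \<alpha>' e0 1 = (\<lambda>i. if i = 0 then c else if i = 1 \<and> d \<noteq> 0 then - 1 else 0)"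
    using top s by (cases "d = 0")
      (auto simp: fun_eq_iff bidiagZ_def bidiagX_def bidiagY_def e0_def c_def add_eq_0_iff algebra_simps)
  show ?thesis
    unfolding 1 using top base[folded c_def] by (cases "d = 0")
      (auto simp: fun_eq_iff bidiagY_def e0_def algebra_simps)
qed

lemma bidiagX_base:
  assumes top: "\<phi> (Suc d) = 0" "\<phi>' (Suc d) = 0"
    and base: "\<phi>' 1 = (s * \<alpha> 0 - \<alpha>' 0) * (\<beta> 0 - \<beta> 1) + s * \<phi> 1"
  shows "bidiagY d \<beta> \<phi> (chain (\<lambda>w. vsc s (bidiagX d \<alpha> w)) \<alpha>' e0 1)
    = vsc (\<beta> 1) (chain (\<lambda>w. vsc s (bidiagX d \<alpha> w)) \<alpha>' e0 1) + vsc (\<phi>' 1) e0"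
proof -
  define c where "c = s * \<alpha> 0 - \<alpha>' 0"
  have 1: "chain (\<lambda>w. vsc s (bidiagX d \<alpha> w)) \<alpha>' e0 1 = (\<lambda>i. if i = 0 then c else if i = 1 \<and> d \<noteq> 0 then s else 0)"
    by (cases "d = 0") (auto simp: fun_eq_iff bidiagX_def e0_def c_def algebra_simps)
  show ?thesis
    unfolding 1 using top base[folded c_def] by (cases "d = 0")
      (auto simp: fun_eq_iff bidiagY_def e0_def algebra_simps)
qed

lemma chain_supp_le:
  assumes "\<And>w. w \<in> supp_le d \<Longrightarrow> A w \<in> supp_le d" "v \<in> supp_le d"
  shows "chain A \<alpha> v i \<in> supp_le d"
  by (induction i) (simp_all only: assms chain.simps supp_le_closed)

text \<open>Past the last index the chain is a \<open>B\<close>-eigenvector for the formal continuation \<open>\<beta> (Suc d)\<close>,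
  which is no eigenvalue of \<open>B\<close>.\<close>
lemma chain_Suc_eq_0:
  assumes P: "BI_params \<alpha> \<beta> \<phi> \<kappa> \<nu> \<mu>" and top: "\<phi> (Suc d) = 0"
    and linA: "lin_on UNIV A"
    and A: "\<And>w. w \<in> supp_le d \<Longrightarrow> A w \<in> supp_le d"
    and rel: "\<And>w. w \<in> supp_le d \<Longrightarrow> A (A (bidiagY d \<beta> \<psi> w)) + vsc 2 (A (bidiagY d \<beta> \<psi> (A w)))
       + bidiagY d \<beta> \<psi> (A (A w)) = bidiagY d \<beta> \<psi> w + vsc (2 * \<kappa>) (A w) + vsc \<mu> w"
    and B1: "bidiagY d \<beta> \<psi> (chain A \<alpha> e0 1) = vsc (\<beta> 1) (chain A \<alpha> e0 1) + vsc (\<phi> 1) e0"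
    and ne: "\<And>j. j \<le> d \<Longrightarrow> \<beta> j \<noteq> \<beta> (Suc d)"
  shows "chain A \<alpha> e0 (Suc d) = 0"
proof -
  define u where "u = chain A \<alpha> e0"
  have e0: "e0 \<in> supp_le d" by (simp add: supp_le_def e0_def)
  have uV: "u i \<in> supp_le d" for i unfolding u_def by (rule chain_supp_le[OF A e0])
  have u0: "bidiagY d \<beta> \<psi> (u 0) = vsc (\<beta> 0) (u 0)"
    unfolding u_def chain.simps(1) by (rule bidiagY_e0)
  have u1: "bidiagY d \<beta> \<psi> (u 1) = vsc (\<beta> 1) (u 1) + vsc (\<phi> 1) (u 0)"
    unfolding u_def chain.simps(1) by (rule B1)
  have uS: "u (Suc i) = A (u i) - vsc (\<alpha> i) (u i)" for i
    unfolding u_def by (rule chain.simps(2))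
  have "bidiagY d \<beta> \<psi> (u (Suc d)) = vsc (\<beta> (Suc d)) (u (Suc d)) + vsc (\<phi> (Suc d)) (u (Suc d - 1))"
    by (rule split_chain[OF linA lin_on_bidiag(2) rel uV P uS u0 u1])
  then have "bidiagY d \<beta> \<psi> (u (Suc d)) = vsc (\<beta> (Suc d)) (u (Suc d))"
    by (simp only: top vsc_0 add_0_right)
  then have "u (Suc d) = 0"
    by (rule bidiagY_eigenvector_zero[where \<beta> = \<beta>, OF uV _ ne])
  then show ?thesis by (simp only: u_def)
qed

text \<open>Indices of equal parity give different real parts; indices of opposite parity give
  opposite non-zero imaginary parts.\<close>

lemma theta_Suc_neq:
  assumes "Im b \<noteq> 0" "j \<le> d" shows "theta d b j \<noteq> theta d b (Suc d)"
proof
  assume eq: "theta d b j = theta d b (Suc d)"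
  show False
  proof (cases "even j = even (Suc d)")
    case True
    then have "real j = real (Suc d)"
      using arg_cong[OF eq, of Re] by (cases "even j") (simp_all add: theta_even theta_odd)
    then show False using assms(2) by (simp only: of_nat_eq_iff)
  next
    case False
    then have "Im (theta d b j) = - Im (theta d b (Suc d))" "Im (theta d b (Suc d)) \<noteq> 0"
      using assms(1) by (cases "even j"; simp add: theta_even theta_odd)+
    then show False using eq by simp
  qed
qed

section \<open>Continuity of the chain in the parameter \<open>b\<close>\<close>

lemma continuous_on_bidiagX:
  assumes "\<And>x. continuous_on UNIV (\<lambda>b. w b x)"
  shows "continuous_on UNIV (\<lambda>b. bidiagX d \<alpha> (w b) x)"
  by (cases "x \<le> d"; cases "x = 0") (auto simp: bidiagX_def intro!: continuous_intros assms)

lemma continuous_on_bidiagY: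
  assumes "\<And>x. continuous_on UNIV (\<lambda>b. w b x)"
    "\<And>i. continuous_on UNIV (\<lambda>b. \<beta> b i)" "\<And>i. continuous_on UNIV (\<lambda>b. \<phi> b i)"
  shows "continuous_on UNIV (\<lambda>b. bidiagY d (\<beta> b) (\<phi> b) (w b) x)"
  by (cases "x \<le> d"; cases "x = d") (auto simp: bidiagY_def intro!: continuous_intros assms)

lemma bidiagZ_apply: "bidiagZ d \<alpha> \<beta> \<phi> \<kappa> w x
    = bidiagX d \<alpha> (bidiagY d \<beta> \<phi> w) x + bidiagY d \<beta> \<phi> (bidiagX d \<alpha> w) x - \<kappa> * w x"
  by (simp add: bidiagZ_def)

lemma continuous_on_bidiagZ:
  assumes "\<And>x. continuous_on UNIV (\<lambda>b. w b x)"
    "\<And>i. continuous_on UNIV (\<lambda>b. \<beta> b i)" "\<And>i. continuous_on UNIV (\<lambda>b. \<phi> b i)" "continuous_on UNIV \<kappa>"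
  shows "continuous_on UNIV (\<lambda>b. bidiagZ d \<alpha> (\<beta> b) (\<phi> b) (\<kappa> b) (w b) x)"
  unfolding bidiagZ_apply
  by (intro continuous_intros continuous_on_bidiagX continuous_on_bidiagY[where \<beta> = \<beta> and \<phi> = \<phi>] assms)

lemma chain_Suc_apply: "chain A \<alpha> v (Suc i) x = A (chain A \<alpha> v i) x - \<alpha> i * chain A \<alpha> v i x"
  by simp

lemma continuous_on_chain_bidiagZ:
  assumes "\<And>i. continuous_on UNIV (\<lambda>b. \<beta> b i)" "\<And>i. continuous_on UNIV (\<lambda>b. \<phi> b i)" "continuous_on UNIV \<kappa>"
  shows "continuous_on UNIV (\<lambda>b. chain (bidiagZ d \<alpha> (\<beta> b) (\<phi> b) (\<kappa> b)) \<alpha>' v i x)"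
proof (induction i arbitrary: x)
  case (Suc i)
  show ?case
    unfolding chain_Suc_apply by (intro continuous_intros continuous_on_bidiagZ assms Suc)
qed simp

text \<open>The non-real numbers are dense: a real \<open>b\<close> is the limit of
  \<open>b + \<i> / (n + 1)\<close>.\<close>

lemma eq_0_of_Im_neq_0:
  fixes f :: "complex \<Rightarrow> complex"
  assumes "continuous_on UNIV f" "\<And>b. Im b \<noteq> 0 \<Longrightarrow> f b = 0"
  shows "f b = 0"
proof (cases "Im b = 0")
  case True
  define X where "X n = b + \<i> * of_real (inverse (real (Suc n)))" for n
  have "X \<longlonglongrightarrow> b + \<i> * of_real 0"
    unfolding X_def by (intro tendsto_intros LIMSEQ_inverse_real_of_nat)
  then have "(\<lambda>n. f (X n)) \<longlonglongrightarrow> f b"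
    using assms(1) continuous_on_tendsto_compose[of UNIV f X b] by simp
  moreover have "f (X n) = 0" for n
    by (rule assms(2)) (simp add: X_def True del: of_nat_Suc)
  ultimately show ?thesis by (simp add: LIMSEQ_const_iff)
qed (rule assms(2))

definition swap_XZ :: "'i bimod \<Rightarrow> 'i bimod" where
  "swap_XZ M = (car M, actZ M, actY M, actX M)"

text \<open>The upper bidiagonal operator of a split form depends on a parameter \<open>b\<close>; all the rest of
  the target data is constant or continuous in \<open>b\<close>, so that the degenerate values of \<open>b\<close> are
  reached by continuity.\<close>
lemma bimod_iso_swap_XZ:
  fixes \<phi> \<phi>' :: "complex \<Rightarrow> nat \<Rightarrow> complex"
  assumes P: "\<And>b. BI_params \<alpha> (theta d b) (\<phi> b) (\<kappa> b) (\<nu> b) (\<mu> b)" and top: "\<And>b. \<phi> b (Suc d) = 0"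
    and P': "\<And>b. BI_params \<alpha>' (theta d b) (\<phi>' b) (\<nu> b) (\<kappa> b) (\<mu> b)" and top': "\<And>b. \<phi>' b (Suc d) = 0"
    and base: "\<And>b. \<phi>' b 1 = (2 * \<alpha> 0 * theta d b 0 + \<phi> b 1 - \<kappa> b - \<alpha>' 0) * (theta d b 0 - theta d b 1) - \<phi> b 1"
    and cont: "\<And>i. continuous_on UNIV (\<lambda>b. \<phi> b i)" "continuous_on UNIV \<kappa>"
  shows "bimod_iso (bidiag_mod d \<alpha>' (theta d b) (\<phi>' b) (\<nu> b))
    (swap_XZ (bidiag_mod d \<alpha> (theta d b) (\<phi> b) (\<kappa> b)))"
proof -
  define Z where "Z b = bidiagZ d \<alpha> (theta d b) (\<phi> b) (\<kappa> b)" for b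
  note rel = bidiag_ZZY[OF P top, folded Z_def]
  have s: "theta d b 0 + theta d b 1 = - 1" for b using theta_add_Suc[of d b 0] by simp
  have B1: "bidiagY d (theta d b) (\<phi> b) (chain (Z b) \<alpha>' e0 1)
      = vsc (theta d b 1) (chain (Z b) \<alpha>' e0 1) + vsc (\<phi>' b 1) e0" for b
    unfolding Z_def by (rule bidiagZ_base) (rule top top' s base)+
  have Zsupp: "w \<in> supp_le d \<Longrightarrow> Z b w \<in> supp_le d" for b w
    unfolding Z_def by (rule bidiagZ_supp_le)
  have linZ: "lin_on UNIV (Z b)" for b unfolding Z_def by (rule lin_on_bidiagZ)
  have nil: "chain (Z b) \<alpha>' e0 (Suc d) x = 0" for b x
  proof (rule eq_0_of_Im_neq_0[of "\<lambda>b. chain (Z b) \<alpha>' e0 (Suc d) x"])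
    show "continuous_on UNIV (\<lambda>b. chain (Z b) \<alpha>' e0 (Suc d) x)"
      unfolding Z_def by (rule continuous_on_chain_bidiagZ) (auto simp: theta_def intro!: continuous_intros cont)
    show "chain (Z b) \<alpha>' e0 (Suc d) x = 0" if "Im b \<noteq> 0" for b
      using chain_Suc_eq_0[OF P' top' linZ Zsupp rel B1 theta_Suc_neq[OF that]] by simp
  qed
  \<comment> \<open>The coefficient by which \<open>Z\<close> raises the top entry is a sum of two
    consecutive diagonal values of \<open>Y\<close>, whose square is 1.\<close>
  have lead: "Z b w \<in> supp_le (Suc i) \<and> (w i \<noteq> 0 \<longrightarrow> Z b w (Suc i) \<noteq> 0)"
    if i: "i < d" and w: "w \<in> supp_le i" for i w
  proof -
    have "Z b w (Suc i) = (theta d b i + theta d b (Suc i)) * w i"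
      using i w by (auto simp: Z_def bidiagZ_def bidiagX_def bidiagY_def supp_le_def algebra_simps)
    moreover have "Z b w \<in> supp_le (Suc i)"
      using i w by (auto simp: Z_def bidiagZ_def bidiagX_def bidiagY_def supp_le_def)
    ultimately show ?thesis using BI_params_sum_neq_0[OF P] by simp
  qed
  show ?thesis
  proof (rule bimod_iso_chain[OF P' top' linZ lin_on_bidiag(2) Zsupp lead _ _ rel bidiagY_e0 B1])
    show "chain (Z b) \<alpha>' e0 (Suc d) = 0" using nil by (simp add: fun_eq_iff)
    fix w assume w: "w \<in> supp_le d"
    have "bidiagX d \<alpha> w + vsc (\<nu> b) w = bidiagY d (theta d b) (\<phi> b) (Z b w) + Z b (bidiagY d (theta d b) (\<phi> b) w)"
      using bidiag_ZX_YZ(2)[OF P top w] by (simp only: Z_def)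
    then show "actZ (swap_XZ (bidiag_mod d \<alpha> (theta d b) (\<phi> b) (\<kappa> b))) w =
         Z b (bidiagY d (theta d b) (\<phi> b) w) + bidiagY d (theta d b) (\<phi> b) (Z b w) - vsc (\<nu> b) w"
      by (simp add: swap_XZ_def actZ_def actX_def[symmetric] actX_bidiag_mod algebra_simps)
  qed (simp_all add: supp_le_def e0_def, auto simp: swap_XZ_def Z_def car_def actX_def actY_def
       simp flip: actZ_bidiagZ, auto simp: bidiag_mod_def supp_le_def)
qed

subsection \<open>Reversing the order of a split form\<close>

lemma lin_on_vsc_bidiagX: "lin_on UNIV (\<lambda>w. vsc s (bidiagX d \<alpha> w))"
  unfolding lin_on_def by (simp add: lin_on_UNIV[OF lin_on_bidiag(1)] fun_eq_iff algebra_simps)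

lemma bidiag_neg_rel:
  assumes P: "BI_params \<alpha> \<beta> \<phi> \<kappa> \<nu> \<mu>" and top: "\<phi> (Suc d) = 0" and w: "w \<in> supp_le d" and s: "s * s = 1"
  defines "A \<equiv> \<lambda>w. vsc s (bidiagX d \<alpha> w)" and "Y \<equiv> bidiagY d \<beta> \<phi>"
  shows "A (A (Y w)) + vsc 2 (A (Y (A w))) + Y (A (A w)) = Y w + vsc (2 * (s * \<kappa>)) (A w) + vsc \<mu> w"
proof -
  have k: "2 * (s * \<kappa>) * s = 2 * \<kappa>" using s by (simp add: algebra_simps)
  show ?thesis
    using bidiag_XXY(1)[OF P top w] unfolding A_def Y_def
    by (simp add: lin_on_UNIV(2)[OF lin_on_bidiag(1)] lin_on_UNIV(2)[OF lin_on_bidiag(2)] s k)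
qed

text \<open>The chain of \<open>s * X\<close> from \<open>e0\<close> in the new order
  \<open>\<alpha>'\<close> leaves the diagonal of \<open>Y\<close> as it is and rearranges the
  eigenvalues of \<open>X\<close>. Its first vector forces the value of \<open>\<phi>' 1\<close> in
  \<open>base\<close>; that the chain stops is supplied separately through
  \<open>nil\<close>.\<close>

lemma bimod_iso_neg:
  assumes P: "BI_params \<alpha> \<beta> \<phi> \<kappa> \<nu> \<mu>" and top: "\<phi> (Suc d) = 0"
    and P': "BI_params \<alpha>' \<beta> \<phi>' (s * \<kappa>) \<nu>' \<mu>" and top': "\<phi>' (Suc d) = 0"
    and base: "\<phi>' 1 = (s * \<alpha> 0 - \<alpha>' 0) * (\<beta> 0 - \<beta> 1) + s * \<phi> 1" and s: "s * s = 1"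
    and nil: "chain (\<lambda>w. vsc s (bidiagX d \<alpha> w)) \<alpha>' e0 (Suc d) = 0"
  shows "bimod_iso (bidiag_mod d \<alpha>' \<beta> \<phi>' (s * \<kappa>)) (twist_sgn s 1 s (bidiag_mod d \<alpha> \<beta> \<phi> \<kappa>))"
proof -
  define A where "A = (\<lambda>w. vsc s (bidiagX d \<alpha> w))"
  have linA: "lin_on UNIV A" unfolding A_def by (rule lin_on_vsc_bidiagX)
  have As: "A w \<in> supp_le d" for w unfolding A_def by (intro supp_le_closed bidiag_supp_le)
  have rel: "A (A (bidiagY d \<beta> \<phi> w)) + vsc 2 (A (bidiagY d \<beta> \<phi> (A w))) + bidiagY d \<beta> \<phi> (A (A w))
      = bidiagY d \<beta> \<phi> w + vsc (2 * (s * \<kappa>)) (A w) + vsc \<mu> w" if "w \<in> supp_le d" for w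
    unfolding A_def by (rule bidiag_neg_rel[OF P top that s])
  have B1: "bidiagY d \<beta> \<phi> (chain A \<alpha>' e0 1) = vsc (\<beta> 1) (chain A \<alpha>' e0 1) + vsc (\<phi>' 1) e0"
    unfolding A_def by (rule bidiagX_base) (rule top top' base)+
  have lead: "A w \<in> supp_le (Suc i) \<and> (w i \<noteq> 0 \<longrightarrow> A w (Suc i) \<noteq> 0)"
    if "i < d" and "w \<in> supp_le i" for i w
    using that s by (auto simp: A_def supp_le_def bidiagX_def)
  show ?thesis
  proof (rule bimod_iso_chain[OF P' top' linA lin_on_bidiag(2) As lead _ _ rel bidiagY_e0 B1])
    show "chain A \<alpha>' e0 (Suc d) = 0" using nil by (simp only: A_def)
    fix w
    show "actZ (twist_sgn s 1 s (bidiag_mod d \<alpha> \<beta> \<phi> \<kappa>)) w =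
         A (bidiagY d \<beta> \<phi> w) + bidiagY d \<beta> \<phi> (A w) - vsc (s * \<kappa>) w"
      unfolding A_def lin_on_UNIV[OF lin_on_bidiag(2)]
      by (simp add: twist_sgn_def actZ_def[of "(_, _)"] actZ_bidiag_mod fun_eq_iff algebra_simps)
  qed (auto simp: supp_le_def e0_def twist_sgn_def A_def car_def[of "(_, _)"] actX_def[of "(_, _)"]
      actY_def[of "(_, _)"] bidiag_mod_simps)
qed

lemma phiE_top: "odd d \<Longrightarrow> phiE d a b c (Suc d) = 0"
  and phiO_top: "even d \<Longrightarrow> phiO d a b c (Suc d) = 0"
  by (simp_all add: phiE_def phiO_def)

lemma continuous_on_phi:
  "continuous_on UNIV (\<lambda>b. phiE d a b c i)" "continuous_on UNIV (\<lambda>b. phiO d a b c i)"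
  "continuous_on UNIV (\<lambda>b. kapE d a b c)" "continuous_on UNIV (\<lambda>b. kapO d a b c)"
  by (cases "even i"; auto simp: phiE_def phiO_def kapE_def kapO_def intro!: continuous_intros)+

text \<open>Exchanging \<open>X\<close> and \<open>Z\<close> exchanges the values of
  \<open>{X,Y} - Z\<close> and \<open>{Y,Z} - X\<close>, which for \<open>kapE\<close> amounts to
  exchanging \<open>a\<close> and \<open>c\<close>.\<close>

lemma Emod_swap_XZ:
  assumes "odd d" shows "bimod_iso (Emod d c b a) (swap_XZ (Emod d a b c))"
proof -
  have P': "BI_params (theta d c) (theta d b) (phiE d c b a) (kapE d c b a) (kapE d a b c) (kapE d a c b)" for b
    using BI_params_E[of d c b a] by (simp add: kapE_def algebra_simps)
  have base: "phiE d c b a 1 = (2 * theta d a 0 * theta d b 0 + phiE d a b c 1 - kapE d a b c - theta d c 0)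
      * (theta d b 0 - theta d b 1) - phiE d a b c 1" for b
    by (simp add: theta_even theta_odd phiE_def kapE_def field_simps power2_eq_square)
  show ?thesis
    unfolding Emod_eq
    by (rule bimod_iso_swap_XZ[where \<alpha> = "theta d a" and \<phi> = "\<lambda>b. phiE d a b c" and \<kappa> = "\<lambda>b. kapE d a b c"
          and \<nu> = "\<lambda>b. kapE d c b a" and \<mu> = "\<lambda>b. kapE d a c b" and \<alpha>' = "theta d c" and \<phi>' = "\<lambda>b. phiE d c b a"])
      (rule BI_params_E phiE_top assms P' base continuous_on_phi)+
qed

lemma Omod_swap_XZ:
  assumes "even d" shows "bimod_iso (Omod d c b a) (swap_XZ (Omod d a b c))"
proof -
  have P': "BI_params (theta d c) (theta d b) (phiO d c b a) (kapO d c b a) (kapO d a b c) (kapO d a c b)" for b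
    using BI_params_O[of d c b a] by (simp add: kapO_def algebra_simps)
  have base: "phiO d c b a 1 = (2 * theta d a 0 * theta d b 0 + phiO d a b c 1 - kapO d a b c - theta d c 0)
      * (theta d b 0 - theta d b 1) - phiO d a b c 1" for b
    by (simp add: theta_even theta_odd phiO_def kapO_def field_simps power2_eq_square)
  show ?thesis
    unfolding Omod_eq
    by (rule bimod_iso_swap_XZ[where \<alpha> = "theta d a" and \<phi> = "\<lambda>b. phiO d a b c" and \<kappa> = "\<lambda>b. kapO d a b c"
          and \<nu> = "\<lambda>b. kapO d c b a" and \<mu> = "\<lambda>b. kapO d a c b" and \<alpha>' = "theta d c" and \<phi>' = "\<lambda>b. phiO d c b a"])
      (rule BI_params_O phiO_top assms P' base continuous_on_phi)+
qed

text \<open>The chain does not involve \<open>\<beta>\<close>, so it may be computed for a generic one.\<close>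
lemma chain_neg_eq_0:
  assumes P: "BI_params \<alpha> (theta d \<i>) \<phi> \<kappa> \<nu> \<mu>" and top: "\<phi> (Suc d) = 0"
    and P': "BI_params \<alpha>' (theta d \<i>) \<phi>' (s * \<kappa>) \<nu>' \<mu>" and top': "\<phi>' (Suc d) = 0"
    and base: "\<phi>' 1 = (s * \<alpha> 0 - \<alpha>' 0) * (theta d \<i> 0 - theta d \<i> 1) + s * \<phi> 1" and s: "s * s = 1"
  shows "chain (\<lambda>w. vsc s (bidiagX d \<alpha> w)) \<alpha>' e0 (Suc d) = 0"
proof -
  define A where "A = (\<lambda>w. vsc s (bidiagX d \<alpha> w))"
  have linA: "lin_on UNIV A" unfolding A_def by (rule lin_on_vsc_bidiagX)
  have As: "A w \<in> supp_le d" for w unfolding A_def by (intro supp_le_closed bidiag_supp_le)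
  let ?Y = "bidiagY d (theta d \<i>) \<phi>"
  have rel: "A (A (?Y w)) + vsc 2 (A (?Y (A w))) + ?Y (A (A w))
      = ?Y w + vsc (2 * (s * \<kappa>)) (A w) + vsc \<mu> w" if "w \<in> supp_le d" for w
    unfolding A_def by (rule bidiag_neg_rel[OF P top that s])
  have B1: "?Y (chain A \<alpha>' e0 1) = vsc (theta d \<i> 1) (chain A \<alpha>' e0 1) + vsc (\<phi>' 1) e0"
    unfolding A_def by (rule bidiagX_base) (rule top top' base)+
  have "Im \<i> \<noteq> 0" by simp
  from chain_Suc_eq_0[OF P' top' linA As rel B1 theta_Suc_neq[OF this]]
  show ?thesis by (simp only: A_def)
qed

text \<open>For odd \<open>d\<close> the list \<open>theta d (- a)\<close> is
  \<open>theta d a\<close> read backwards. This is the second split form used for irreducibility;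
  the twist has trivial signs and only fits the shape of \<open>bimod_iso_neg\<close>.\<close>

lemma Emod_neg:
  assumes "odd d" shows "bimod_iso (Emod d (- a) b c) (twist_sgn 1 1 1 (Emod d a b c))"
proof -
  have k: "kapE d (- a) b c = 1 * kapE d a b c" "kapE d (- a) c b = kapE d a c b" for b
    by (simp_all add: kapE_def)
  have base: "phiE d (- a) b c 1 = (1 * theta d a 0 - theta d (- a) 0) * (theta d b 0 - theta d b 1) + 1 * phiE d a b c 1" for b
    by (simp add: theta_even theta_odd phiE_def field_simps power2_eq_square)
  note P' = BI_params_E[of d "- a" _ c, unfolded k]
  show ?thesis
    unfolding Emod_eq k
    by (rule bimod_iso_neg[OF BI_params_E phiE_top[OF assms] P' phiE_top[OF assms] base _
          chain_neg_eq_0[OF BI_params_E phiE_top[OF assms] P' phiE_top[OF assms] base]]) simp_all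
qed

text \<open>For even \<open>d\<close> the list \<open>theta d (- a)\<close> is
  \<open>theta d a\<close> read backwards and negated. Hence \<open>X\<close> and \<open>Z\<close>
  change sign, and so must \<open>c\<close>, to turn \<open>kapO d a b c\<close> into its
  negative.\<close>

lemma Omod_neg:
  assumes "even d" shows "bimod_iso (Omod d (- a) b (- c)) (twist_sgn (- 1) 1 (- 1) (Omod d a b c))"
proof -
  have k: "kapO d (- a) b (- c) = - 1 * kapO d a b c" "kapO d (- a) (- c) b = kapO d a c b" for b
    by (simp_all add: kapO_def)
  have base: "phiO d (- a) b (- c) 1 = (- 1 * theta d a 0 - theta d (- a) 0) * (theta d b 0 - theta d b 1) + - 1 * phiO d a b c 1" for b
    by (simp add: theta_even theta_odd phiO_def field_simps power2_eq_square)
  note P' = BI_params_O[of d "- a" _ "- c", unfolded k]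
  show ?thesis
    unfolding Omod_eq k
    by (rule bimod_iso_neg[OF BI_params_O phiO_top[OF assms] P' phiO_top[OF assms] base _
          chain_neg_eq_0[OF BI_params_O phiO_top[OF assms] P' phiO_top[OF assms] base]]) simp_all
qed

text \<open>Reading the basis backwards makes \<open>X\<close> upper and \<open>Y\<close> lower
  bidiagonal. A diagonal rescaling then moves the entries \<open>\<phi>\<close> from
  \<open>Y\<close> to \<open>X\<close>, which is possible because they are non-zero.\<close>

lemma bimod_iso_reverse:
  assumes nz: "\<And>i. 1 \<le> i \<Longrightarrow> i \<le> d \<Longrightarrow> \<phi> i \<noteq> 0" and s: "s * s = 1"
    and \<alpha>': "\<And>i. i \<le> d \<Longrightarrow> \<alpha>' i = s * \<beta> (d - i)" and \<beta>': "\<And>i. i \<le> d \<Longrightarrow> \<beta>' i = s * \<alpha> (d - i)"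
    and \<phi>': "\<And>i. 1 \<le> i \<Longrightarrow> i \<le> d \<Longrightarrow> \<phi>' i = \<phi> (Suc d - i)"
    and N: "car N = supp_le d" "\<And>w. actX N w = vsc s (bidiagY d \<beta>' \<phi>' w)"
      "\<And>w. actY N w = vsc s (bidiagX d \<alpha>' w)" "\<And>w. actZ N w = bidiagZ d \<alpha>' \<beta>' \<phi>' \<kappa> w"
  shows "bimod_iso (bidiag_mod d \<alpha> \<beta> \<phi> \<kappa>) N"
proof -
  \<comment> \<open>Chosen so that \<open>\<rho> i = s * \<phi> (d - i) * \<rho> (i + 1)\<close>,
    which turns the subdiagonal of \<open>s * Y\<close> into ones.\<close>
  define \<rho> where "\<rho> i = (\<Prod>j<i. s / \<phi> (d - j))" for i
  have s0: "s \<noteq> 0" using s by auto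
  have ss: "s * (s * x) = x" for x by (simp add: s flip: mult.assoc)
  have \<rho>0: "\<rho> i \<noteq> 0" if "i \<le> d" for i
    using that nz s0 by (auto simp: \<rho>_def)
  have \<rho>: "\<rho> i = s * \<phi> (d - i) * \<rho> (Suc i)" if "i < d" for i
    using that nz[of "d - i"] s by (simp add: \<rho>_def)
  define f :: "(nat \<Rightarrow> complex) \<Rightarrow> nat \<Rightarrow> complex" where "f w i = (if i \<le> d then \<rho> i * w (d - i) else 0)" for w i
  have lin: "lin_on UNIV f" by (auto simp: lin_on_def f_def fun_eq_iff algebra_simps)
  note lf = lin_on_UNIV[OF lin]
  have X: "f (bidiagX d \<alpha> w) = vsc s (bidiagY d \<beta>' \<phi>' (f w))" for w
  proof
    fix i
    show "f (bidiagX d \<alpha> w) i = vsc s (bidiagY d \<beta>' \<phi>' (f w)) i"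
    proof (cases "i < d")
      case True
      have "vsc s (bidiagY d \<beta>' \<phi>' (f w)) i = (s * s) * \<alpha> (d - i) * \<rho> i * w (d - i)
          + (s * \<phi> (d - i) * \<rho> (Suc i)) * w (d - Suc i)"
        using True by (simp add: bidiagY_def f_def \<beta>' \<phi>' algebra_simps)
      also have "s * \<phi> (d - i) * \<rho> (Suc i) = \<rho> i"
        by (simp only: \<rho>[OF True])
      also have "s * s * \<alpha> (d - i) * \<rho> i * w (d - i) + \<rho> i * w (d - Suc i) = f (bidiagX d \<alpha> w) i"
        unfolding s using True by (simp add: bidiagX_def f_def distrib_left mult_ac)
      finally show ?thesis by (rule sym)
    qed (auto simp: bidiagX_def bidiagY_def f_def \<beta>' not_less ss mult.left_commute dest: le_antisym)
  qed
  have Y: "f (bidiagY d \<beta> \<phi> w) = vsc s (bidiagX d \<alpha>' (f w))" for w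
  proof
    fix i
    show "f (bidiagY d \<beta> \<phi> w) i = vsc s (bidiagX d \<alpha>' (f w)) i"
    proof (cases i)
      case (Suc j)
      show ?thesis
      proof (cases "i \<le> d")
        case True
        have "vsc s (bidiagX d \<alpha>' (f w)) i = (s * s) * \<beta> (d - i) * \<rho> i * w (d - i) + s * \<rho> j * w (d - j)"
          using True by (simp add: bidiagX_def f_def \<alpha>' Suc algebra_simps)
        also have "s * \<rho> j = (s * s) * \<phi> (d - j) * \<rho> i"
          using \<rho>[of j] True by (simp add: Suc)
        also have "s * s * \<beta> (d - i) * \<rho> i * w (d - i) + s * s * \<phi> (d - j) * \<rho> i * w (d - j) = f (bidiagY d \<beta> \<phi> w) i"
          unfolding s using True by (simp add: bidiagY_def f_def Suc Suc_diff_Suc distrib_left mult_ac)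
        finally show ?thesis by (rule sym)
      qed (simp add: f_def bidiagX_def)
    qed (simp add: bidiagX_def bidiagY_def f_def \<alpha>' ss mult.left_commute)
  qed
  have Z: "f (bidiagZ d \<alpha> \<beta> \<phi> \<kappa> w) = bidiagZ d \<alpha>' \<beta>' \<phi>' \<kappa> (f w)" for w
    unfolding bidiagZ_def lf X Y
    unfolding lin_on_UNIV[OF lin_on_bidiag(1)] lin_on_UNIV[OF lin_on_bidiag(2)]
    by (simp add: s fun_eq_iff add.commute flip: mult.assoc)
  have "bij_betw f (supp_le d) (supp_le d)"
    by (rule bij_betw_byWitness[where f' = "\<lambda>y i. if i \<le> d then y (d - i) / \<rho> (d - i) else 0"])
       (auto simp: f_def fun_eq_iff supp_le_def \<rho>0)
  then show ?thesis
    unfolding bimod_iso_def intertwines_def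
    by (intro exI[of _ f])
      (use lin X Y Z in \<open>auto simp: N car_bidiag_mod actX_bidiag_mod actY_bidiag_mod actZ_bidiagZ lin_on_def\<close>)
qed

text \<open>The map is the inverse of the first isomorphism followed by the second. Closure of
  \<open>P\<close> under the action ensures that this inverse can be evaluated on the transformed
  vectors.\<close>

lemma bimod_iso_common_source:
  assumes "bimod_iso P M" "bimod_iso P N" and sub: "subspace_of (car P) (car P)"
    and act: "\<And>v. v \<in> car P \<Longrightarrow> actX P v \<in> car P" "\<And>v. v \<in> car P \<Longrightarrow> actY P v \<in> car P"
      "\<And>v. v \<in> car P \<Longrightarrow> actZ P v \<in> car P"
  shows "bimod_iso M N"
proof -
  obtain f g where f: "lin_on (car P) f" "bij_betw f (car P) (car M)" "intertwines P M f"
    and g: "lin_on (car P) g" "bij_betw g (car P) (car N)" "intertwines P N g"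
    using assms(1,2) by (auto simp: bimod_iso_def)
  define r where "r = inv_into (car P) f"
  have r: "r (f x) = x" if "x \<in> car P" for x
    unfolding r_def using f(2) that by (auto simp: bij_betw_def inv_into_f_f)
  have M: "car M = f ` car P" using f(2) by (auto simp: bij_betw_def)
  have cl: "x + y \<in> car P" "vsc c x \<in> car P" if "x \<in> car P" "y \<in> car P" for x y c
    using sub that by (auto simp: subspace_of_def)
  have "lin_on (car M) (g \<circ> r)"
    unfolding lin_on_def
  proof (intro conjI ballI allI)
    fix u w assume "u \<in> car M" "w \<in> car M"
    then obtain x y where xy: "x \<in> car P" "y \<in> car P" "u = f x" "w = f y" by (auto simp: M)
    then have "u + w = f (x + y)" using f(1) by (simp add: lin_on_def)
    then show "(g \<circ> r) (u + w) = (g \<circ> r) u + (g \<circ> r) w"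
      using g(1) xy r cl by (simp add: lin_on_def)
  next
    fix c u assume "u \<in> car M"
    then obtain x where x: "x \<in> car P" "u = f x" by (auto simp: M)
    then have "vsc c u = f (vsc c x)" using f(1) by (simp add: lin_on_def)
    then show "(g \<circ> r) (vsc c u) = vsc c ((g \<circ> r) u)"
      using g(1) x r cl by (simp add: lin_on_def)
  qed
  moreover have "bij_betw (g \<circ> r) (car M) (car N)"
    unfolding r_def using bij_betw_trans[OF bij_betw_inv_into[OF f(2)] g(2)] .
  moreover have "intertwines M N (g \<circ> r)"
    unfolding intertwines_def
  proof
    fix v assume "v \<in> car M"
    then obtain x where x: "x \<in> car P" "v = f x" by (auto simp: M)
    then have "actX M v = f (actX P x)" "actY M v = f (actY P x)" "actZ M v = f (actZ P x)"
      using f(3) by (simp_all add: intertwines_def)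
    then show "(g \<circ> r) (actX M v) = actX N ((g \<circ> r) v) \<and> (g \<circ> r) (actY M v) = actY N ((g \<circ> r) v) \<and>
        (g \<circ> r) (actZ M v) = actZ N ((g \<circ> r) v)"
      using g(3) x r act by (simp add: intertwines_def)
  qed
  ultimately show ?thesis by (auto simp: bimod_iso_def)
qed

definition twist_YXZ :: "complex \<Rightarrow> complex \<Rightarrow> complex \<Rightarrow> 'i bimod \<Rightarrow> 'i bimod" where
  "twist_YXZ e1 e2 e3 M = (car M, \<lambda>v. vsc e1 (actY M v), \<lambda>v. vsc e2 (actX M v), \<lambda>v. vsc e3 (actZ M v))"

lemma twist_YXZ_simps:
  "car (twist_YXZ e1 e2 e3 M) = car M" "actX (twist_YXZ e1 e2 e3 M) v = vsc e1 (actY M v)"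
  "actY (twist_YXZ e1 e2 e3 M) v = vsc e2 (actX M v)" "actZ (twist_YXZ e1 e2 e3 M) v = vsc e3 (actZ M v)"
  by (simp_all add: twist_YXZ_def car_def actX_def actY_def actZ_def)

lemma bimod_iso_twist_YXZ:
  assumes "bimod_iso M N"
    and act: "\<And>v. v \<in> car M \<Longrightarrow> actX M v \<in> car M" "\<And>v. v \<in> car M \<Longrightarrow> actY M v \<in> car M"
      "\<And>v. v \<in> car M \<Longrightarrow> actZ M v \<in> car M"
  shows "bimod_iso (twist_YXZ e1 e2 e3 M) (twist_YXZ e1 e2 e3 N)"
proof -
  obtain f where f: "lin_on (car M) f" "bij_betw f (car M) (car N)" "intertwines M N f"
    using assms(1) by (auto simp: bimod_iso_def)
  have "f (vsc c v) = vsc c (f v)" if "v \<in> car M" for c v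
    using f(1) that by (simp add: lin_on_def)
  then have "intertwines (twist_YXZ e1 e2 e3 M) (twist_YXZ e1 e2 e3 N) f"
    using f(3) act unfolding intertwines_def twist_YXZ_simps by metis
  then show ?thesis
    using f(1,2) unfolding bimod_iso_def twist_YXZ_simps by blast
qed

lemma bidiag_mod_closed:
  assumes M_def: "M = bidiag_mod d \<alpha> \<beta> \<phi> \<kappa>"
  shows "subspace_of (car M) (car M)" "v \<in> car M \<Longrightarrow> actX M v \<in> car M" "v \<in> car M \<Longrightarrow> actY M v \<in> car M"
    "v \<in> car M \<Longrightarrow> actZ M v \<in> car M"
proof -
  show "subspace_of (car M) (car M)"
    by (auto simp: M_def car_bidiag_mod subspace_of_def supp_le_closed)
  show "v \<in> car M \<Longrightarrow> actX M v \<in> car M" "v \<in> car M \<Longrightarrow> actY M v \<in> car M"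
    by (simp_all add: M_def bidiag_mod_simps bidiag_supp_le)
  show "v \<in> car M \<Longrightarrow> actZ M v \<in> car M"
    unfolding M_def car_bidiag_mod actZ_bidiagZ by (rule bidiagZ_supp_le)
qed

text \<open>The transposition of \<open>X\<close> and \<open>Y\<close>, applied with signs to both
  isomorphisms out of \<open>P\<close>, turns the exchange of \<open>X\<close> and \<open>Z\<close>
  into the three-cycle on \<open>M\<close> and undoes the reversal on \<open>N\<close>. With
  \<open>s = 1\<close> the signs are those of the twists of the \<open>E\<close> modules, with
  \<open>s = - 1\<close> those of the \<open>O\<close> modules.\<close>

lemma bimod_iso_swap_reverse:
  assumes P: "P = bidiag_mod d \<alpha> \<beta> \<phi> \<kappa>" and sw: "bimod_iso P (swap_XZ M)"
    and s: "s * s = 1"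
    and rev: "bimod_iso P (twist_YXZ s s 1 N)"
  shows "bimod_iso (car M, \<lambda>v. vsc s (actY M v), \<lambda>v. vsc (- 1) (actZ M v), \<lambda>v. vsc (- s) (actX M v))
    (car N, actX N, \<lambda>v. vsc (- s) (actY N v), \<lambda>v. vsc (- s) (actZ N v))"
proof -
  note cl = bidiag_mod_closed[OF P]
  have 1: "twist_YXZ s (- 1) (- s) (swap_XZ M)
      = (car M, \<lambda>v. vsc s (actY M v), \<lambda>v. vsc (- 1) (actZ M v), \<lambda>v. vsc (- s) (actX M v))"
    by (simp add: twist_YXZ_def swap_XZ_def car_def actX_def actY_def actZ_def)
  have 2: "twist_YXZ s (- 1) (- s) (twist_YXZ s s 1 N)
      = (car N, actX N, \<lambda>v. vsc (- s) (actY N v), \<lambda>v. vsc (- s) (actZ N v))"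
    by (simp add: twist_YXZ_def[of s "- 1"] twist_YXZ_simps s)
  have "bimod_iso (twist_YXZ s (- 1) (- s) (swap_XZ M)) (twist_YXZ s (- 1) (- s) (twist_YXZ s s 1 N))"
  proof (rule bimod_iso_common_source)
    show "bimod_iso (twist_YXZ s (- 1) (- s) P) (twist_YXZ s (- 1) (- s) (swap_XZ M))"
      by (rule bimod_iso_twist_YXZ[OF sw cl(2-4)])
    show "bimod_iso (twist_YXZ s (- 1) (- s) P) (twist_YXZ s (- 1) (- s) (twist_YXZ s s 1 N))"
      by (rule bimod_iso_twist_YXZ[OF rev cl(2-4)])
    have "vsc c v \<in> car P" if "v \<in> car P" for c v using cl(1) that by (simp add: subspace_of_def)
    then show "actX (twist_YXZ s (- 1) (- s) P) v \<in> car (twist_YXZ s (- 1) (- s) P)"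
       "actY (twist_YXZ s (- 1) (- s) P) v \<in> car (twist_YXZ s (- 1) (- s) P)"
       "actZ (twist_YXZ s (- 1) (- s) P) v \<in> car (twist_YXZ s (- 1) (- s) P)"
      if "v \<in> car (twist_YXZ s (- 1) (- s) P)" for v
      using that cl(2-4) by (simp_all only: twist_YXZ_simps)
  qed (use cl(1) in \<open>simp add: twist_YXZ_simps\<close>)
  then show ?thesis by (simp only: 1 2)
qed

lemma Emod_twist_iso:
  assumes "odd d" and nz: "\<And>i. 1 \<le> i \<Longrightarrow> i \<le> d \<Longrightarrow> phiE d c b a i \<noteq> 0"
  shows "bimod_iso (twist_sgn_123 (- 1) 1 (- 1) (Emod d a b c)) (twist_sgn 1 (- 1) (- 1) (Emod d (- b) (- c) a))"
proof -
  have "bimod_iso (Emod d c b a) (twist_YXZ 1 1 1 (Emod d (- b) (- c) a))"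
    unfolding Emod_eq
  proof (rule bimod_iso_reverse[where s = 1, OF nz])
    show "theta d (- b) i = 1 * theta d b (d - i)" "theta d (- c) i = 1 * theta d c (d - i)" if "i \<le> d" for i
      using that assms(1) by (cases "even i"; simp add: theta_even theta_odd of_nat_diff)+
    show "phiE d (- b) (- c) a i = phiE d c b a (Suc d - i)" if i: "1 \<le> i" "i \<le> d" for i
    proof (cases "even i")
      case True
      then show ?thesis using i assms(1) by (simp add: phiE_def of_nat_diff algebra_simps)
    next
      case False
      \<comment> \<open>The two bases are negatives of each other.\<close>
      have "(2 * (- b) + 2 * (- c) - of_nat d + 2 * of_nat i - 1)\<^sup>2
          = (2 * c + 2 * b - of_nat d + 2 * of_nat (Suc d - i) - 1)\<^sup>2"
        unfolding power2_eq_iff using i by (simp add: of_nat_diff)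
      then show ?thesis using False i assms(1) by (simp only: phiE_def) simp
    qed
    have "kapE d (- b) (- c) a = kapE d c b a" by (simp add: kapE_def)
    then show "actZ (twist_YXZ 1 1 1 (bidiag_mod d (theta d (- b)) (theta d (- c)) (phiE d (- b) (- c) a) (kapE d (- b) (- c) a))) w
        = bidiagZ d (theta d (- b)) (theta d (- c)) (phiE d (- b) (- c) a) (kapE d c b a) w" for w
      by (simp add: twist_YXZ_simps actZ_bidiagZ)
  qed (simp_all add: twist_YXZ_simps bidiag_mod_simps)
  from bimod_iso_swap_reverse[OF Emod_eq Emod_swap_XZ[OF assms(1)] _ this]
  show ?thesis
    by (simp add: twist_sgn_123_def twist_123_def twist_sgn_def car_def actX_def actY_def actZ_def)
qed

lemma Omod_twist_iso:
  assumes "even d" and nz: "\<And>i. 1 \<le> i \<Longrightarrow> i \<le> d \<Longrightarrow> phiO d c b a i \<noteq> 0"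
  shows "bimod_iso (twist_sgn_123 1 (- 1) (- 1) (Omod d a b c)) (Omod d (- b) (- c) a)"
proof -
  have "bimod_iso (Omod d c b a) (twist_YXZ (- 1) (- 1) 1 (Omod d (- b) (- c) a))"
    unfolding Omod_eq
  proof (rule bimod_iso_reverse[where s = "- 1", OF nz])
    show "theta d (- b) i = - 1 * theta d b (d - i)" "theta d (- c) i = - 1 * theta d c (d - i)" if "i \<le> d" for i
      using that assms(1) by (cases "even i"; simp add: theta_even theta_odd of_nat_diff)+
    show "phiO d (- b) (- c) a i = phiO d c b a (Suc d - i)" if "1 \<le> i" "i \<le> d" for i
      using that assms(1) by (cases "even i"; simp add: phiO_def of_nat_diff algebra_simps)
    have "kapO d (- b) (- c) a = kapO d c b a" by (simp add: kapO_def)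
    then show "actZ (twist_YXZ (- 1) (- 1) 1 (bidiag_mod d (theta d (- b)) (theta d (- c)) (phiO d (- b) (- c) a) (kapO d (- b) (- c) a))) w
        = bidiagZ d (theta d (- b)) (theta d (- c)) (phiO d (- b) (- c) a) (kapO d c b a) w" for w
      by (simp add: twist_YXZ_simps actZ_bidiagZ)
  qed (simp_all add: twist_YXZ_simps bidiag_mod_simps)
  from bimod_iso_swap_reverse[OF Omod_eq Omod_swap_XZ[OF assms(1)] _ this]
  show ?thesis
    by (simp add: twist_sgn_123_def twist_123_def twist_sgn_def car_def actX_def actY_def actZ_def)
qed

subsection \<open>Irreducibility\<close>

definition unit_vec :: "nat \<Rightarrow> nat \<Rightarrow> complex" where "unit_vec m i = (if i = m then 1 else 0)"

lemma subspace_of_diff: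
  assumes "subspace_of U V" "u \<in> U" "w \<in> U" shows "u - w \<in> U"
proof -
  have "u - w = u + vsc (- 1) w" by (simp add: fun_eq_iff)
  then show ?thesis using assms unfolding subspace_of_def by metis
qed

text \<open>\<open>Y\<close> moves the first non-zero entry of a vector one place towards index 0,
  multiplying it by an entry of \<open>\<phi>\<close>. Repeating this reaches index 0 inside
  \<open>U\<close>.\<close>

lemma bidiag_submodule_leading:
  assumes sub: "subspace_of U (supp_le d)" and Y: "\<And>w. w \<in> U \<Longrightarrow> bidiagY d \<beta> \<phi> w \<in> U"
    and nz: "\<And>i. 1 \<le> i \<Longrightarrow> i \<le> d \<Longrightarrow> \<phi> i \<noteq> 0" and U: "w \<in> U" "w \<noteq> 0"
  shows "\<exists>w\<in>U. w 0 \<noteq> 0"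
proof -
  have step: "\<exists>w\<in>U. w 0 \<noteq> 0" if "w \<in> U" "m \<le> d" "\<forall>i<m. w i = 0" "w m \<noteq> 0" for w m
    using that
  proof (induction m arbitrary: w)
    case (Suc m)
    have "bidiagY d \<beta> \<phi> w m = \<phi> (Suc m) * w (Suc m)" "\<forall>i<m. bidiagY d \<beta> \<phi> w i = 0"
      using Suc.prems by (auto simp: bidiagY_def)
    then show ?case using Suc.IH[of "bidiagY d \<beta> \<phi> w"] Y[OF Suc.prems(1)] Suc.prems nz[of "Suc m"] by auto
  qed blast
  obtain m where m: "w m \<noteq> 0" using U(2) by (auto simp: fun_eq_iff)
  define l where "l = (LEAST m. w m \<noteq> 0)"
  have "w l \<noteq> 0" unfolding l_def by (rule LeastI[of "\<lambda>m. w m \<noteq> 0", OF m])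
  moreover have "\<forall>i<l. w i = 0" unfolding l_def using not_less_Least by blast
  moreover have "w \<in> supp_le d" using sub U(1) unfolding subspace_of_def by blast
  with \<open>w l \<noteq> 0\<close> have "l \<le> d"
    unfolding supp_le_def by (metis (mono_tags, lifting) mem_Collect_eq not_less)
  ultimately show ?thesis using step U(1) by blast
qed

text \<open>The factors \<open>X - \<alpha> 1\<close>, ..., \<open>X - \<alpha> d\<close> are
  applied in turn. Each multiplies entry 0 by some \<open>\<alpha> 0 - \<alpha> j \<noteq> 0\<close>
  and lengthens by one the initial segment on which \<open>(X - \<alpha> 0) w\<close>
  vanishes.\<close>

lemma bidiag_submodule_eigenvector:
  assumes sub: "subspace_of U (supp_le d)" and X: "\<And>w. w \<in> U \<Longrightarrow> bidiagX d \<alpha> w \<in> U"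
    and ne: "\<And>j. 1 \<le> j \<Longrightarrow> j \<le> d \<Longrightarrow> \<alpha> 0 \<noteq> \<alpha> j" and U: "w \<in> U" "w 0 \<noteq> 0"
  shows "\<exists>w\<in>U. w \<noteq> 0 \<and> bidiagX d \<alpha> w = vsc (\<alpha> 0) w"
proof -
  note lX = lin_on_UNIV[OF lin_on_bidiag(1)[of d \<alpha>]]
  have "k \<le> d \<Longrightarrow> \<exists>w\<in>U. w 0 \<noteq> 0 \<and> (\<forall>i\<le>k. (bidiagX d \<alpha> w - vsc (\<alpha> 0) w) i = 0)" for k
  proof (induction k)
    case 0
    then show ?case using U by (auto simp: bidiagX_def)
  next
    case (Suc k)
    then obtain w where w: "w \<in> U" "w 0 \<noteq> 0" and 0: "\<And>i. i \<le> k \<Longrightarrow> (bidiagX d \<alpha> w - vsc (\<alpha> 0) w) i = 0"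
      by (meson Suc_leD)
    define D where "D = bidiagX d \<alpha> w - vsc (\<alpha> 0) w"
    define v where "v = bidiagX d \<alpha> w - vsc (\<alpha> (Suc k)) w"
    have D0: "D i = 0" if "i \<le> k" for i unfolding D_def by (rule 0[OF that])
    have "v \<in> U"
      unfolding v_def by (rule subspace_of_diff[OF sub X[OF w(1)]]) (use sub w(1) in \<open>auto simp: subspace_of_def\<close>)
    moreover have "v 0 = (\<alpha> 0 - \<alpha> (Suc k)) * w 0"
      by (simp add: v_def bidiagX_def algebra_simps)
    then have "v 0 \<noteq> 0" using ne[of "Suc k"] Suc.prems w(2) by simp
    moreover have vD: "bidiagX d \<alpha> v - vsc (\<alpha> 0) v = bidiagX d \<alpha> D - vsc (\<alpha> (Suc k)) D"
      unfolding v_def D_def lX by (simp add: fun_eq_iff algebra_simps)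
    moreover have "(bidiagX d \<alpha> D - vsc (\<alpha> (Suc k)) D) i = 0" if "i \<le> Suc k" for i
    proof (cases "i = Suc k")
      case True
      then show ?thesis using D0[of k] Suc.prems by (simp add: bidiagX_def)
    next
      case False
      then show ?thesis using D0[of i] D0[of "i - 1"] that Suc.prems by (simp add: bidiagX_def)
    qed
    ultimately show ?case unfolding vD[symmetric] by blast
  qed
  from this[of d] obtain w where w: "w \<in> U" "w 0 \<noteq> 0" "\<And>i. i \<le> d \<Longrightarrow> (bidiagX d \<alpha> w - vsc (\<alpha> 0) w) i = 0"
    by auto
  have "bidiagX d \<alpha> w i = vsc (\<alpha> 0) w i" for i
  proof (cases "i \<le> d")
    case False
    then show ?thesis using w(1) sub by (auto simp: bidiagX_def subspace_of_def supp_le_def subset_iff)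
  qed (use w(3)[of i] in simp)
  then show ?thesis using w(1,2) by (intro bexI[of _ w]) (auto simp: fun_eq_iff)
qed

lemma bidiagX_last_eigenvector:
  assumes w: "w \<in> supp_le d" "bidiagX d \<alpha> w = vsc (\<alpha> d) w" and ne: "\<And>j. j < d \<Longrightarrow> \<alpha> d \<noteq> \<alpha> j"
  shows "w = vsc (w d) (unit_vec d)"
proof -
  have "i < d \<Longrightarrow> w i = 0" for i
  proof (induction i)
    case 0
    then show ?case using fun_cong[OF w(2), of 0] ne[of 0] by (auto simp: bidiagX_def)
  next
    case (Suc i)
    then show ?case using fun_cong[OF w(2), of "Suc i"] ne[of "Suc i"] by (auto simp: bidiagX_def)
  qed
  then show ?thesis using w(1) by (auto simp: fun_eq_iff unit_vec_def supp_le_def linorder_neq_iff)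
qed

lemma bidiag_submodule_eq:
  assumes sub: "subspace_of U (supp_le d)" and Y: "\<And>w. w \<in> U \<Longrightarrow> bidiagY d \<beta> \<phi> w \<in> U"
    and nz: "\<And>i. 1 \<le> i \<Longrightarrow> i \<le> d \<Longrightarrow> \<phi> i \<noteq> 0" and U: "unit_vec d \<in> U"
  shows "U = supp_le d"
proof -
  have scl: "vsc c u \<in> U" if "u \<in> U" for c u using sub that by (simp add: subspace_of_def)
  have unit_vec: "unit_vec m \<in> U" if "m \<le> d" for m
  proof (rule inc_induct[OF that, of "\<lambda>m. unit_vec m \<in> U"])
    fix m assume m: "m < d" and IH: "unit_vec (Suc m) \<in> U"
    have "unit_vec m = vsc (1 / \<phi> (Suc m)) (bidiagY d \<beta> \<phi> (unit_vec (Suc m)) - vsc (\<beta> (Suc m)) (unit_vec (Suc m)))"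
      using m nz[of "Suc m"] by (auto simp: fun_eq_iff bidiagY_def unit_vec_def)
    also have "\<dots> \<in> U" by (intro scl subspace_of_diff[OF sub] Y IH)
    finally show "unit_vec m \<in> U" .
  qed (rule U)
  have "comb d unit_vec w \<in> U" for w
  proof -
    have "(\<Sum>i\<in>I. vsc (w i) (unit_vec i)) \<in> U" if "finite I" "I \<subseteq> {..d}" for I
      using that
    proof induction
      case empty
      then show ?case using sub by (simp only: sum.empty subspace_of_def)
    next
      case (insert x I)
      have "vsc (w x) (unit_vec x) \<in> U" using insert.prems by (intro scl unit_vec) simp
      moreover have "(\<Sum>i\<in>I. vsc (w i) (unit_vec i)) \<in> U" by (rule insert.IH) (use insert.prems in blast)
      ultimately show ?case
        unfolding sum.insert[OF insert.hyps] using sub unfolding subspace_of_def by blast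
    qed
    then show ?thesis by (simp add: comb_def)
  qed
  moreover have "comb d unit_vec w = w" if "w \<in> supp_le d" for w
    using that by (auto simp: fun_eq_iff comb_apply unit_vec_def supp_le_def if_distrib sum.delta cong: if_cong)
  ultimately show ?thesis using sub by (metis subsetI subset_antisym subspace_of_def)
qed

text \<open>A nonzero submodule contains an eigenvector for the first diagonal entry of \<open>X\<close> in every
  split form of the module; two split forms with opposite orders therefore yield a generator.\<close>
lemma irreducible_bidiag_mod:
  fixes \<alpha> \<beta> \<phi> \<kappa> d defines "M \<equiv> bidiag_mod d \<alpha> \<beta> \<phi> \<kappa>"
  assumes nz: "\<And>i. 1 \<le> i \<Longrightarrow> i \<le> d \<Longrightarrow> \<phi> i \<noteq> 0" and nz': "\<And>i. 1 \<le> i \<Longrightarrow> i \<le> d \<Longrightarrow> \<phi>' i \<noteq> 0"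
    and ne: "\<And>j. j < d \<Longrightarrow> \<alpha> d \<noteq> \<alpha> j" and ne': "\<And>j. 1 \<le> j \<Longrightarrow> j \<le> d \<Longrightarrow> \<alpha>' 0 \<noteq> \<alpha>' j"
    and eq: "\<alpha>' 0 = s * \<alpha> d" and s: "s \<noteq> 0"
    and iso: "bimod_iso (bidiag_mod d \<alpha>' \<beta>' \<phi>' \<kappa>') (twist_sgn s 1 t M)"
  shows "irreducible_mod M"
  unfolding irreducible_mod_def
proof (intro conjI allI impI)
  have "unit_vec 0 \<in> car M" "unit_vec 0 \<noteq> 0" by (auto simp: M_def car_bidiag_mod supp_le_def unit_vec_def fun_eq_iff)
  then show "car M \<noteq> {0}" by auto
  fix U assume "subspace_of U (car M) \<and> actX M ` U \<subseteq> U \<and> actY M ` U \<subseteq> U \<and> actZ M ` U \<subseteq> U"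
  then have sub: "subspace_of U (supp_le d)" and X: "\<And>w. w \<in> U \<Longrightarrow> bidiagX d \<alpha> w \<in> U"
    and Y: "\<And>w. w \<in> U \<Longrightarrow> bidiagY d \<beta> \<phi> w \<in> U"
    by (auto simp: M_def bidiag_mod_simps)
  have clU: "0 \<in> U" "\<And>u w. u \<in> U \<Longrightarrow> w \<in> U \<Longrightarrow> u + w \<in> U" "\<And>c u. u \<in> U \<Longrightarrow> vsc c u \<in> U"
    using sub by (auto simp: subspace_of_def)
  obtain f where f: "lin_on (supp_le d) f" "bij_betw f (supp_le d) (supp_le d)"
    and fX: "\<And>w. w \<in> supp_le d \<Longrightarrow> f (bidiagX d \<alpha>' w) = vsc s (bidiagX d \<alpha> (f w))"
    and fY: "\<And>w. w \<in> supp_le d \<Longrightarrow> f (bidiagY d \<beta>' \<phi>' w) = bidiagY d \<beta> \<phi> (f w)"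
    using iso unfolding bimod_iso_def intertwines_def
    by (auto simp: M_def bidiag_mod_simps twist_sgn_def car_def[of "(_, _)"] actX_def[of "(_, _)"] actY_def[of "(_, _)"])
  have f0: "f 0 = 0"
    using f(1) supp_le_closed(1)[of d] unfolding lin_on_def by (metis vsc_0)
  \<comment> \<open>The submodule seen in the second split form, where \<open>s * \<alpha> d\<close>
    is the first eigenvalue. The eigenvector found there becomes an eigenvector of \<open>X\<close>
    for \<open>\<alpha> d\<close>, hence a multiple of the last unit vector.\<close>
  define U' where "U' = {w \<in> supp_le d. f w \<in> U}"
  have sub': "subspace_of U' (supp_le d)"
    using f(1) f0 clU unfolding subspace_of_def U'_def lin_on_def by (auto simp: supp_le_closed)
  have X': "bidiagX d \<alpha>' w \<in> U'" and Y': "bidiagY d \<beta>' \<phi>' w \<in> U'" if "w \<in> U'" for w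
    using that X Y clU by (auto simp: U'_def bidiag_supp_le fX fY)
  show "U = {0} \<or> U = car M"
  proof (cases "U = {0}")
    case False
    then obtain u where u: "u \<in> U" "u \<noteq> 0" using clU(1) by auto
    then have "u \<in> f ` supp_le d" using f(2) sub by (auto simp: bij_betw_def subspace_of_def)
    then obtain w where w: "w \<in> U'" "w \<noteq> 0" using u f0 by (auto simp: U'_def)
    obtain w1 where w1: "w1 \<in> U'" "w1 0 \<noteq> 0"
      using bidiag_submodule_leading[OF sub' Y' nz' w] by blast
    obtain w2 where w2: "w2 \<in> U'" "w2 \<noteq> 0" "bidiagX d \<alpha>' w2 = vsc (\<alpha>' 0) w2"
      using bidiag_submodule_eigenvector[OF sub' X' ne' w1] by blast
    define y where "y = f w2"
    have w2d: "w2 \<in> supp_le d" and y: "y \<in> U" using w2(1) by (auto simp: U'_def y_def)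
    have y0: "y \<noteq> 0"
      using w2(2) w2d f(2) f0 supp_le_closed(1)[of d] unfolding y_def bij_betw_def inj_on_def by metis
    have "vsc s (bidiagX d \<alpha> y) = vsc (s * \<alpha> d) y"
      using fX[OF w2d] f(1) w2d by (simp add: w2(3) y_def lin_on_def eq)
    then have "vsc (1 / s) (vsc s (bidiagX d \<alpha> y)) = vsc (1 / s) (vsc (s * \<alpha> d) y)" by (rule arg_cong)
    then have "bidiagX d \<alpha> y = vsc (\<alpha> d) y" using s by simp
    then have ye: "y = vsc (y d) (unit_vec d)"
      using bidiagX_last_eigenvector ne y sub by (metis subsetD subspace_of_def)
    then have "y d \<noteq> 0" using y0 by (metis vsc_0)
    then have "unit_vec d = vsc (1 / y d) y" by (subst ye) simp
    then have "unit_vec d \<in> U" using clU(3)[OF y] by metis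
    then show ?thesis
      using bidiag_submodule_eq[OF sub Y nz] by (simp add: M_def car_bidiag_mod)
  qed simp
qed

lemma irreducible_twist_sgn_123:
  assumes irr: "irreducible_mod M" and e: "e1 \<noteq> 0" "e2 \<noteq> 0" "e3 \<noteq> 0"
  shows "irreducible_mod (twist_sgn_123 e1 e2 e3 M)"
proof -
  define N where "N = twist_sgn_123 e1 e2 e3 M"
  have N: "car N = car M" "actX N v = vsc e2 (actY M v)" "actY N v = vsc e3 (actZ M v)" "actZ N v = vsc e1 (actX M v)" for v
    by (simp_all add: N_def twist_sgn_123_def twist_123_def twist_sgn_def car_def actX_def actY_def actZ_def)
  have "actX M ` U \<subseteq> U \<and> actY M ` U \<subseteq> U \<and> actZ M ` U \<subseteq> U"
    if sub: "subspace_of U (car M)" and U: "actX N ` U \<subseteq> U" "actY N ` U \<subseteq> U" "actZ N ` U \<subseteq> U" for U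
  proof -
    have *: "v \<in> U" if "vsc c v \<in> U" "c \<noteq> 0" for c v
    proof -
      have "vsc (1 / c) (vsc c v) \<in> U" using sub that(1) unfolding subspace_of_def by blast
      then show ?thesis using that(2) by simp
    qed
    show ?thesis
      using U * e unfolding N image_subset_iff by metis
  qed
  then show ?thesis
    using irr unfolding irreducible_mod_def N_def[symmetric] N by metis
qed

lemma irreducible_Emod:
  assumes d: "odd d" and nz: "\<And>i. 1 \<le> i \<Longrightarrow> i \<le> d \<Longrightarrow> phiE d a b c i \<noteq> 0 \<and> phiE d (- a) b c i \<noteq> 0"
    and ne: "\<And>j. j < d \<Longrightarrow> theta d a d \<noteq> theta d a j"
  shows "irreducible_mod (Emod d a b c)"
proof -
  have rev: "theta d (- a) j = theta d a (d - j)" if "j \<le> d" for j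
    using that d by (cases "even j"; simp add: theta_even theta_odd of_nat_diff)
  show ?thesis
    unfolding Emod_eq
  proof (rule irreducible_bidiag_mod[where s = 1, OF _ _ _ _ _ _ Emod_neg[OF d, unfolded Emod_eq]])
    show "theta d (- a) 0 \<noteq> theta d (- a) j" if "1 \<le> j" "j \<le> d" for j
      using ne[of "d - j"] that by (simp add: rev)
  qed (use nz ne rev in auto)
qed

lemma irreducible_Omod:
  assumes d: "even d" and nz: "\<And>i. 1 \<le> i \<Longrightarrow> i \<le> d \<Longrightarrow> phiO d a b c i \<noteq> 0 \<and> phiO d (- a) b (- c) i \<noteq> 0"
    and ne: "\<And>j. j < d \<Longrightarrow> theta d a d \<noteq> theta d a j"
  shows "irreducible_mod (Omod d a b c)"
proof -
  have rev: "theta d (- a) j = - theta d a (d - j)" if "j \<le> d" for j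
    using that d by (cases "even j"; simp add: theta_even theta_odd of_nat_diff field_simps)
  show ?thesis
    unfolding Omod_eq
  proof (rule irreducible_bidiag_mod[where s = "- 1", OF _ _ _ _ _ _ Omod_neg[OF d, unfolded Omod_eq]])
    show "theta d (- a) 0 \<noteq> theta d (- a) j" if "1 \<le> j" "j \<le> d" for j
      using ne[of "d - j"] that by (simp add: rev)
  qed (use nz ne rev in auto)
qed

text \<open>Equal values at indices of the same parity force \<open>j = d\<close>. At opposite
  parities they force \<open>4 * a + 2 * j = 0\<close>, that is \<open>a = 0\<close> and
  \<open>j = 0\<close>, and then \<open>d\<close> is odd.\<close>

lemma theta_last_neq:
  fixes a :: real
  assumes "a > 0 \<or> a \<ge> 0 \<and> even d" "j < d"
  shows "theta d (of_real a) d \<noteq> theta d (of_real a) j"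
proof
  assume "theta d (of_real a) d = theta d (of_real a) j"
  then have "Re (theta d (of_real a) d) = Re (theta d (of_real a) j)" by simp
  then have "(even d = even j \<and> real d = real j) \<or> (even d \<noteq> even j \<and> 4 * a + 2 * real j = 0)"
    by (cases "even d"; cases "even j") (simp_all add: theta_even theta_odd)
  then show False
    using assms by (cases j) auto
qed

section \<open>Non-vanishing of the split sequences for non-negative parameters\<close>

lemma phiE_neq_0:
  assumes "1 \<le> i" "i \<le> d"
    and "2 * a + 2 * b - real d + 2 * real i - 1 - 2 * c \<noteq> 0" "2 * a + 2 * b - real d + 2 * real i - 1 + 2 * c \<noteq> 0"
  shows "phiE d (of_real a) (of_real b) (of_real c) i \<noteq> 0"
proof (cases "even i")
  case True
  have "phiE d (of_real a) (of_real b) (of_real c) i = of_real (real i * (real d - real i + 1))"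
    using True by (simp add: phiE_def)
  then show ?thesis using assms(1,2) by (simp only: of_real_eq_0_iff) simp
next
  case False
  have "phiE d (of_real a) (of_real b) (of_real c) i = of_real (- ((2 * a + 2 * b - real d + 2 * real i - 1 - 2 * c)
     * (2 * a + 2 * b - real d + 2 * real i - 1 + 2 * c)) / 4)"
    using False by (simp add: phiE_def field_simps power2_eq_square)
  then show ?thesis using assms(3,4) by (simp only: of_real_eq_0_iff) simp
qed

lemma phiO_neq_0:
  assumes "1 \<le> i" "i \<le> d"
    and "even i \<Longrightarrow> real d + 1 - 2 * real i - 2 * a - 2 * b - 2 * c \<noteq> 0"
    and "odd i \<Longrightarrow> real d + 1 - 2 * real i - 2 * a - 2 * b + 2 * c \<noteq> 0"
  shows "phiO d (of_real a) (of_real b) (of_real c) i \<noteq> 0"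
proof -
  have "phiO d (of_real a) (of_real b) (of_real c) i = of_real (if even i
      then real i * (real d + 1 - 2 * real i - 2 * a - 2 * b - 2 * c) / 2
      else (real i - real d - 1) * (real d + 1 - 2 * real i - 2 * a - 2 * b + 2 * c) / 2)"
    by (simp add: phiO_def)
  then show ?thesis using assms by (simp only: of_real_eq_0_iff) auto
qed

lemma W1_simple:
  fixes k2 k3 K :: real and n t :: nat
  assumes n: "even n" and t: "odd t" "t \<le> n" and K: "K = - real t / 2 + k2 + k3" and pos: "k2 \<ge> 0" "k3 \<ge> 0"
  defines "W \<equiv> twist_sgn_123 (- 1) 1 (- 1)
     (Emod (n - t) (of_real (k2 + (real n + 1) / 2)) (of_real (- K - (real n + 1) / 2)) (of_real (- k3 - (real n + 1) / 2)))"
  shows "irreducible_mod W"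
    and "bimod_iso W (twist_sgn 1 (- 1) (- 1)
      (Emod (n - t) (of_real (K + (real n + 1) / 2)) (of_real (k3 + (real n + 1) / 2)) (of_real (k2 + (real n + 1) / 2))))"
proof -
  define a b c where "a = k2 + (real n + 1) / 2" and "b = - K - (real n + 1) / 2" and "c = - k3 - (real n + 1) / 2"
  note abc = a_def b_def c_def
  have d: "odd (n - t)" using n t by simp
  have rd: "real (n - t) = real n - real t" using t by (simp add: of_nat_diff)
  have "irreducible_mod (Emod (n - t) (of_real a) (of_real b) (of_real c))"
  proof (rule irreducible_Emod[OF d])
    show "theta (n - t) (of_real a) (n - t) \<noteq> theta (n - t) (of_real a) j" if "j < n - t" for j
      by (rule theta_last_neq[OF _ that]) (use pos in \<open>simp add: abc add_nonneg_pos\<close>)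
    fix i assume i: "1 \<le> i" "i \<le> n - t"
    then have ir: "1 \<le> real i" "real i + real t \<le> real n" "0 \<le> real t" using t by linarith+
    \<comment> \<open>The two linear factors are \<open>2 * (t + i) > 0\<close> and
      \<open>- 2 * (n + 1 - t - i) - 4 * k3 < 0\<close>. With \<open>- a\<close> instead of
      \<open>a\<close>, and for the parameters in the order \<open>c\<close>, \<open>b\<close>,
      \<open>a\<close>, both factors are negative.\<close>
    have "phiE (n - t) (of_real a) (of_real b) (of_real c) i \<noteq> 0"
      by (rule phiE_neq_0[OF i]) (use ir pos in \<open>auto simp: abc K rd field_simps\<close>)
    moreover have "phiE (n - t) (of_real (- a)) (of_real b) (of_real c) i \<noteq> 0"
      by (rule phiE_neq_0[OF i]) (use ir pos in \<open>auto simp: abc K rd field_simps\<close>)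
    ultimately show "phiE (n - t) (of_real a) (of_real b) (of_real c) i \<noteq> 0 \<and>
        phiE (n - t) (- of_real a) (of_real b) (of_real c) i \<noteq> 0" by simp
  qed
  then show "irreducible_mod W"
    unfolding W_def abc by (rule irreducible_twist_sgn_123) simp_all
  have "bimod_iso (twist_sgn_123 (- 1) 1 (- 1) (Emod (n - t) (of_real a) (of_real b) (of_real c)))
     (twist_sgn 1 (- 1) (- 1) (Emod (n - t) (- of_real b) (- of_real c) (of_real a)))"
  proof (rule Emod_twist_iso[OF d])
    fix i assume i: "1 \<le> i" "i \<le> n - t"
    then have ir: "1 \<le> real i" "real i + real t \<le> real n" "0 \<le> real t" using t by linarith+
    show "phiE (n - t) (of_real c) (of_real b) (of_real a) i \<noteq> 0"
      by (rule phiE_neq_0[OF i]) (use ir pos in \<open>auto simp: abc K rd field_simps\<close>)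
  qed
  moreover have "- complex_of_real b = of_real (K + (real n + 1) / 2)" "- complex_of_real c = of_real (k3 + (real n + 1) / 2)"
    unfolding abc of_real_minus[symmetric] by simp_all
  ultimately show "bimod_iso W (twist_sgn 1 (- 1) (- 1)
      (Emod (n - t) (of_real (K + (real n + 1) / 2)) (of_real (k3 + (real n + 1) / 2)) (of_real (k2 + (real n + 1) / 2))))"
    unfolding W_def by (simp only: abc)
qed

lemma W2_simple:
  fixes k2 k3 K :: real and n t :: nat
  assumes t: "odd t" "t \<le> n" and K: "K = - real t / 2 + k2 + k3" and pos: "k2 \<ge> 0" "k3 \<ge> 0"
  defines "W \<equiv> twist_sgn_123 1 (- 1) (- 1) (Omod (t - 1) (of_real k2) (of_real (- K - real n - 1)) (of_real (- k3)))"
  shows "irreducible_mod W"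
    and "bimod_iso W (Omod (t - 1) (of_real (K + real n + 1)) (of_real k3) (of_real k2))"
proof -
  define b c where "b = - K - real n - 1" and "c = - k3"
  note abc = b_def c_def
  have d: "even (t - 1)" using t by simp
  have rd: "real (t - 1) = real t - 1" using t by (cases t) auto
  have "irreducible_mod (Omod (t - 1) (of_real k2) (of_real b) (of_real c))"
  proof (rule irreducible_Omod[OF d])
    show "theta (t - 1) (of_real k2) (t - 1) \<noteq> theta (t - 1) (of_real k2) j" if "j < t - 1" for j
      by (rule theta_last_neq[OF _ that]) (use pos d in simp)
    fix i assume i: "1 \<le> i" "i \<le> t - 1"
    then have ir: "1 \<le> real i" "real i + 1 \<le> real t" "real t \<le> real n" using t by linarith+
    \<comment> \<open>Here and for the two other triples of parameters below, the linear factors are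
      \<open>2 * (n + 1 - i)\<close> plus non-negative multiples of \<open>k2\<close> and
      \<open>k3\<close>.\<close>
    have "phiO (t - 1) (of_real k2) (of_real b) (of_real c) i \<noteq> 0"
      by (rule phiO_neq_0[OF i]) (use ir pos in \<open>auto simp: abc K rd field_simps\<close>)
    moreover have "phiO (t - 1) (of_real (- k2)) (of_real b) (of_real (- c)) i \<noteq> 0"
      by (rule phiO_neq_0[OF i]) (use ir pos in \<open>auto simp: abc K rd field_simps\<close>)
    ultimately show "phiO (t - 1) (of_real k2) (of_real b) (of_real c) i \<noteq> 0 \<and>
        phiO (t - 1) (- of_real k2) (of_real b) (- of_real c) i \<noteq> 0" by simp
  qed
  then show "irreducible_mod W"
    unfolding W_def abc by (rule irreducible_twist_sgn_123) simp_all
  have "bimod_iso (twist_sgn_123 1 (- 1) (- 1) (Omod (t - 1) (of_real k2) (of_real b) (of_real c)))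
     (Omod (t - 1) (- of_real b) (- of_real c) (of_real k2))"
  proof (rule Omod_twist_iso[OF d])
    fix i assume i: "1 \<le> i" "i \<le> t - 1"
    then have ir: "1 \<le> real i" "real i + 1 \<le> real t" "real t \<le> real n" using t by linarith+
    show "phiO (t - 1) (of_real c) (of_real b) (of_real k2) i \<noteq> 0"
      by (rule phiO_neq_0[OF i]) (use ir pos in \<open>auto simp: abc K rd field_simps\<close>)
  qed
  moreover have "- complex_of_real b = of_real (K + real n + 1)" "- complex_of_real c = of_real k3"
    unfolding abc of_real_minus[symmetric] by simp_all
  ultimately show "bimod_iso W (Omod (t - 1) (of_real (K + real n + 1)) (of_real k3) (of_real k2))"
    unfolding W_def by (simp only: abc)
qed

subsection \<open>Homogeneous solutions of the Dirac equation\<close>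

text \<open>The factor in \<open>T x^j = dunkl_num k j * x^(j-1)\<close> for the Dunkl operator
  \<open>T\<close> with parameter \<open>k\<close>. For \<open>j \<ge> 1\<close> it vanishes only if
  \<open>j\<close> is odd and \<open>2 * k = - j\<close>.\<close>

definition dunkl_num :: "real \<Rightarrow> nat \<Rightarrow> complex" where
  "dunkl_num x j = of_nat j + (if odd j then 2 * of_real x else 0)"

text \<open>Row \<open>s\<close> of the Pauli matrix \<open>\<sigma>\<^sub>2\<close> has the entry \<open>sg s\<close> off the diagonal, row \<open>s\<close> of \<open>\<sigma>\<^sub>3\<close> the entry
  \<open>tau s\<close> on the diagonal.\<close>
definition sg :: "bool \<Rightarrow> complex" where "sg s = (if s then \<i> else - \<i>)"
definition tau :: "bool \<Rightarrow> complex" where "tau s = (if s then - 1 else 1)"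

lemma dunkl_num_0 [simp]: "dunkl_num x 0 = 0" by (simp add: dunkl_num_def)

lemma dunkl_apply:
  "dunkl k (Suc 0) p (s, (a, b, c)) = dunkl_num (k 1) (Suc a) * p (s, (Suc a, b, c))"
  "dunkl k 2 p (s, (a, b, c)) = dunkl_num (k 2) (Suc b) * p (s, (a, Suc b, c))"
  "dunkl k 3 p (s, (a, b, c)) = dunkl_num (k 3) (Suc c) * p (s, (a, b, Suc c))"
  by (auto simp: dunkl_def pdx_def divx_def refl_def expo_def incr_def dunkl_num_def algebra_simps)

lemma pauli_apply:
  "pauli (Suc 0) p (s, m) = p (\<not> s, m)"
  "pauli 2 p (s, m) = sg s * p (\<not> s, m)"
  "pauli 3 p (s, m) = tau s * p (s, m)"
  by (cases s; simp add: pauli_def sg_def tau_def)+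

lemma dirac_apply:
  "dirac k p (s, (a, b, c)) = dunkl_num (k 1) (Suc a) * p (\<not> s, (Suc a, b, c))
    + sg s * (dunkl_num (k 2) (Suc b) * p (\<not> s, (a, Suc b, c))) + tau s * (dunkl_num (k 3) (Suc c) * p (s, (a, b, Suc c)))"
  by (simp add: dirac_def dunkl_apply pauli_apply)

text \<open>The equation is multiplied by \<open>e\<^sub>2\<close>, whose square is 1, and solved
  for the \<open>T\<^sub>2\<close> term. This is the form of an evolution equation in
  \<open>x\<^sub>2\<close>.\<close>

lemma dirac_eq_0_iff:
  "dirac k p (\<not> s, (a, b, c)) = 0 \<longleftrightarrow> dunkl_num (k 2) (Suc b) * p (s, (a, Suc b, c))
     = sg s * (tau s * dunkl_num (k 3) (Suc c) * p (\<not> s, (a, b, Suc c)) - dunkl_num (k 1) (Suc a) * p (s, (Suc a, b, c)))"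
  (is "?l \<longleftrightarrow> ?x = ?r")
proof -
  have "dirac k p (\<not> s, (a, b, c)) = - sg s * (?x - ?r)"
    by (cases s) (simp_all add: dirac_apply sg_def tau_def algebra_simps)
  moreover have "sg s \<noteq> 0" by (simp add: sg_def)
  ultimately show ?thesis by simp
qed

lemma Mn_iff: "p \<in> Mn k n \<longleftrightarrow> p \<in> homog n \<and> (\<forall>s a b c. dunkl_num (k 2) (Suc b) * p (s, (a, Suc b, c))
     = sg s * (tau s * dunkl_num (k 3) (Suc c) * p (\<not> s, (a, b, Suc c)) - dunkl_num (k 1) (Suc a) * p (s, (Suc a, b, c))))"
proof -
  have "dirac k p = 0 \<longleftrightarrow> (\<forall>s a b c. dirac k p (\<not> s, (a, b, c)) = 0)"
  proof
    assume *: "\<forall>s a b c. dirac k p (\<not> s, (a, b, c)) = 0"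
    show "dirac k p = 0"
    proof
      fix x show "dirac k p x = 0 x" using *[rule_format, of "\<not> fst x"] by (cases x) simp
    qed
  qed simp
  then show ?thesis by (simp add: Mn_def dirac_eq_0_iff)
qed

lemma homogD: "p \<in> homog n \<Longrightarrow> a + b + c \<noteq> n \<Longrightarrow> p (s, (a, b, c)) = 0"
  by (auto simp: homog_def)

text \<open>The recursion in the exponent \<open>b\<close> of \<open>x\<^sub>2\<close> refers to the
  exponents \<open>a\<close> and \<open>a + 1\<close> of \<open>x\<^sub>1\<close>. At
  \<open>a + 1 = t\<close> the factor \<open>dunkl_num (k 1) t\<close>, or the degree, removes the
  second reference, so the range \<open>a < t\<close> is closed. The value \<open>t = t1\<close>
  describes the submodule, \<open>t = n + 1\<close> gives uniqueness.\<close>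

lemma Mn_eq_0_of_restriction:
  assumes p: "p \<in> Mn k n" and nz: "\<And>j. 1 \<le> j \<Longrightarrow> j \<le> n \<Longrightarrow> dunkl_num (k 2) j \<noteq> 0"
    and t: "dunkl_num (k 1) t = 0 \<or> n < t" and 0: "\<And>s a. a < t \<Longrightarrow> a \<le> n \<Longrightarrow> p (s, (a, 0, n - a)) = 0"
    and a: "a < t"
  shows "p (s, (a, b, c)) = 0"
  using a
proof (induction b arbitrary: s a c)
  case 0
  have hom: "p \<in> homog n" using p by (simp add: Mn_iff)
  show ?case
  proof (cases "a + c = n")
    case True
    then have "c = n - a" "a \<le> n" by auto
    then show ?thesis using assms(4)[OF 0] by simp
  qed (simp add: homogD[OF hom])
next
  case (Suc b)
  have hom: "p \<in> homog n" using p by (simp add: Mn_iff)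
  have "dunkl_num (k 1) (Suc a) * p (s, (Suc a, b, c)) = 0"
  proof (cases "Suc a = t")
    case True
    then show ?thesis using t by (auto simp: homogD[OF hom])
  next
    case False
    then show ?thesis using Suc by simp
  qed
  then have "dunkl_num (k 2) (Suc b) * p (s, (a, Suc b, c)) = 0"
    using p Suc unfolding Mn_iff by simp
  then show ?case
    using nz[of "Suc b"] homogD[OF hom, of a "Suc b" c s] by (cases "Suc b \<le> n") auto
qed

text \<open>The recursion of \<open>Mn_iff\<close>, started from the data \<open>g\<close> on
  \<open>x\<^sub>2 = 0\<close>. A zero denominator could occur only for exponents of
  \<open>x\<^sub>2\<close> above \<open>n\<close>, where all values vanish by homogeneity.\<close>

primrec CK_ext :: "(nat \<Rightarrow> real) \<Rightarrow> nat \<Rightarrow> (bool \<Rightarrow> nat \<Rightarrow> complex) \<Rightarrow> nat \<Rightarrow> bool \<Rightarrow> nat \<Rightarrow> nat \<Rightarrow> complex" where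
  "CK_ext k n g 0 s a c = (if a + c = n then g s a else 0)"
| "CK_ext k n g (Suc b) s a c = sg s / dunkl_num (k 2) (Suc b) *
     (tau s * dunkl_num (k 3) (Suc c) * CK_ext k n g b (\<not> s) a (Suc c) - dunkl_num (k 1) (Suc a) * CK_ext k n g b s (Suc a) c)"

lemma CK_ext_homog: "a + b + c \<noteq> n \<Longrightarrow> CK_ext k n g b s a c = 0"
  by (induction b arbitrary: s a c) auto

lemma Mn_extension:
  assumes nz: "\<And>j. 1 \<le> j \<Longrightarrow> j \<le> n \<Longrightarrow> dunkl_num (k 2) j \<noteq> 0"
  obtains p where "p \<in> Mn k n" "\<And>s a. a \<le> n \<Longrightarrow> p (s, (a, 0, n - a)) = g s a"
proof -
  define p :: cpol where "p = (\<lambda>(s, (a, b, c)). CK_ext k n g b s a c)"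
  have "p \<in> Mn k n"
    unfolding Mn_iff
  proof (intro conjI allI)
    show "p \<in> homog n" by (auto simp: homog_def p_def) (metis CK_ext_homog)
    fix s a b c
    show "dunkl_num (k 2) (Suc b) * p (s, (a, Suc b, c))
     = sg s * (tau s * dunkl_num (k 3) (Suc c) * p (\<not> s, (a, b, Suc c)) - dunkl_num (k 1) (Suc a) * p (s, (Suc a, b, c)))"
    proof (cases "a + Suc b + c = n")
      case True
      then show ?thesis using nz[of "Suc b"] by (simp add: p_def)
    next
      case False
      then show ?thesis by (simp add: p_def CK_ext_homog del: CK_ext.simps)
    qed
  qed
  moreover have "p (s, (a, 0, n - a)) = g s a" if "a \<le> n" for s a
    using that by (simp add: p_def)
  ultimately show ?thesis using that by blast
qed

section \<open>The operators in the coordinates on \<open>x\<^sub>2 = 0\<close>\<close>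

lemma opX_apply: "opX k p (s, (a, 0, c)) = \<i> * (if c = 0 then 0 else (-1) ^ c * (dunkl_num (k 2) 1 * p (\<not> s, (a, 1, c - 1))))
    + ((1 / 2 + of_real (k 2)) * (-1) ^ c + of_real (k 3)) * p (s, (a, 0, c))"
  by (cases c) (simp_all add: opX_def bi_op_def Let_def pauli_apply mulx_def dunkl_apply refl_def expo_def decr_def power_add field_simps)

lemma opZ_apply: "opZ k p (s, (a, 0, c)) = - \<i> * tau s * (if a = 0 then 0 else (-1) ^ a * (dunkl_num (k 2) 1 * p (s, (a - 1, 1, c))))
    + ((1 / 2 + of_real (k 2)) * (-1) ^ a + of_real (k 1)) * p (s, (a, 0, c))"
  by (cases a) (simp_all add: opZ_def bi_op_def Let_def pauli_apply mulx_def dunkl_apply refl_def expo_def decr_def power_add field_simps)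

lemma opY_apply: "opY k p (s, (a, 0, c)) = \<i> * sg s * (-1) ^ (a + c) *
      ((if a = 0 then 0 else dunkl_num (k 3) (Suc c) * p (\<not> s, (a - 1, 0, Suc c)))
      - (if c = 0 then 0 else dunkl_num (k 1) (Suc a) * p (\<not> s, (Suc a, 0, c - 1))))
    + (1 / 2 * (-1) ^ (a + c) + of_real (k 1) * (-1) ^ c + of_real (k 3) * (-1) ^ a) * p (s, (a, 0, c))"
  by (cases a; cases c) (simp_all add: opY_def bi_op_def Let_def pauli_apply mulx_def dunkl_apply refl_def expo_def decr_def power_add field_simps)

text \<open>Coordinates on the kernel of the Dirac operator: restrict to \<open>x\<^sub>2 = 0\<close> and project onto the two
  eigenlines of \<open>e\<^sub>2\<close>. The operator \<open>e\<^sub>1 R\<^sub>1\<close> commutes with the action and exchanges the two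
  components; this is the reason for the sign \<open>(-1) ^ a\<close>.\<close>
definition restr :: "nat \<Rightarrow> cpol \<Rightarrow> bool \<Rightarrow> nat \<Rightarrow> complex" where
  "restr n p s a = (if s then (-1) ^ a * (p (False, (a, 0, n - a)) + \<i> * p (True, (a, 0, n - a)))
     else p (False, (a, 0, n - a)) - \<i> * p (True, (a, 0, n - a)))"

lemma restr_beyond: "p \<in> homog n \<Longrightarrow> n < a \<Longrightarrow> restr n p s a = 0"
  by (simp add: restr_def homogD)

lemma minus_one_power_diff: "even n \<Longrightarrow> a \<le> n \<Longrightarrow> (-1) ^ (n - a) = ((-1) ^ a :: complex)"
  by (cases "even a") auto

text \<open>On \<open>x\<^sub>2 = 0\<close> the term of \<open>X\<close> containing the factor
  \<open>x\<^sub>2\<close> drops out, and the remaining derivative \<open>T\<^sub>2\<close> brings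
  in coefficients with exponent 1 of \<open>x\<^sub>2\<close>. The Dirac equation, in
  \<open>rec\<close>, expresses these through the restriction again.\<close>

lemma restr_opX:
  assumes p: "p \<in> Mn k n" and n: "even n" and a: "a \<le> n"
  shows "restr n (opX k p) s a = ((-1) ^ a * (dunkl_num (k 3) (n - a) + 1 / 2 + of_real (k 2)) + of_real (k 3)) * restr n p s a
     + \<i> * (-1) ^ a * dunkl_num (k 1) (Suc a) * restr n p s (Suc a)"
proof (cases "a = n")
  case True
  have "p \<in> homog n" using p by (simp add: Mn_iff)
  then show ?thesis using True n by (simp add: restr_beyond) (simp add: restr_def opX_apply field_simps)
next
  case False
  define c where "c = n - Suc a"
  have c: "n - a = Suc c" "n - Suc a = c" using a False by (auto simp: c_def)
  have sc: "(-1) ^ Suc c = ((-1) ^ a :: complex)" using minus_one_power_diff[OF n a] by (simp only: c)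
  have rec: "dunkl_num (k 2) 1 * p (s, (a, 1, c)) = sg s * (tau s * dunkl_num (k 3) (Suc c) * p (\<not> s, (a, 0, Suc c))
      - dunkl_num (k 1) (Suc a) * p (s, (Suc a, 0, c)))" for s
    using p unfolding Mn_iff by simp
  have X: "opX k p (s, (a, 0, Suc c)) = \<i> * ((-1) ^ a * (dunkl_num (k 2) 1 * p (\<not> s, (a, 1, c))))
      + ((1 / 2 + of_real (k 2)) * (-1) ^ a + of_real (k 3)) * p (s, (a, 0, Suc c))" for s
    unfolding opX_apply sc by simp
  show ?thesis
    unfolding restr_def c X rec by (simp add: sg_def tau_def field_simps)
qed

lemma restr_opZ:
  assumes p: "p \<in> Mn k n" and n: "even n" and a: "a \<le> n"
  shows "restr n (opZ k p) s a = ((-1) ^ a * (dunkl_num (k 1) a + 1 / 2 + of_real (k 2)) + of_real (k 1)) * restr n p s a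
     - (if a = 0 then 0 else \<i> * (-1) ^ a * dunkl_num (k 3) (Suc (n - a)) * restr n p s (a - 1))"
proof (cases a)
  case 0
  then show ?thesis by (simp add: restr_def opZ_apply field_simps)
next
  case (Suc e)
  define c where "c = n - a"
  have c: "n - e = Suc c" "n - Suc e = c" using a Suc by (auto simp: c_def)
  have rec: "dunkl_num (k 2) 1 * p (s, (e, 1, c)) = sg s * (tau s * dunkl_num (k 3) (Suc c) * p (\<not> s, (e, 0, Suc c))
      - dunkl_num (k 1) (Suc e) * p (s, (Suc e, 0, c)))" for s
    using p unfolding Mn_iff by simp
  have Z: "opZ k p (s, (Suc e, 0, c)) = - \<i> * tau s * ((-1) ^ Suc e * (dunkl_num (k 2) 1 * p (s, (e, 1, c))))
      + ((1 / 2 + of_real (k 2)) * (-1) ^ Suc e + of_real (k 1)) * p (s, (Suc e, 0, c))" for s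
    unfolding opZ_apply by simp
  show ?thesis
    unfolding restr_def Suc c diff_Suc_1 Z rec by (simp add: sg_def tau_def field_simps)
qed

lemma restr_opY:
  assumes p: "p \<in> Mn k n" and n: "even n" and a: "a \<le> n"
  shows "restr n (opY k p) s a = (1 / 2 + (of_real (k 1) + of_real (k 3)) * (-1) ^ a) * restr n p s a
     + (if a = 0 then 0 else \<i> * dunkl_num (k 3) (Suc (n - a)) * restr n p s (a - 1))
     - \<i> * dunkl_num (k 1) (Suc a) * restr n p s (Suc a)"
proof -
  have hom: "p \<in> homog n" using p by (simp add: Mn_iff)
  have Y: "opY k p (s, (a, 0, n - a)) = \<i> * sg s *
      ((if a = 0 then 0 else dunkl_num (k 3) (Suc (n - a)) * p (\<not> s, (a - 1, 0, Suc (n - a))))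
      - dunkl_num (k 1) (Suc a) * p (\<not> s, (Suc a, 0, n - Suc a)))
    + (1 / 2 + of_real (k 1) * (-1) ^ a + of_real (k 3) * (-1) ^ a) * p (s, (a, 0, n - a))" for s
  proof -
    have "(if n - a = 0 then 0 else dunkl_num (k 1) (Suc a) * p (\<not> s, (Suc a, 0, n - a - 1)))
        = dunkl_num (k 1) (Suc a) * p (\<not> s, (Suc a, 0, n - Suc a))"
      using a by (auto simp: homogD[OF hom])
    then show ?thesis unfolding opY_apply using a n by (simp add: minus_one_power_diff)
  qed
  show ?thesis
  proof (cases a)
    case 0
    then show ?thesis unfolding restr_def Y by (simp add: sg_def field_simps)
  next
    case (Suc e)
    then have c: "n - e = Suc (n - a)" using a by simp
    show ?thesis unfolding restr_def Y unfolding Suc by (simp add: c[unfolded Suc] sg_def field_simps)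
  qed
qed

text \<open>The rescaling that gives \<open>(-1) ^ t * Z\<close> the subdiagonal entries 1: each
  factor inverts the coefficient of the lower neighbour in \<open>restr_opZ\<close>, with
  \<open>m = n - t\<close>.\<close>

definition split_scale :: "real \<Rightarrow> nat \<Rightarrow> nat \<Rightarrow> complex" where
  "split_scale k3 m i = (\<Prod>j<i. 1 / (- \<i> * (-1) ^ Suc j * dunkl_num k3 (m - j)))"

definition split_coord :: "(nat \<Rightarrow> real) \<Rightarrow> nat \<Rightarrow> nat \<Rightarrow> nat \<Rightarrow> cpol \<Rightarrow> bool \<times> nat \<Rightarrow> complex" where
  "split_coord k n t d p = (\<lambda>(s, i). if i \<le> d then split_scale (k 3) (n - t) i * restr n p s (t + i) else 0)"

lemma restr_add: "restr n (p + q) s a = restr n p s a + restr n q s a"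
  and restr_vsc: "restr n (vsc c p) s a = c * restr n p s a"
  by (simp_all add: restr_def algebra_simps)

lemma lin_on_split_coord: "lin_on V (split_coord k n t d)"
  by (auto simp: lin_on_def split_coord_def fun_eq_iff restr_add restr_vsc algebra_simps)

lemma bidiagZ_theta:
  assumes "i \<le> d" "\<phi> 0 = 0" "\<phi> (Suc d) = 0" "w (Suc d) = 0"
  shows "bidiagZ d (theta d a) (theta d b) \<phi> \<kappa> w i
    = (2 * theta d a i * theta d b i + \<phi> i + \<phi> (Suc i) - \<kappa>) * w i + (-1) ^ i * (if i = 0 then 0 else w (i - 1))
      - (-1) ^ i * \<phi> (Suc i) * w (Suc i)"
proof -
  have "bidiagZ d (theta d a) (theta d b) \<phi> \<kappa> w i
    = (2 * theta d a i * theta d b i + \<phi> i + \<phi> (Suc i) - \<kappa>) * w i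
      + (theta d b (i - 1) + theta d b i) * (if i = 0 then 0 else w (i - 1))
      + \<phi> (Suc i) * (theta d a i + theta d a (Suc i)) * w (Suc i)"
    using assms by (cases "i = d"; cases "i = 0")
      (auto simp: bidiagZ_def bidiagX_def bidiagY_def algebra_simps)
  moreover have "theta d b (i - 1) + theta d b i = (-1) ^ i" if "i \<noteq> 0"
    using theta_add_Suc[of d b "i - 1"] that by (cases i) auto
  ultimately show ?thesis
    unfolding theta_add_Suc by (cases "i = 0") auto
qed

text \<open>The identities that match the exponents \<open>t, ..., t + d\<close> of
  \<open>x\<^sub>1\<close> with a split form: \<open>\<phi>\<close> is the product of the lowering
  factor of \<open>X\<close> and the raising factor of \<open>Z\<close>, and the last three clauses
  compare the diagonals of \<open>Z\<close>, \<open>X\<close> and \<open>Y\<close>. It is used with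
  \<open>t = t1\<close>, \<open>d = n - t1\<close> and with \<open>t = 0\<close>,
  \<open>d = t1 - 1\<close>.\<close>

definition split_coordinates ::
  "(nat \<Rightarrow> real) \<Rightarrow> nat \<Rightarrow> nat \<Rightarrow> nat \<Rightarrow> complex \<Rightarrow> complex \<Rightarrow> complex \<Rightarrow> (nat \<Rightarrow> complex) \<Rightarrow> bool" where
  "split_coordinates k n t d a b \<kappa> \<phi> \<longleftrightarrow> even n \<and> t + d \<le> n \<and>
    (\<forall>j. 1 \<le> j \<and> j \<le> n \<longrightarrow> dunkl_num (k 3) j \<noteq> 0) \<and> \<phi> 0 = 0 \<and> \<phi> (Suc d) = 0 \<and>
    (\<forall>i<d. \<phi> (Suc i) = dunkl_num (k 1) (Suc (t + i)) * dunkl_num (k 3) (n - (t + i))) \<and>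
    (\<forall>i\<le>d. (-1) ^ (t + i) * (dunkl_num (k 1) (t + i) + 1 / 2 + of_real (k 2)) + of_real (k 1)
          = (-1) ^ t * theta d a i) \<and>
    (\<forall>i\<le>d. (-1) ^ (t + i) * (dunkl_num (k 3) (n - (t + i)) + 1 / 2 + of_real (k 2)) + of_real (k 3)
          = - ((-1) ^ t) * theta d b i) \<and>
    (\<forall>i\<le>d. 1 / 2 + (of_real (k 1) + of_real (k 3)) * (-1) ^ (t + i)
          = - (2 * theta d a i * theta d b i + \<phi> i + \<phi> (Suc i) - \<kappa>))"

lemma split_coordinatesD:
  assumes "split_coordinates k n t d a b \<kappa> \<phi>"
  shows "even n" "t + d \<le> n" "1 \<le> j \<Longrightarrow> j \<le> n \<Longrightarrow> dunkl_num (k 3) j \<noteq> 0" "\<phi> 0 = 0" "\<phi> (Suc d) = 0"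
    "i < d \<Longrightarrow> \<phi> (Suc i) = dunkl_num (k 1) (Suc (t + i)) * dunkl_num (k 3) (n - (t + i))"
    "i \<le> d \<Longrightarrow> (-1) ^ (t + i) * (dunkl_num (k 1) (t + i) + 1 / 2 + of_real (k 2)) + of_real (k 1)
          = (-1) ^ t * theta d a i"
    "i \<le> d \<Longrightarrow> (-1) ^ (t + i) * (dunkl_num (k 3) (n - (t + i)) + 1 / 2 + of_real (k 2)) + of_real (k 3)
          = - ((-1) ^ t) * theta d b i"
    "i \<le> d \<Longrightarrow> 1 / 2 + (of_real (k 1) + of_real (k 3)) * (-1) ^ (t + i)
          = - (2 * theta d a i * theta d b i + \<phi> i + \<phi> (Suc i) - \<kappa>)"
  using assms unfolding split_coordinates_def by blast+

lemma split_scale_Suc: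
  assumes "split_coordinates k n t d a b \<kappa> \<phi>" "i < d"
  shows "split_scale (k 3) (n - t) i
    = \<i> * (-1) ^ i * dunkl_num (k 3) (n - (t + i)) * split_scale (k 3) (n - t) (Suc i)"
  using split_coordinatesD(3)[OF assms(1), of "n - (t + i)"] split_coordinatesD(2)[OF assms(1)] assms(2)
  by (simp add: split_scale_def field_simps flip: power_add)

lemma split_scale_nonzero:
  assumes "split_coordinates k n t d a b \<kappa> \<phi>" "i \<le> d" shows "split_scale (k 3) (n - t) i \<noteq> 0"
  using split_coordinatesD(2,3)[OF assms(1)] assms(2) by (auto simp: split_scale_def)

text \<open>The hypotheses \<open>start\<close> and \<open>stop\<close> cut the exponents
  \<open>t, ..., t + d\<close> off from those below and above. Within this block the rescaled
  formulas for \<open>restr\<close> are the bidiagonal ones, with \<open>Z\<close> in the role of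
  the lower and \<open>X\<close> in that of the upper bidiagonal operator.\<close>

lemma split_coord_ops:
  fixes s :: bool
  assumes S: "split_coordinates k n t d a b \<kappa> \<phi>"
    and p: "p \<in> Mn k n" and start: "t = 0 \<or> (\<forall>s. restr n p s (t - 1) = 0)"
    and stop: "\<And>s. dunkl_num (k 1) (Suc (t + d)) * restr n p s (Suc (t + d)) = 0"
  defines "w \<equiv> \<lambda>i. split_coord k n t d p (s, i)"
  shows "(\<lambda>i. split_coord k n t d (opX k p) (s, i)) = vsc (- ((-1) ^ t)) (bidiagY d (theta d b) \<phi> w)"
    and "(\<lambda>i. split_coord k n t d (opY k p) (s, i)) = vsc (- 1) (bidiagZ d (theta d a) (theta d b) \<phi> \<kappa> w)"
    and "(\<lambda>i. split_coord k n t d (opZ k p) (s, i)) = vsc ((-1) ^ t) (bidiagX d (theta d a) w)"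
proof -
  note n = split_coordinatesD(1)[OF S] and td = split_coordinatesD(2)[OF S]
    and \<phi>0 = split_coordinatesD(4,5)[OF S] and \<phi> = split_coordinatesD(6)[OF S]
    and diagZ = split_coordinatesD(7)[OF S] and diagX = split_coordinatesD(8)[OF S] and diagY = split_coordinatesD(9)[OF S]
  define L where "L = split_scale (k 3) (n - t)"
  define g where "g = (\<lambda>i. restr n p s (t + i))"
  have w: "w i = L i * g i" if "i \<le> d" for i using that by (simp add: w_def split_coord_def L_def g_def)
  have wd: "w (Suc d) = 0" by (simp add: w_def split_coord_def)
  have tt: "(-1) ^ t * (-1) ^ t = (1 :: complex)" by (simp flip: power_add)
  have ii: "(-1) ^ i * (-1) ^ i = (1 :: complex)" for i by (simp flip: power_add)
  \<comment> \<open>At \<open>i = d\<close> the left side vanishes by \<open>stop\<close> and the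
    right side by \<open>\<phi> (Suc d) = 0\<close>; below, one step of the rescaling supplies the
    missing factor of \<open>\<phi>\<close>.\<close>
  have up: "\<i> * (-1) ^ i * dunkl_num (k 1) (Suc (t + i)) * L i * g (Suc i) = - (\<phi> (Suc i) * w (Suc i))" if "i \<le> d" for i
  proof (cases "i = d")
    case True
    then show ?thesis using stop[of s] \<phi>0 by (auto simp: g_def)
  next
    case False
    then have i: "i < d" using that by simp
    have "\<i> * (-1) ^ i * dunkl_num (k 1) (Suc (t + i)) * L i * g (Suc i)
        = ((-1) ^ i * (-1) ^ i) * (\<i> * \<i>) * (dunkl_num (k 1) (Suc (t + i)) * dunkl_num (k 3) (n - (t + i))) * (L (Suc i) * g (Suc i))"
      unfolding L_def split_scale_Suc[OF S i] by (simp only: mult_ac)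
    then show ?thesis using w[of "Suc i"] i by (simp add: ii \<phi>)
  qed
  have down: "(if t + i = 0 then 0 else \<i> * dunkl_num (k 3) (Suc (n - (t + i))) * L i * restr n p s (t + i - 1))
      = - ((-1) ^ i * (if i = 0 then 0 else w (i - 1)))" if "i \<le> d" for i
  proof (cases i)
    case 0
    then show ?thesis using start by auto
  next
    case (Suc j)
    have c: "Suc (n - (t + i)) = n - (t + j)" using Suc that td by simp
    have "w j = \<i> * (-1) ^ j * dunkl_num (k 3) (n - (t + j)) * L i * g j"
      using w[of j] split_scale_Suc[OF S, of j] that by (simp add: Suc L_def)
    then have "- ((-1) ^ i * w j) = ((-1) ^ j * (-1) ^ j) * (\<i> * dunkl_num (k 3) (n - (t + j)) * L i * g j)"
      by (simp add: Suc)
    then show ?thesis unfolding ii c by (simp add: Suc g_def)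
  qed
  have FGX: "split_coord k n t d (opX k p) (s, i) = L i * restr n (opX k p) s (t + i)"
    and FGY: "split_coord k n t d (opY k p) (s, i) = L i * restr n (opY k p) s (t + i)"
    and FGZ: "split_coord k n t d (opZ k p) (s, i) = L i * restr n (opZ k p) s (t + i)" if "i \<le> d" for i
    using that by (simp_all add: split_coord_def L_def)
  have le: "t + i \<le> n" if "i \<le> d" for i using that td by simp
  show "(\<lambda>i. split_coord k n t d (opX k p) (s, i)) = vsc (- ((-1) ^ t)) (bidiagY d (theta d b) \<phi> w)"
  proof
    fix i
    show "split_coord k n t d (opX k p) (s, i) = vsc (- ((-1) ^ t)) (bidiagY d (theta d b) \<phi> w) i"
    proof (cases "i \<le> d")
      case True
      have "split_coord k n t d (opX k p) (s, i) = (- ((-1) ^ t) * theta d b i) * (L i * g i)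
          + (-1) ^ t * (\<i> * (-1) ^ i * dunkl_num (k 1) (Suc (t + i)) * L i * g (Suc i))"
        unfolding diagX[OF True, symmetric]
        unfolding FGX[OF True] restr_opX[OF p n le[OF True]] by (simp add: g_def power_add algebra_simps)
      also have "\<dots> = - ((-1) ^ t) * (theta d b i * w i + \<phi> (Suc i) * w (Suc i))"
        unfolding up[OF True] by (simp add: w True algebra_simps)
      finally show ?thesis using True \<phi>0 by (cases "i = d") (simp_all add: bidiagY_def)
    qed (simp add: split_coord_def bidiagY_def)
  qed
  show "(\<lambda>i. split_coord k n t d (opZ k p) (s, i)) = vsc ((-1) ^ t) (bidiagX d (theta d a) w)"
  proof
    fix i
    show "split_coord k n t d (opZ k p) (s, i) = vsc ((-1) ^ t) (bidiagX d (theta d a) w) i"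
    proof (cases "i \<le> d")
      case True
      have "split_coord k n t d (opZ k p) (s, i) = ((-1) ^ t * theta d a i) * (L i * g i)
          - (-1) ^ t * (-1) ^ i * (if t + i = 0 then 0 else \<i> * dunkl_num (k 3) (Suc (n - (t + i))) * L i * restr n p s (t + i - 1))"
        unfolding diagZ[OF True, symmetric]
        unfolding FGZ[OF True] restr_opZ[OF p n le[OF True]] by (simp add: g_def power_add algebra_simps)
      also have "\<dots> = (-1) ^ t * (theta d a i * w i) + (-1) ^ t * ((-1) ^ i * (-1) ^ i) * (if i = 0 then 0 else w (i - 1))"
        unfolding down[OF True] by (simp add: w True)
      finally show ?thesis unfolding ii using True by (simp add: bidiagX_def algebra_simps)
    qed (simp add: split_coord_def bidiagX_def)
  qed
  show "(\<lambda>i. split_coord k n t d (opY k p) (s, i)) = vsc (- 1) (bidiagZ d (theta d a) (theta d b) \<phi> \<kappa> w)"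
  proof
    fix i
    show "split_coord k n t d (opY k p) (s, i) = vsc (- 1) (bidiagZ d (theta d a) (theta d b) \<phi> \<kappa> w) i"
    proof (cases "i \<le> d")
      case True
      have "split_coord k n t d (opY k p) (s, i)
          = - (2 * theta d a i * theta d b i + \<phi> i + \<phi> (Suc i) - \<kappa>) * (L i * g i)
          + (if t + i = 0 then 0 else \<i> * dunkl_num (k 3) (Suc (n - (t + i))) * L i * restr n p s (t + i - 1))
          - ((-1) ^ i * (-1) ^ i) * (\<i> * dunkl_num (k 1) (Suc (t + i)) * L i * g (Suc i))"
        unfolding ii diagY[OF True, symmetric]
        unfolding FGY[OF True] restr_opY[OF p n le[OF True]] by (simp add: g_def algebra_simps)
      also have "((-1) ^ i * (-1) ^ i) * (\<i> * dunkl_num (k 1) (Suc (t + i)) * L i * g (Suc i))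
          = (-1) ^ i * (\<i> * (-1) ^ i * dunkl_num (k 1) (Suc (t + i)) * L i * g (Suc i))"
        by (simp only: mult_ac)
      finally show ?thesis
        unfolding down[OF True] up[OF True] by (simp add: bidiagZ_theta[of i d \<phi> w a b \<kappa>, OF True \<phi>0 wd] w True algebra_simps)
    next
      case False
      then show ?thesis by (simp add: w_def split_coord_def bidiagZ_def bidiagX_def bidiagY_def)
    qed
  qed
qed

lemma tpar_eq_enat:
  assumes "tpar x = enat t" shows "odd t" "x = - real t / 2" "dunkl_num x t = 0"
proof -
  obtain m :: nat where m: "odd m" "2 * x = - real m" "t = nat \<lfloor>- 2 * x\<rfloor>"
    using assms by (auto simp: tpar_def split: if_splits)
  then have "t = m" by simp
  then show "odd t" "x = - real t / 2" using m by auto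
  then show "dunkl_num x t = 0" by (simp add: dunkl_num_def)
qed

lemma dunkl_num_neq_0:
  assumes "enat n < tpar x" "1 \<le> j" "j \<le> n" shows "dunkl_num x j \<noteq> 0"
proof
  assume 0: "dunkl_num x j = 0"
  have "Re (dunkl_num x j) = real j + (if odd j then 2 * x else 0)" by (simp add: dunkl_num_def)
  then have j: "odd j" "2 * x = - real j" using 0 assms(2) by (auto split: if_splits)
  then have "tpar x = enat (nat \<lfloor>- 2 * x\<rfloor>)" unfolding tpar_def by auto
  also have "nat \<lfloor>- 2 * x\<rfloor> = j" using j by simp
  finally show False using assms by simp
qed

lemma restr_prescribed:
  assumes "\<And>j. 1 \<le> j \<Longrightarrow> j \<le> n \<Longrightarrow> dunkl_num (k 2) j \<noteq> 0"
  obtains p where "p \<in> Mn k n" "\<And>s a. a \<le> n \<Longrightarrow> restr n p s a = h s a"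
proof -
  \<comment> \<open>Inverts the projections onto the two eigenlines of \<open>e\<^sub>2\<close> that
    define \<open>restr\<close>.\<close>
  define g where "g s a = (if s then \<i> * (h False a - (-1) ^ a * h True a) / 2
      else (h False a + (-1) ^ a * h True a) / 2)" for s :: bool and a :: nat
  obtain p where p: "p \<in> Mn k n" "\<And>s a. a \<le> n \<Longrightarrow> p (s, (a, 0, n - a)) = g s a"
    using Mn_extension[where n = n and k = k and g = g] assms by blast
  have aa: "(-1) ^ a * ((-1) ^ a * x) = (x :: complex)" for a x
    by (cases "even a") simp_all
  have "restr n p s a = h s a" if "a \<le> n" for s a
    using p(2)[OF that] by (simp add: restr_def g_def aa field_simps)
  then show ?thesis using that p(1) by blast
qed

lemma restr_eq_0_iff: "(\<forall>s. restr n p s a = 0) \<longleftrightarrow> (\<forall>s. p (s, (a, 0, n - a)) = 0)"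
proof
  assume *: "\<forall>s. restr n p s a = 0"
  have "p (False, (a, 0, n - a)) = \<i> * p (True, (a, 0, n - a))"
    "p (False, (a, 0, n - a)) = - (\<i> * p (True, (a, 0, n - a)))"
    using *[rule_format, of False] *[rule_format, of True] by (auto simp: restr_def add_eq_0_iff2)
  then have "p (False, (a, 0, n - a)) = 0" "p (True, (a, 0, n - a)) = 0" by (auto simp: eq_neg_iff_add_eq_0)
  then show "\<forall>s. p (s, (a, 0, n - a)) = 0" by (metis (full_types))
qed (simp add: restr_def)

subsection \<open>The submodule and the quotient\<close>

lemma Mn_diff: "p \<in> Mn k n \<Longrightarrow> q \<in> Mn k n \<Longrightarrow> p - q \<in> Mn k n"
  unfolding Mn_iff by (auto simp: homog_def right_diff_distrib) (metis (no_types))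

lemma Mn_eqI:
  assumes p: "p \<in> Mn k n" and q: "q \<in> Mn k n" and nz: "\<And>j. 1 \<le> j \<Longrightarrow> j \<le> n \<Longrightarrow> dunkl_num (k 2) j \<noteq> 0"
    and eq: "\<And>s a. a \<le> n \<Longrightarrow> restr n p s a = restr n q s a"
  shows "p = q"
proof -
  define r where "r = p - q"
  have r: "r \<in> Mn k n" unfolding r_def by (rule Mn_diff[OF p q])
  have "restr n r s a = 0" if "a \<le> n" for s a
    using eq[OF that, of s] by (simp add: r_def restr_def algebra_simps split: if_splits)
  then have 0: "r (s, (a, 0, n - a)) = 0" if "a \<le> n" for s a
    using restr_eq_0_iff[of n r a] that by blast
  have "r (s, (a, b, c)) = 0" for s a b c
  proof (cases "a < Suc n")
    case True
    \<comment> \<open>The bound \<open>t\<close> is \<open>Suc n\<close> here, so that every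
      exponent up to \<open>n\<close> is covered.\<close>
    show ?thesis
      by (rule Mn_eq_0_of_restriction[OF r nz _ 0 True]) auto
  next
    case False
    then show ?thesis using homogD[of r n a b c s] r by (simp add: Mn_iff)
  qed
  then show ?thesis by (auto simp: r_def fun_eq_iff)
qed

text \<open>Since \<open>dunkl_num (k 1) t = 0\<close>, the vanishing of the coefficients with
  \<open>a < t\<close> spreads from \<open>x\<^sub>2 = 0\<close> to all powers of
  \<open>x\<^sub>2\<close>.\<close>

lemma Mnx_iff_restr:
  assumes p: "p \<in> Mn k n" and nz: "\<And>j. 1 \<le> j \<Longrightarrow> j \<le> n \<Longrightarrow> dunkl_num (k 2) j \<noteq> 0"
    and t: "tpar (k 1) = enat t" and tn: "t \<le> n"
  shows "p \<in> Mnx k n 1 \<longleftrightarrow> (\<forall>s. \<forall>a<t. restr n p s a = 0)"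
proof
  assume "p \<in> Mnx k n 1"
  then have "p (s, (a, b, c)) = 0" if "a < t" for s a b c
    using that unfolding Mnx_def t by (force simp: expo_def)
  then show "\<forall>s. \<forall>a<t. restr n p s a = 0" by (simp add: restr_def)
next
  assume "\<forall>s. \<forall>a<t. restr n p s a = 0"
  then have 0: "p (s, (a, 0, n - a)) = 0" if "a < t" "a \<le> n" for s a
    using restr_eq_0_iff[of n p a] that by blast
  have "p (s, (a, b, c)) = 0" if "a < t" for s a b c
    by (rule Mn_eq_0_of_restriction[OF p nz disjI1[OF tpar_eq_enat(3)[OF t]] 0 that])
  then show "p \<in> Mnx k n 1"
    using p unfolding Mnx_def t by (auto simp: expo_def)
qed

lemma dsum2_simps:
  "car (dsum2 M) = {w. \<forall>s. (\<lambda>j. w (s, j)) \<in> car M}"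
  "actX (dsum2 M) w (s, i) = actX M (\<lambda>j. w (s, j)) i"
  "actY (dsum2 M) w (s, i) = actY M (\<lambda>j. w (s, j)) i"
  "actZ (dsum2 M) w (s, i) = actZ M (\<lambda>j. w (s, j)) i"
  by (auto simp: dsum2_def car_def actX_def actY_def actZ_def) (metis (full_types))

lemma twist_sgn_123_simps:
  "car (twist_sgn_123 e1 e2 e3 M) = car M" "actX (twist_sgn_123 e1 e2 e3 M) v = vsc e2 (actY M v)"
  "actY (twist_sgn_123 e1 e2 e3 M) v = vsc e3 (actZ M v)" "actZ (twist_sgn_123 e1 e2 e3 M) v = vsc e1 (actX M v)"
  by (simp_all add: twist_sgn_123_def twist_123_def twist_sgn_def car_def actX_def actY_def actZ_def)

lemma Mmod_simps:
  "car (Mmod k n) = Mn k n" "actX (Mmod k n) = opX k" "actY (Mmod k n) = opY k" "actZ (Mmod k n) = opZ k"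
  "car (Mxmod k n i) = Mnx k n i" "actX (Mxmod k n i) = opX k" "actY (Mxmod k n i) = opY k" "actZ (Mxmod k n i) = opZ k"
  by (simp_all add: Mmod_def Mxmod_def car_def actX_def actY_def actZ_def)

text \<open>One formula for both twists: odd \<open>t\<close> gives the signs of \<open>W1\<close>,
  and \<open>t = 0\<close> those of \<open>W2\<close>.\<close>

definition split_mod :: "nat \<Rightarrow> nat \<Rightarrow> complex \<Rightarrow> complex \<Rightarrow> complex \<Rightarrow> (nat \<Rightarrow> complex) \<Rightarrow> nat bimod" where
  "split_mod t d a b \<kappa> \<phi> = twist_sgn_123 ((-1) ^ t) (- ((-1) ^ t)) (- 1) (bidiag_mod d (theta d a) (theta d b) \<phi> \<kappa>)"

lemma car_dsum2_split_mod: "car (dsum2 (split_mod t d a b \<kappa> \<phi>)) = {w. \<forall>s. (\<lambda>j. w (s, j)) \<in> supp_le d}"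
  by (simp add: dsum2_simps split_mod_def twist_sgn_123_simps car_bidiag_mod)

lemma split_coord_intertwines:
  assumes S: "split_coordinates k n t d a b \<kappa> \<phi>"
    and M: "car M \<subseteq> Mn k n" "actX M = opX k" "actY M = opY k" "actZ M = opZ k"
    and start: "\<And>p s. p \<in> car M \<Longrightarrow> t = 0 \<or> restr n p s (t - 1) = 0"
    and stop: "\<And>p s. p \<in> car M \<Longrightarrow> dunkl_num (k 1) (Suc (t + d)) * restr n p s (Suc (t + d)) = 0"
  shows "intertwines M (dsum2 (split_mod t d a b \<kappa> \<phi>)) (split_coord k n t d)"
  unfolding intertwines_def M
proof
  fix p assume p: "p \<in> car M"
  then have pM: "p \<in> Mn k n" using M(1) by blast
  have start': "t = 0 \<or> (\<forall>s. restr n p s (t - 1) = 0)" using start[OF p] by blast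
  note ops = split_coord_ops[OF S pM start' stop[OF p]]
  show "split_coord k n t d (opX k p) = actX (dsum2 (split_mod t d a b \<kappa> \<phi>)) (split_coord k n t d p) \<and> split_coord k n t d (opY k p) = actY (dsum2 (split_mod t d a b \<kappa> \<phi>)) (split_coord k n t d p) \<and>
      split_coord k n t d (opZ k p) = actZ (dsum2 (split_mod t d a b \<kappa> \<phi>)) (split_coord k n t d p)"
  proof (intro conjI ext)
    fix x :: "bool \<times> nat"
    obtain s i where x: "x = (s, i)" by (cases x)
    show "split_coord k n t d (opX k p) x = actX (dsum2 (split_mod t d a b \<kappa> \<phi>)) (split_coord k n t d p) x"
      using fun_cong[OF ops(1)[of s], of i]
      unfolding x dsum2_simps split_mod_def twist_sgn_123_simps bidiag_mod_simps .
    show "split_coord k n t d (opY k p) x = actY (dsum2 (split_mod t d a b \<kappa> \<phi>)) (split_coord k n t d p) x"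
      using fun_cong[OF ops(2)[of s], of i]
      unfolding x dsum2_simps split_mod_def twist_sgn_123_simps actZ_bidiagZ .
    show "split_coord k n t d (opZ k p) x = actZ (dsum2 (split_mod t d a b \<kappa> \<phi>)) (split_coord k n t d p) x"
      using fun_cong[OF ops(3)[of s], of i]
      unfolding x dsum2_simps split_mod_def twist_sgn_123_simps bidiag_mod_simps .
  qed
qed

lemma split_coord_eq_iff:
  assumes "split_coordinates k n t d a b \<kappa> \<phi>"
  shows "split_coord k n t d p = split_coord k n t d q \<longleftrightarrow> (\<forall>s. \<forall>i\<le>d. restr n p s (t + i) = restr n q s (t + i))"
  using split_scale_nonzero[OF assms] by (auto simp: split_coord_def fun_eq_iff)

lemma split_coord_in_car: "split_coord k n t d p \<in> car (dsum2 (split_mod t d a b \<kappa> \<phi>))"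
  unfolding car_dsum2_split_mod by (simp add: split_coord_def supp_le_def)

lemma split_coord_onto:
  assumes S: "split_coordinates k n t d a b \<kappa> \<phi>"
    and nz2: "\<And>j. 1 \<le> j \<Longrightarrow> j \<le> n \<Longrightarrow> dunkl_num (k 2) j \<noteq> 0" and w: "w \<in> car (dsum2 (split_mod t d a b \<kappa> \<phi>))"
  obtains p where "p \<in> Mn k n" "split_coord k n t d p = w" "\<And>s a. a < t \<Longrightarrow> restr n p s a = 0"
proof -
  note td = split_coordinatesD(2)[OF S]
  \<comment> \<open>Zero outside the block; the zeros below \<open>t\<close> put the polynomial into
    the submodule when \<open>t = t1\<close>.\<close>
  define h where "h s i = (if t \<le> i \<and> i \<le> t + d then w (s, i - t) / split_scale (k 3) (n - t) (i - t) else 0)" for s i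
  obtain p where p: "p \<in> Mn k n" "\<And>s a. a \<le> n \<Longrightarrow> restr n p s a = h s a"
    using restr_prescribed[where n = n and k = k and h = h] nz2 by blast
  have "split_coord k n t d p (s, i) = w (s, i)" for s i
  proof (cases "i \<le> d")
    case True
    then show ?thesis using p(2)[of "t + i" s] td split_scale_nonzero[OF S True] by (simp add: split_coord_def h_def)
  next
    case False
    then show ?thesis using w by (simp add: split_coord_def car_dsum2_split_mod supp_le_def)
  qed
  then have "split_coord k n t d p = w" by auto
  moreover have "restr n p s a = 0" if "a < t" for s a
    using p(2)[of a s] that td by (simp add: h_def)
  ultimately show ?thesis using that p(1) by blast
qed

lemma Mxmod_iso:
  assumes S: "split_coordinates k n t d a b \<kappa> \<phi>" and t: "tpar (k 1) = enat t" and d: "t + d = n"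
    and k2: "enat n < tpar (k 2)"
  shows "bimod_iso (Mxmod k n 1) (dsum2 (split_mod t d a b \<kappa> \<phi>))"
proof -
  let ?W = "split_mod t d a b \<kappa> \<phi>"
  note nz2 = dunkl_num_neq_0[OF k2]
  have tn: "t \<le> n" using d by simp
  have sub: "Mnx k n 1 \<subseteq> Mn k n" by (auto simp: Mnx_def)
  have iff: "p \<in> Mnx k n 1 \<longleftrightarrow> p \<in> Mn k n \<and> (\<forall>s. \<forall>a<t. restr n p s a = 0)" for p
    using Mnx_iff_restr[OF _ nz2 t tn] sub by blast
  have "bij_betw (split_coord k n t d) (Mnx k n 1) (car (dsum2 ?W))"
  proof (rule bij_betw_imageI)
    show "inj_on (split_coord k n t d) (Mnx k n 1)"
    proof (rule inj_onI)
      fix p q assume pq: "p \<in> Mnx k n 1" "q \<in> Mnx k n 1" and eq: "split_coord k n t d p = split_coord k n t d q"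
      show "p = q"
      proof (rule Mn_eqI[where k = k and n = n, OF _ _ nz2])
        show "p \<in> Mn k n" "q \<in> Mn k n" using pq sub by auto
        fix s and e :: nat assume e: "e \<le> n"
        show "restr n p s e = restr n q s e"
        proof (cases "e < t")
          case True
          then show ?thesis using pq unfolding iff by simp
        next
          case False
          then have "e = t + (e - t)" "e - t \<le> d" using e d by auto
          then show ?thesis using eq unfolding split_coord_eq_iff[OF S] by metis
        qed
      qed auto
    qed
    show "split_coord k n t d ` Mnx k n 1 = car (dsum2 ?W)"
    proof
      show "split_coord k n t d ` Mnx k n 1 \<subseteq> car (dsum2 ?W)" using split_coord_in_car by blast
      show "car (dsum2 ?W) \<subseteq> split_coord k n t d ` Mnx k n 1"
      proof
        fix w assume "w \<in> car (dsum2 ?W)"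
        then obtain p where p: "p \<in> Mn k n" "split_coord k n t d p = w" "\<And>s a. a < t \<Longrightarrow> restr n p s a = 0"
          using split_coord_onto[OF S nz2] by blast
        then have "p \<in> Mnx k n 1" unfolding iff by blast
        then show "w \<in> split_coord k n t d ` Mnx k n 1" using p(2) by blast
      qed
    qed
  qed
  moreover have "intertwines (Mxmod k n 1) (dsum2 ?W) (split_coord k n t d)"
  proof (rule split_coord_intertwines[OF S])
    fix p s assume "p \<in> car (Mxmod k n 1)"
    then have p: "p \<in> Mnx k n 1" by (simp add: Mmod_simps)
    then show "t = 0 \<or> restr n p s (t - 1) = 0" unfolding iff by (cases t) auto
    have "p \<in> homog n" using p sub by (auto simp: Mn_def)
    \<comment> \<open>Here the block ends at the degree: \<open>Suc (t + d) = n + 1\<close>.\<close>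
    then show "dunkl_num (k 1) (Suc (t + d)) * restr n p s (Suc (t + d)) = 0" using d by (simp add: restr_beyond)
  qed (use sub in \<open>simp_all add: Mmod_simps\<close>)
  ultimately show ?thesis
    unfolding bimod_iso_def Mmod_simps using lin_on_split_coord by blast
qed

text \<open>The block \<open>0, ..., d\<close> is cut off from above by
  \<open>dunkl_num (k 1) (Suc d) = 0\<close>. Forgetting the exponents above \<open>d\<close> is
  therefore a homomorphism, and its kernel is the submodule.\<close>

lemma Mmod_quot_iso:
  assumes S: "split_coordinates k n 0 d a b \<kappa> \<phi>" and t: "tpar (k 1) = enat (Suc d)" and d: "Suc d \<le> n"
    and k2: "enat n < tpar (k 2)"
  shows "quot_iso (Mmod k n) (Mxmod k n 1) (dsum2 (split_mod 0 d a b \<kappa> \<phi>))"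
proof -
  let ?W = "split_mod 0 d a b \<kappa> \<phi>"
  note nz2 = dunkl_num_neq_0[OF k2]
  have sub: "Mnx k n 1 \<subseteq> Mn k n" by (auto simp: Mnx_def)
  have iff: "p \<in> Mnx k n 1 \<longleftrightarrow> p \<in> Mn k n \<and> (\<forall>s. \<forall>a<Suc d. restr n p s a = 0)" for p
    using Mnx_iff_restr[OF _ nz2 t d] sub by blast
  have onto: "split_coord k n 0 d ` Mn k n = car (dsum2 ?W)"
  proof
    show "split_coord k n 0 d ` Mn k n \<subseteq> car (dsum2 ?W)" using split_coord_in_car by blast
    show "car (dsum2 ?W) \<subseteq> split_coord k n 0 d ` Mn k n"
    proof
      fix w assume "w \<in> car (dsum2 ?W)"
      then obtain p where "p \<in> Mn k n" "split_coord k n 0 d p = w"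
        using split_coord_onto[OF S nz2] by blast
      then show "w \<in> split_coord k n 0 d ` Mn k n" by blast
    qed
  qed
  have restr_0: "restr n 0 s a = 0" for s a by (simp add: restr_def)
  then have "split_coord k n 0 d 0 = 0" by (auto simp: split_coord_def fun_eq_iff)
  then have "split_coord k n 0 d p = 0 \<longleftrightarrow> (\<forall>s. \<forall>a<Suc d. restr n p s a = 0)" for p
    using split_coord_eq_iff[OF S, of p 0] restr_0 by (simp add: less_Suc_eq_le)
  then have ker: "{p \<in> Mn k n. split_coord k n 0 d p = 0} = Mnx k n 1"
    using iff by blast
  have "intertwines (Mmod k n) (dsum2 ?W) (split_coord k n 0 d)"
    by (rule split_coord_intertwines[OF S]) (simp_all add: Mmod_simps tpar_eq_enat(3)[OF t, simplified])
  then show ?thesis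
    unfolding quot_iso_def Mmod_simps
    by (intro exI[of _ "split_coord k n 0 d"] conjI lin_on_split_coord onto ker)
qed

text \<open>The diagonals of \<open>Z\<close> and \<open>X\<close> determine \<open>a\<close> and
  \<open>b\<close>, and the product formula for \<open>phiE\<close> at odd indices determines the
  square of \<open>c\<close>. At even \<open>i\<close> the formula reads
  \<open>i * (d - i + 1)\<close> because \<open>2 * k 1 = - t\<close> cancels the \<open>t\<close>
  in \<open>dunkl_num (k 1) (t + i)\<close>.\<close>

lemma split_coordinates_E:
  fixes k :: "nat \<Rightarrow> real" and n t :: nat and K :: real
  assumes n: "even n" and t: "odd t" "t \<le> n" and k1: "k 1 = - real t / 2" and K: "K = k 1 + k 2 + k 3"
    and k3: "enat n < tpar (k 3)"
  defines "a \<equiv> complex_of_real (k 2 + (real n + 1) / 2)" and "b \<equiv> complex_of_real (- K - (real n + 1) / 2)"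
    and "c \<equiv> complex_of_real (- k 3 - (real n + 1) / 2)"
  shows "split_coordinates k n t (n - t) a b (kapE (n - t) a b c) (phiE (n - t) a b c)"
  unfolding split_coordinates_def
proof (intro conjI allI impI)
  have d: "odd (n - t)" using n t by simp
  have rd: "complex_of_nat (n - t) = of_nat n - of_nat t" using t by (simp add: of_nat_diff)
  have ri: "complex_of_nat (n - (t + i)) = of_nat n - of_nat t - of_nat i" if "i \<le> n - t" for i
    using that t by (simp add: of_nat_diff)
  have le: "t + i \<le> n" if "i \<le> n - t" for i using that t by simp
  have pi: "even (n - (t + i)) \<longleftrightarrow> odd i" if "i \<le> n - t" for i
    using le[OF that] n t by auto
  have k1': "complex_of_real (k 1) = - of_nat t / 2" unfolding k1 by simp
  have a: "a = of_real (k 2) + (of_nat n + 1) / 2" by (simp add: a_def)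
  have b: "b = of_nat t / 2 - of_real (k 2) - of_real (k 3) - (of_nat n + 1) / 2" unfolding b_def K k1 by simp
  have c: "c = - of_real (k 3) - (of_nat n + 1) / 2" by (simp add: c_def)
  note simps = dunkl_num_def theta_even theta_odd phiE_def kapE_def rd ri pi k1'[unfolded One_nat_def] t n a b c
  show "even n" by (rule n)
  show "t + (n - t) \<le> n" using t by simp
  show "phiE (n - t) a b c 0 = 0" by (simp add: phiE_def)
  show "phiE (n - t) a b c (Suc (n - t)) = 0" by (rule phiE_top[OF d])
  show "dunkl_num (k 3) j \<noteq> 0" if "1 \<le> j \<and> j \<le> n" for j using dunkl_num_neq_0[OF k3] that by blast
  show "phiE (n - t) a b c (Suc i) = dunkl_num (k 1) (Suc (t + i)) * dunkl_num (k 3) (n - (t + i))" if "i < n - t" for i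
    using that le[of i] by (cases "even i") (simp_all add: simps del: of_nat_Suc add: of_nat_Suc field_simps power2_eq_square)
  fix i assume i0: "i \<le> n - t"
  note i = i0 le[OF i0]
  show "(-1) ^ (t + i) * (dunkl_num (k 1) (t + i) + 1 / 2 + of_real (k 2)) + of_real (k 1) = (-1) ^ t * theta (n - t) a i"
    using i by (cases "even i") (simp_all add: simps field_simps)
  show "(-1) ^ (t + i) * (dunkl_num (k 3) (n - (t + i)) + 1 / 2 + of_real (k 2)) + of_real (k 3) = - ((-1) ^ t) * theta (n - t) b i"
    using i by (cases "even i") (simp_all add: simps field_simps)
  show "1 / 2 + (of_real (k 1) + of_real (k 3)) * (-1) ^ (t + i)
      = - (2 * theta (n - t) a i * theta (n - t) b i + phiE (n - t) a b c i + phiE (n - t) a b c (Suc i) - kapE (n - t) a b c)"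
    using i by (cases "even i") (simp_all add: simps field_simps power2_eq_square)
qed

text \<open>The block starts at 0 and has \<open>d = t - 1\<close> even. At odd \<open>i\<close> the
  factor \<open>i - d - 1\<close> of \<open>phiO\<close> is \<open>i - t\<close>, which is
  \<open>dunkl_num (k 1) i\<close>.\<close>

lemma split_coordinates_O:
  fixes k :: "nat \<Rightarrow> real" and n t :: nat and K :: real
  assumes n: "even n" and t: "odd t" "t \<le> n" and k1: "k 1 = - real t / 2" and K: "K = k 1 + k 2 + k 3"
    and k3: "enat n < tpar (k 3)"
  defines "a \<equiv> complex_of_real (k 2)" and "b \<equiv> complex_of_real (- K - real n - 1)"
    and "c \<equiv> complex_of_real (- k 3)"
  shows "split_coordinates k n 0 (t - 1) a b (kapO (t - 1) a b c) (phiO (t - 1) a b c)"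
  unfolding split_coordinates_def
proof (intro conjI allI impI)
  have d: "even (t - 1)" using t by simp
  have rd: "complex_of_nat (t - 1) = of_nat t - 1" using t by (cases t) auto
  have ri: "complex_of_nat (n - i) = of_nat n - of_nat i" if "i \<le> t - 1" for i
    using that t by (simp add: of_nat_diff)
  have le: "i \<le> n" if "i \<le> t - 1" for i using that t by simp
  have pi: "even (n - i) \<longleftrightarrow> even i" if "i \<le> t - 1" for i
    using le[OF that] n by auto
  have k1': "complex_of_real (k 1) = - of_nat t / 2" unfolding k1 by simp
  have b: "b = of_nat t / 2 - of_real (k 2) - of_real (k 3) - of_nat n - 1" unfolding b_def K k1 by simp
  have c: "c = - of_real (k 3)" by (simp add: c_def)
  note simps = dunkl_num_def theta_even theta_odd phiO_def kapO_def rd[simplified] ri pi k1'[unfolded One_nat_def] t n a_def b c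
  show "even n" by (rule n)
  show "0 + (t - 1) \<le> n" using t by simp
  show "phiO (t - 1) a b c 0 = 0" by (simp add: phiO_def)
  show "phiO (t - 1) a b c (Suc (t - 1)) = 0" by (rule phiO_top[OF d])
  show "dunkl_num (k 3) j \<noteq> 0" if "1 \<le> j \<and> j \<le> n" for j using dunkl_num_neq_0[OF k3] that by blast
  show "phiO (t - 1) a b c (Suc i) = dunkl_num (k 1) (Suc (0 + i)) * dunkl_num (k 3) (n - (0 + i))" if "i < t - 1" for i
    using that le[of i] by (cases "even i") (simp_all add: simps field_simps)
  fix i assume i0: "i \<le> t - 1"
  note i = i0 le[OF i0]
  show "(-1) ^ (0 + i) * (dunkl_num (k 1) (0 + i) + 1 / 2 + of_real (k 2)) + of_real (k 1) = (-1) ^ 0 * theta (t - 1) a i"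
    using i by (cases "even i") (simp_all add: simps field_simps)
  show "(-1) ^ (0 + i) * (dunkl_num (k 3) (n - (0 + i)) + 1 / 2 + of_real (k 2)) + of_real (k 3) = - ((-1) ^ 0) * theta (t - 1) b i"
    using i by (cases "even i") (simp_all add: simps field_simps)
  show "1 / 2 + (of_real (k 1) + of_real (k 3)) * (-1) ^ (0 + i)
      = - (2 * theta (t - 1) a i * theta (t - 1) b i + phiO (t - 1) a b c i + phiO (t - 1) a b c (Suc i) - kapO (t - 1) a b c)"
    using i by (cases "even i") (simp_all add: simps field_simps power2_eq_square)
qed

thm_deps theta_even shifted_theta_phi BI_params_E BI_params_O bidiagX_eq_trunc verma_XXY split_chain
  lin_on_bidiag lin_on_comb comb_triangular BI_params_sum_neq_0 bidiagZ_supp_le bidiagZ_base theta_Suc_neq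
  continuous_on_bidiagZ bimod_iso_swap_XZ phiE_top chain_neg_eq_0 bimod_iso_common_source
  bimod_iso_swap_reverse Emod_twist_iso bidiag_submodule_leading irreducible_bidiag_mod
  irreducible_twist_sgn_123 theta_last_neq W1_simple W2_simple dirac_apply Mn_eq_0_of_restriction opZ_apply
  restr_opX lin_on_split_coord split_scale_nonzero restr_prescribed Mnx_iff_restr car_dsum2_split_mod
  split_coord_onto Mxmod_iso Mmod_quot_iso split_coordinates_E split_coordinates_O

theorem theorem7p8:
  fixes k :: "nat \<Rightarrow> real" and n t1 :: nat and K :: real
    and W1 W2 :: "nat bimod"
  assumes "even n"
    and "tpar (k 1) = enat t1" and "t1 \<le> n"
    and "enat n < tpar (k 2)" and "enat n < tpar (k 3)"
    and "K = k 1 + k 2 + k 3"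
    and "W1 = twist_sgn_123 (-1) 1 (-1)
               (Emod (n - t1) (k 2 + (real n + 1) / 2) (- K - (real n + 1) / 2) (- k 3 - (real n + 1) / 2))"
    and "W2 = twist_sgn_123 1 (-1) (-1)
               (Omod (t1 - 1) (k 2) (- K - real n - 1) (- k 3))"
  shows "bimod_iso (Mxmod k n 1) (dsum2 W1)
         \<and> quot_iso (Mmod k n) (Mxmod k n 1) (dsum2 W2)
         \<and> (k 2 \<ge> 0 \<and> k 3 \<ge> 0 \<longrightarrow>
           irreducible_mod W1 \<and> irreducible_mod W2
           \<and> bimod_iso W1 (twist_sgn 1 (-1) (-1)
                 (Emod (n - t1) (K + (real n + 1) / 2) (k 3 + (real n + 1) / 2) (k 2 + (real n + 1) / 2)))
           \<and> bimod_iso W2 (Omod (t1 - 1) (K + real n + 1) (k 3) (k 2)))"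
proof -
  note t = tpar_eq_enat[OF assms(2)]
  have K: "K = - real t1 / 2 + k 2 + k 3" using assms(6) t(2) by simp
  \<comment> \<open>\<open>t1\<close> is odd, hence positive, so the subtraction in
    \<open>t1 - 1\<close> is not truncated.\<close>
  have t0: "Suc (t1 - 1) = t1" using t(1) by (cases t1) auto
  note E = split_coordinates_E[OF assms(1) t(1) assms(3) t(2) assms(6,5)]
  note O = split_coordinates_O[OF assms(1) t(1) assms(3) t(2) assms(6,5)]
  have s: "(-1) ^ t1 = (-1 :: complex)" using t(1) by simp
  have t2: "tpar (k 1) = enat (Suc (t1 - 1))" and t3: "Suc (t1 - 1) \<le> n" using assms(2,3) t0 by simp_all
  have "bimod_iso (Mxmod k n 1) (dsum2 W1)"
    using Mxmod_iso[OF E assms(2) le_add_diff_inverse[OF assms(3)] assms(4)]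
    unfolding split_mod_def assms(7) Emod_eq s minus_minus .
  moreover have "quot_iso (Mmod k n) (Mxmod k n 1) (dsum2 W2)"
    using Mmod_quot_iso[OF O t2 t3 assms(4)]
    unfolding split_mod_def assms(8) Omod_eq power_0 .
  moreover have "irreducible_mod W1 \<and> irreducible_mod W2
           \<and> bimod_iso W1 (twist_sgn 1 (-1) (-1)
                 (Emod (n - t1) (K + (real n + 1) / 2) (k 3 + (real n + 1) / 2) (k 2 + (real n + 1) / 2)))
           \<and> bimod_iso W2 (Omod (t1 - 1) (K + real n + 1) (k 3) (k 2))" if "k 2 \<ge> 0 \<and> k 3 \<ge> 0"
    using W1_simple[OF assms(1) t(1) assms(3) K] W2_simple[OF t(1) assms(3) K] that
    unfolding assms(7,8) by blast
  ultimately show ?thesis by blast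
qed

end
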